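(* Let $N\ge 2$, let $B_1\subset\mathbb{R}^N$ be the open unit ball, and let $p>1$. Then for every integer $k\ge 2$, $$\lambda_k(B_1;p)<\mu_k(p).$$
   Context: For a bounded Lipschitz domain $\Omega\subset\mathbb{R}^N$ and $p>1$, let $\mathcal{S}=\{u\in W_0^{1,p}(\Omega):\|u\|_{L^p(\Omega)}=1\}$, and for $k\in\mathbb{N}$ let $\mathcal{F}_k$ be the family of sets $\mathcal{A}\subset\mathcal{S}$ of the form $\mathcal{A}=h(\mathcal{S}^{k-1})$, where $\mathcal{S}^{k-1}$ is the unit sphere in $\mathbb{R}^k$ and $h:\mathcal{S}^{k-1}\to\mathcal{S}$ is continuous and odd. Define the variational eigenvalues of the Dirichlet $p$-Laplacian $-\Delta_p u=-\mathrm{div}(|\nabla u|^{p-2}\nabla u)$ by $$\lambda_k(\Omega;p)=\inf_{\mathcal{A}\in\mathcal{F}_k}\sup_{u\in\mathcal{A}}\int_\Omega|\nabla u|^p\,dx.$$ The radial eigenvalues $\mu_1(p)<\mu_2(p)<\dots$ are the numbers $\mu$ for which the problem $-(r^{N-1}|u'|^{p-2}u')'=\mu r^{N-1}|u|^{p-2}u$ on $(0,1)$, $u'(0)=0$, $u(1)=0$, has a nontrivial solution, listed in increasing order; an eigenfunction of $\mu_k(p)$ has exactly $k-1$ zeros in $(0,1)$. *)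

theory Defs
  imports "HOL-Analysis.Analysis"
begin

definition partial_d :: "'n::finite \<Rightarrow> (real^'n \<Rightarrow> real) \<Rightarrow> real^'n \<Rightarrow> real" where
  "partial_d i f x = deriv (\<lambda>t. f (x + t *\<^sub>R axis i 1)) 0"

fun iter_partial :: "'n::finite list \<Rightarrow> (real^'n \<Rightarrow> real) \<Rightarrow> real^'n \<Rightarrow> real" where
  "iter_partial [] f = f"
| "iter_partial (i # is) f = partial_d i (iter_partial is f)"

definition smooth :: "(real^'n::finite \<Rightarrow> real) \<Rightarrow> bool" where
  "smooth f \<longleftrightarrow> (\<forall>is. continuous_on UNIV (iter_partial is f) \<and>
      (\<forall>i x. (\<lambda>t. iter_partial is f (x + t *\<^sub>R axis i 1)) differentiable (at 0)))"

definition test_fun :: "(real^'n::finite) set \<Rightarrow> (real^'n \<Rightarrow> real) set" where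
  "test_fun \<Omega> = {\<phi>. smooth \<phi> \<and> compact (closure {x. \<phi> x \<noteq> 0}) \<and> closure {x. \<phi> x \<noteq> 0} \<subseteq> \<Omega>}"

definition Lp_fun :: "(real^'n::finite) set \<Rightarrow> real \<Rightarrow> (real^'n \<Rightarrow> real) \<Rightarrow> bool" where
  "Lp_fun \<Omega> p f \<longleftrightarrow> f \<in> borel_measurable (lebesgue_on \<Omega>) \<and>
      integrable (lebesgue_on \<Omega>) (\<lambda>x. \<bar>f x\<bar> powr p)"

definition Lp_vec :: "(real^'n::finite) set \<Rightarrow> real \<Rightarrow> (real^'n \<Rightarrow> real^'n) \<Rightarrow> bool" where
  "Lp_vec \<Omega> p g \<longleftrightarrow> g \<in> borel_measurable (lebesgue_on \<Omega>) \<and>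
      integrable (lebesgue_on \<Omega>) (\<lambda>x. norm (g x) powr p)"

definition weak_grad :: "(real^'n::finite) set \<Rightarrow> (real^'n \<Rightarrow> real) \<Rightarrow> (real^'n \<Rightarrow> real^'n) \<Rightarrow> bool" where
  "weak_grad \<Omega> u g \<longleftrightarrow> (\<forall>\<phi>\<in>test_fun \<Omega>. \<forall>i.
      (LINT x|lebesgue_on \<Omega>. u x * partial_d i \<phi> x) = - (LINT x|lebesgue_on \<Omega>. g x $ i * \<phi> x))"

definition W1p :: "(real^'n::finite) set \<Rightarrow> real \<Rightarrow> (real^'n \<Rightarrow> real) \<Rightarrow> bool" where
  "W1p \<Omega> p u \<longleftrightarrow> Lp_fun \<Omega> p u \<and> (\<exists>g. Lp_vec \<Omega> p g \<and> weak_grad \<Omega> u g)"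

definition wgrad :: "(real^'n::finite) set \<Rightarrow> real \<Rightarrow> (real^'n \<Rightarrow> real) \<Rightarrow> real^'n \<Rightarrow> real^'n" where
  "wgrad \<Omega> p u = (SOME g. Lp_vec \<Omega> p g \<and> weak_grad \<Omega> u g)"

definition wdist :: "(real^'n::finite) set \<Rightarrow> real \<Rightarrow> (real^'n \<Rightarrow> real) \<Rightarrow> (real^'n \<Rightarrow> real) \<Rightarrow> real" where
  "wdist \<Omega> p u v = (LINT x|lebesgue_on \<Omega>. \<bar>u x - v x\<bar> powr p)
      + (LINT x|lebesgue_on \<Omega>. norm (wgrad \<Omega> p (\<lambda>y. u y - v y) x) powr p)"

definition W01p :: "(real^'n::finite) set \<Rightarrow> real \<Rightarrow> (real^'n \<Rightarrow> real) \<Rightarrow> bool" where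
  "W01p \<Omega> p u \<longleftrightarrow> W1p \<Omega> p u \<and>
     (\<exists>\<phi>s. (\<forall>j. \<phi>s j \<in> test_fun \<Omega>) \<and> (\<lambda>j. wdist \<Omega> p (\<phi>s j) u) \<longlonglongrightarrow> 0)"

definition energy :: "(real^'n::finite) set \<Rightarrow> real \<Rightarrow> (real^'n \<Rightarrow> real) \<Rightarrow> real" where
  "energy \<Omega> p u = (LINT x|lebesgue_on \<Omega>. norm (wgrad \<Omega> p u x) powr p)"

definition Ssph :: "(real^'n::finite) set \<Rightarrow> real \<Rightarrow> (real^'n \<Rightarrow> real) set" where
  "Ssph \<Omega> p = {u. W01p \<Omega> p u \<and> (LINT x|lebesgue_on \<Omega>. \<bar>u x\<bar> powr p) = 1}"

text \<open>Unit sphere S^{k-1} of R^k, with R^k represented as functions nat => real vanishing from k on.\<close>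
definition sphk :: "nat \<Rightarrow> (nat \<Rightarrow> real) set" where
  "sphk k = {x. (\<forall>i\<ge>k. x i = 0) \<and> (\<Sum>i<k. (x i)\<^sup>2) = 1}"

definition distk :: "nat \<Rightarrow> (nat \<Rightarrow> real) \<Rightarrow> (nat \<Rightarrow> real) \<Rightarrow> real" where
  "distk k x y = sqrt (\<Sum>i<k. (x i - y i)\<^sup>2)"

definition Fk :: "(real^'n::finite) set \<Rightarrow> real \<Rightarrow> nat \<Rightarrow> (real^'n \<Rightarrow> real) set set" where
  "Fk \<Omega> p k = {h ` sphk k | h.
      (\<forall>y\<in>sphk k. h y \<in> Ssph \<Omega> p) \<and>
      (\<forall>y\<in>sphk k. h (- y) = (\<lambda>x. - h y x)) \<and>
      (\<forall>y\<in>sphk k. \<forall>e>0. \<exists>d>0. \<forall>z\<in>sphk k. distk k z y < d \<longrightarrow> wdist \<Omega> p (h z) (h y) < e)}"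

definition lambda_var :: "(real^'n::finite) set \<Rightarrow> real \<Rightarrow> nat \<Rightarrow> real" where
  "lambda_var \<Omega> p k = Inf ((\<lambda>A. Sup (energy \<Omega> p ` A)) ` Fk \<Omega> p k)"

definition phi_p :: "real \<Rightarrow> real \<Rightarrow> real" where
  "phi_p p t = sgn t * \<bar>t\<bar> powr (p - 1)"

definition radial_eig :: "nat \<Rightarrow> real \<Rightarrow> real \<Rightarrow> bool" where
  "radial_eig N p \<mu> \<longleftrightarrow> (\<exists>u u'.
      (\<forall>r\<in>{0..1}. (u has_real_derivative u' r) (at r within {0..1})) \<and>
      continuous_on {0..1} u' \<and> u' 0 = 0 \<and> u 1 = 0 \<and> (\<exists>r\<in>{0..1}. u r \<noteq> 0) \<and>
      (\<forall>r\<in>{0<..<1}. ((\<lambda>s. s ^ (N - 1) * phi_p p (u' s)) has_real_derivative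
            (- \<mu> * r ^ (N - 1) * phi_p p (u r))) (at r)))"

text \<open>mu_k: the k-th smallest radial eigenvalue (k >= 1).\<close>
definition mu_rad :: "nat \<Rightarrow> real \<Rightarrow> nat \<Rightarrow> real" where
  "mu_rad N p k = (THE \<mu>. radial_eig N p \<mu> \<and> card {\<nu>. radial_eig N p \<nu> \<and> \<nu> < \<mu>} = k - 1)"

end

theory Submission
  imports Defs "HOL-Complex_Analysis.Great_Picard"
begin

text \<open>Let \<open>U\<close> solve the radial equation with \<open>\<mu> = 1\<close> and let \<open>0 < z 1 < z 2 < \<dots>\<close> be its zeros. By
  Sturm comparison the number of zeros of an eigenfunction is strictly increasing in the
  eigenvalue, so the \<open>k\<close>-th radial eigenvalue is \<open>\<mu> = z k powr p\<close>, with an eigenfunction that is a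
  rescaling of \<open>U\<close>. It remains to find \<open>k\<close> functions with disjoint supports in the ball whose
  Rayleigh quotients are all less than \<open>\<mu>\<close>: their odd combinations form an admissible set.
  The \<open>k\<close> pieces of the radial eigenfunction have quotient exactly \<open>\<mu>\<close>. Move the ball that carries
  the first \<open>k - 1\<close> of them off centre. The last piece, cut at its maximum into an increasing part
  that moves along with that ball and a decreasing part that stays, is replaced by the minimum
  of the two parts, which lowers its quotient strictly. This leaves room to dilate the ball
  slightly, which lowers the other quotients.\<close>

section \<open>The radial equation\<close>

text \<open>Why the minimum gains: let A be the increasing part, extended by the maximum M outwards,
  and B the decreasing part, extended by M inwards. Pointwise min(A,B)^p + max(A,B)^p = A^p + B^p,
  and moving A changes neither its energy nor the integral of M^p - A^p. For concentric parts
  max(A,B) = M everywhere; after the move max(A,B) < M on an open set, so the p-th power of the norm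
  grows by the integral of M^p - max(A,B)^p, while the energy, taken from one part at each point,
  does not grow. This gain belongs to one function only. Truncating that function at a small height
  spends some of the gain on a gap around the moved ball; the dilation into the gap then makes the
  other k - 1 equalities strict. Two obstacles shape the rest. The equation is singular at 0 and
  \<open>phi_p\<close> or its inverse may fail to be Lipschitz, so existence comes from compactness
  and uniqueness is proved for zero data only, by an energy. The competitors are merely Lipschitz
  with touching supports, while \<open>energy\<close> refers to an arbitrarily chosen weak gradient;
  they are truncated and mollified into test functions, whose weak gradient is a.e. the classical
  one.\<close>

lemma powr_tangent_le:
  fixes p X Y :: real
  assumes "p > 1" "X \<ge> 0" "Y \<ge> 0"
  shows "Y powr p + p * Y powr (p - 1) * (X - Y) \<le> X powr p"
proof (cases "Y = 0")
  case True
  then show ?thesis using assms by simp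
next
  case Y0: False
  then have Y: "Y > 0" using assms by simp
  show ?thesis
  \<comment> \<open>Convexity is applied on the open half-line, where the power is differentiable;
    the boundary value X = 0 is computed directly.\<close>
  proof (cases "X = 0")
    case True
    have "Y powr (p - 1) * Y = Y powr p"
      using Y powr_mult_base [of Y "p - 1"] by (simp add: mult.commute)
    then have "Y powr p + p * Y powr (p - 1) * (X - Y) = (1 - p) * Y powr p"
      using True by (simp add: algebra_simps)
    also have "\<dots> \<le> 0" using assms by (simp add: mult_le_0_iff)
    finally show ?thesis using True assms by simp
  next
    case False
    have "X powr p - Y powr p \<ge> (p * Y powr (p - 1)) * (X - Y)"
    proof (rule convex_on_imp_above_tangent [where f = "\<lambda>x. x powr p" and A = "{0<..}"])
      show "convex_on {0<..} (\<lambda>x. x powr p)"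
        using assms powr_convex by simp
      show "connected {0::real<..}" by simp
      show "Y \<in> interior {0<..}" using Y by (simp add: interior_open)
      show "X \<in> {0<..}" using assms False by simp
      show "((\<lambda>x. x powr p) has_real_derivative p * Y powr (p - 1)) (at Y within {0<..})"
        using Y by (auto intro!: derivative_eq_intros)
    qed
    then show ?thesis by (simp add: algebra_simps)
  qed
qed

section \<open>The signed power \<open>phi_p\<close>\<close>

lemma phi_p_0 [simp]: "phi_p p 0 = 0"
  by (simp add: phi_p_def)

lemma phi_p_minus: "phi_p p (- t) = - phi_p p t"
  by (simp add: phi_p_def sgn_minus)

lemma phi_p_mult: "phi_p p (a * b) = phi_p p a * phi_p p b"
  by (simp add: phi_p_def sgn_mult abs_mult powr_mult)

lemma phi_p_eq_0_iff [simp]: "phi_p p t = 0 \<longleftrightarrow> t = 0"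
  by (auto simp: phi_p_def sgn_if)

lemma phi_p_pos_iff [simp]: "phi_p p t > 0 \<longleftrightarrow> t > 0"
  by (auto simp: phi_p_def zero_less_mult_iff sgn_if)

lemma phi_p_neg_iff [simp]: "phi_p p t < 0 \<longleftrightarrow> t < 0"
  by (auto simp: phi_p_def mult_less_0_iff sgn_if)

lemma abs_phi_p: "\<bar>phi_p p t\<bar> = \<bar>t\<bar> powr (p - 1)"
  by (cases "t = 0") (auto simp: phi_p_def abs_mult abs_sgn_eq)

lemma phi_p_times_self:
  assumes "p > 1" shows "phi_p p t * t = \<bar>t\<bar> powr p"
proof (cases "t = 0")
  case False
  have "phi_p p t * t = \<bar>t\<bar> powr (p - 1) * \<bar>t\<bar> powr 1"
    using False by (simp add: phi_p_def sgn_if)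
  also have "\<dots> = \<bar>t\<bar> powr p"
    by (simp only: powr_add [symmetric]) simp
  finally show ?thesis .
qed (use assms in auto)

lemma phi_p_inverse:
  assumes "(p - 1) * (q - 1) = 1" shows "phi_p q (phi_p p t) = t"
proof (cases "t = 0")
  case False
  have "phi_p q (phi_p p t) = sgn t * (\<bar>t\<bar> powr (p - 1)) powr (q - 1)"
    using False by (simp add: phi_p_def [of q] abs_phi_p) (simp add: phi_p_def sgn_mult)
  then show ?thesis
    using False assms by (simp add: powr_powr sgn_mult_abs)
qed simp

text \<open>The definition contains the discontinuous factor \<open>sgn\<close>; written as a
  difference of powers of the positive and the negative part, the function is visibly continuous
  through 0.\<close>

lemma continuous_on_phi_p:
  assumes "p > 1" "continuous_on S f" shows "continuous_on S (\<lambda>x. phi_p p (f x))"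
proof -
  have "phi_p p t = max t 0 powr (p - 1) - max (- t) 0 powr (p - 1)" for t
    using assms by (auto simp: phi_p_def sgn_if max_def)
  then show ?thesis
    using assms by (auto intro!: continuous_intros continuous_on_powr')
qed

lemma isCont_phi_p: "p > 1 \<Longrightarrow> isCont (phi_p p) t"
  using continuous_on_phi_p [of p UNIV "\<lambda>x. x"] by (simp add: continuous_on_eq_continuous_at)

lemma tendsto_phi_p:
  "p > 1 \<Longrightarrow> (f \<longlongrightarrow> l) F \<Longrightarrow> ((\<lambda>x. phi_p p (f x)) \<longlongrightarrow> phi_p p l) F"
  by (rule isCont_tendsto_compose [OF isCont_phi_p])

text \<open>Away from 0 this is the power rule on each side. At 0 the difference quotient with step
  h is \<open>phi_p p h\<close> itself, which tends to 0.\<close>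

lemma has_derivative_abs_powr:
  fixes t :: real
  assumes "p > 1"
  shows "((\<lambda>x. \<bar>x\<bar> powr p) has_real_derivative p * phi_p p t) (at t)"
proof -
  consider "t > 0" | "t < 0" | "t = 0" by linarith
  then show ?thesis
  proof cases
    case 1
    have "((\<lambda>x. x powr p) has_real_derivative p * phi_p p t) (at t)"
      using 1 by (auto intro!: derivative_eq_intros simp: phi_p_def)
    then show ?thesis
      by (rule has_field_derivative_transform_within_open [of _ _ _ "{0<..}"]) (use 1 in auto)
  next
    case 2
    have "((\<lambda>x. (- x) powr p) has_real_derivative p * phi_p p t) (at t)"
      using 2 by (auto intro!: derivative_eq_intros simp: phi_p_def)
    then show ?thesis
      by (rule has_field_derivative_transform_within_open [of _ _ _ "{..<0}"]) (use 2 in auto)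
  next
    case 3
    have "((\<lambda>h. phi_p p h) \<longlongrightarrow> 0) (at 0)"
      using tendsto_phi_p [OF assms tendsto_ident_at [of 0 UNIV]] by simp
    then have "((\<lambda>h. (\<bar>0 + h\<bar> powr p - \<bar>0::real\<bar> powr p) / h) \<longlongrightarrow> 0) (at 0)"
    proof (rule Lim_transform_eventually)
      have "phi_p p h = (\<bar>0 + h\<bar> powr p - \<bar>0\<bar> powr p) / h" if "h \<noteq> 0" for h
        using phi_p_times_self [OF assms, of h] that by (simp add: eq_divide_eq)
      then show "\<forall>\<^sub>F h in at 0. phi_p p h = (\<bar>0 + h\<bar> powr p - \<bar>0\<bar> powr p) / h"
        by (auto simp: eventually_at_filter)
    qed
    then show ?thesis using 3 by (simp add: DERIV_def)
  qed
qed

text \<open>The point 0 is excluded because for p < 2 the graph has a vertical tangent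
  there.\<close>

lemma has_derivative_phi_p:
  fixes t :: real
  assumes "t \<noteq> 0"
  shows "(phi_p p has_real_derivative (p - 1) * \<bar>t\<bar> powr (p - 2)) (at t)"
proof (cases "t > 0")
  case True
  have "((\<lambda>x. x powr (p - 1)) has_real_derivative (p - 1) * \<bar>t\<bar> powr (p - 2)) (at t)"
    using True by (auto intro!: derivative_eq_intros simp: algebra_simps)
  then show ?thesis
    by (rule has_field_derivative_transform_within_open [of _ _ _ "{0<..}"])
       (use True in \<open>auto simp: phi_p_def\<close>)
next
  case False
  then have t: "t < 0" using assms by simp
  have "((\<lambda>x. - ((- x) powr (p - 1))) has_real_derivative (p - 1) * \<bar>t\<bar> powr (p - 2)) (at t)"
    using t by (auto intro!: derivative_eq_intros simp: algebra_simps)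
  then show ?thesis
    by (rule has_field_derivative_transform_within_open [of _ _ _ "{..<0}"])
       (use t in \<open>auto simp: phi_p_def\<close>)
qed

section \<open>Solutions of the radial equation on an interval \<open>{0..R}\<close>\<close>

text \<open>The differential part of \<open>radial_eig\<close>, without u 1 = 0 and nontriviality
  and on an interval of any length: one solution on a long interval then yields eigenfunctions by
  rescaling.\<close>

definition radsol :: "nat \<Rightarrow> real \<Rightarrow> real \<Rightarrow> real \<Rightarrow> (real \<Rightarrow> real) \<Rightarrow> (real \<Rightarrow> real) \<Rightarrow> bool" where
  "radsol N p \<mu> R u u' \<longleftrightarrow>
      (\<forall>r\<in>{0..R}. (u has_real_derivative u' r) (at r within {0..R})) \<and>
      continuous_on {0..R} u' \<and> u' 0 = 0 \<and>
      (\<forall>r\<in>{0<..<R}. ((\<lambda>s. s ^ (N - 1) * phi_p p (u' s)) has_real_derivative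
            (- \<mu> * r ^ (N - 1) * phi_p p (u r))) (at r))"

lemma radial_eig_iff:
  "radial_eig N p \<mu> \<longleftrightarrow> (\<exists>u u'. radsol N p \<mu> 1 u u' \<and> u 1 = 0 \<and> (\<exists>r\<in>{0..1}. u r \<noteq> 0))"
  unfolding radial_eig_def radsol_def
  by (intro ex_cong1 iffI; elim conjE; intro conjI; assumption)

context
  fixes N :: nat and p \<mu> R :: real and u u' :: "real \<Rightarrow> real"
  assumes p: "p > 1" and sol: "radsol N p \<mu> R u u'"
begin

lemma radsol_deriv_within: "r \<in> {0..R} \<Longrightarrow> (u has_real_derivative u' r) (at r within {0..R})"
  using sol by (auto simp: radsol_def)

lemma radsol_deriv:
  assumes "r \<in> {0<..<R}" shows "(u has_real_derivative u' r) (at r)"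
proof -
  have "(u has_real_derivative u' r) (at r within {0<..<R})"
    using assms by (intro DERIV_subset [OF radsol_deriv_within]) auto
  moreover have "at r within {0<..<R} = at r"
    by (rule at_within_open [OF assms open_greaterThanLessThan])
  ultimately show ?thesis by (simp only:)
qed

lemma radsol_cont: "continuous_on {0..R} u"
  by (rule DERIV_continuous_on [OF radsol_deriv_within])

lemma radsol_cont': "continuous_on {0..R} u'"
  using sol by (auto simp: radsol_def)

lemma radsol_deriv0: "u' 0 = 0"
  using sol by (auto simp: radsol_def)

lemma radsol_flux_deriv:
  "r \<in> {0<..<R} \<Longrightarrow> ((\<lambda>s. s ^ (N - 1) * phi_p p (u' s)) has_real_derivative
            (- \<mu> * r ^ (N - 1) * phi_p p (u r))) (at r)"
  using sol by (auto simp: radsol_def)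

text \<open>Dividing the flux by s^(N-1) gives the non-divergence form, in which the term with
  (N-1)/r acts as friction.\<close>

lemma radsol_phi_deriv:
  assumes "r \<in> {0<..<R}"
  shows "((\<lambda>s. phi_p p (u' s)) has_real_derivative
            (- \<mu> * phi_p p (u r) - real (N - 1) / r * phi_p p (u' r))) (at r)"
proof -
  have r: "r > 0" using assms by simp
  have "((\<lambda>s. s ^ (N - 1) * phi_p p (u' s) / s ^ (N - 1)) has_real_derivative
     ((- \<mu> * r ^ (N - 1) * phi_p p (u r)) * r ^ (N - 1)
       - (r ^ (N - 1) * phi_p p (u' r)) * (real (N - 1) * r ^ (N - 1 - 1))) / (r ^ (N - 1) * r ^ (N - 1))) (at r)"
    using assms r by (intro DERIV_divide radsol_flux_deriv) (auto intro!: derivative_eq_intros)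
  moreover have "((- \<mu> * r ^ (N - 1) * phi_p p (u r)) * r ^ (N - 1)
       - (r ^ (N - 1) * phi_p p (u' r)) * (real (N - 1) * r ^ (N - 1 - 1))) / (r ^ (N - 1) * r ^ (N - 1))
      = - \<mu> * phi_p p (u r) - real (N - 1) / r * phi_p p (u' r)"
  \<comment> \<open>The exponent N - 1 - 1 is truncated when N - 1 = 0, but then its coefficient
    \<open>real (N - 1)\<close> vanishes.\<close>
  proof (cases "N - 1")
    case (Suc m)
    then show ?thesis using r by (simp add: field_simps)
  qed (use r in auto)
  ultimately have "((\<lambda>s. s ^ (N - 1) * phi_p p (u' s) / s ^ (N - 1)) has_real_derivative
      (- \<mu> * phi_p p (u r) - real (N - 1) / r * phi_p p (u' r))) (at r)"
    by simp
  then show ?thesis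
    by (rule has_field_derivative_transform_within_open [of _ _ _ "{0<..}"]) (use r in auto)
qed

text \<open>A first integral of the equation for N = 1; in general the friction term makes it
  non-increasing.\<close>

definition radsol_energy :: "real \<Rightarrow> real" where
  "radsol_energy r = (p - 1) * \<bar>u' r\<bar> powr p + \<mu> * \<bar>u r\<bar> powr p"

lemma radsol_energy_cont: "continuous_on {0..R} radsol_energy"
  unfolding radsol_energy_def using p radsol_cont radsol_cont'
  by (auto intro!: continuous_intros continuous_on_powr')

text \<open>The power \<open>\<bar>u'\<bar> powr p\<close> is differentiated as a power of the flux, since \<open>u'\<close> itself
  need not be differentiable.\<close>

lemma radsol_energy_deriv:
  assumes "r \<in> {0<..<R}"
  shows "(radsol_energy has_real_derivative - p * real (N - 1) / r * \<bar>u' r\<bar> powr p) (at r)"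
proof -
  define q where "q = p / (p - 1)"
  have q: "q > 1" "(p - 1) * (q - 1) = 1" "(p - 1) * q = p"
    using p by (auto simp: q_def field_simps)
  have eq: "\<bar>u' s\<bar> powr p = \<bar>phi_p p (u' s)\<bar> powr q" for s
    by (simp add: abs_phi_p powr_powr q)
  have 1: "((\<lambda>s. \<bar>phi_p p (u' s)\<bar> powr q) has_real_derivative
     (q * phi_p q (phi_p p (u' r))) * (- \<mu> * phi_p p (u r) - real (N - 1) / r * phi_p p (u' r))) (at r)"
    by (rule DERIV_chain2 [OF has_derivative_abs_powr [OF q(1)] radsol_phi_deriv [OF assms]])
  have 2: "((\<lambda>s. \<bar>u s\<bar> powr p) has_real_derivative (p * phi_p p (u r)) * u' r) (at r)"
    by (rule DERIV_chain2 [OF has_derivative_abs_powr [OF p] radsol_deriv [OF assms]])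
  have "(radsol_energy has_real_derivative
      (p - 1) * ((q * phi_p q (phi_p p (u' r))) * (- \<mu> * phi_p p (u r) - real (N - 1) / r * phi_p p (u' r)))
      + \<mu> * ((p * phi_p p (u r)) * u' r)) (at r)"
    unfolding radsol_energy_def eq by (intro DERIV_add DERIV_cmult 1 2)
  moreover have "(p - 1) * ((q * phi_p q (phi_p p (u' r))) * (- \<mu> * phi_p p (u r) - real (N - 1) / r * phi_p p (u' r)))
      + \<mu> * ((p * phi_p p (u r)) * u' r) = - p * real (N - 1) / r * \<bar>u' r\<bar> powr p"
  proof -
    have "(p - 1) * ((q * phi_p q (phi_p p (u' r))) * (- \<mu> * phi_p p (u r) - real (N - 1) / r * phi_p p (u' r)))
       = ((p - 1) * q) * (u' r * (- \<mu> * phi_p p (u r) - real (N - 1) / r * phi_p p (u' r)))"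
      by (simp add: phi_p_inverse q(2))
    also have "\<dots> = p * (- \<mu> * phi_p p (u r) * u' r - real (N - 1) / r * (phi_p p (u' r) * u' r))"
      by (simp only: q(3)) (simp add: algebra_simps)
    finally have "(p - 1) * ((q * phi_p q (phi_p p (u' r))) * (- \<mu> * phi_p p (u r) - real (N - 1) / r * phi_p p (u' r)))
       = p * (- \<mu> * phi_p p (u r) * u' r - real (N - 1) / r * \<bar>u' r\<bar> powr p)"
      by (simp only: phi_p_times_self [OF p])
    then show ?thesis
      by (simp only: ring_distribs) (simp add: mult_ac)
  qed
  ultimately show ?thesis by simp
qed

text \<open>Uniqueness for zero Cauchy data at any r0, by energy. To the right of r0 the energy E
  cannot grow. To the left, r^m * E is nondecreasing for a suitable m, so E vanishes on (0, r0) and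
  u 0 = 0 by continuity. Since u' 0 = 0 always holds, E vanishes at 0 and hence everywhere.\<close>

lemma radsol_zero:
  assumes mu: "\<mu> > 0" and R: "R > 0"
    and r0: "r0 \<in> {0..R}" "u r0 = 0" "u' r0 = 0" and r: "r \<in> {0..R}"
  shows "u r = 0"
proof -
  have nonneg: "radsol_energy s \<ge> 0" for s
    using p mu by (simp add: radsol_energy_def)
  have E0: "radsol_energy s = 0 \<Longrightarrow> u s = 0" for s
  proof -
    assume "radsol_energy s = 0"
    moreover have "0 \<le> (p - 1) * \<bar>u' s\<bar> powr p" "0 \<le> \<mu> * \<bar>u s\<bar> powr p"
      using p mu by auto
    ultimately have "\<mu> * \<bar>u s\<bar> powr p = 0"
      unfolding radsol_energy_def by linarith
    then show "u s = 0" using mu by auto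
  qed
  have decr: "radsol_energy t \<le> radsol_energy s" if "0 \<le> s" "s \<le> t" "t \<le> R" for s t
  proof -
    show ?thesis using \<open>s \<le> t\<close>
    proof (rule DERIV_nonpos_imp_decreasing_open)
      fix x assume "s < x" "x < t"
      then show "\<exists>y. (radsol_energy has_real_derivative y) (at x) \<and> y \<le> 0"
      proof (intro exI conjI)
        show "(radsol_energy has_real_derivative - p * real (N - 1) / x * \<bar>u' x\<bar> powr p) (at x)"
          using that \<open>s < x\<close> \<open>x < t\<close> by (intro radsol_energy_deriv) auto
        have "0 \<le> p * real (N - 1) / x * \<bar>u' x\<bar> powr p"
          using that p \<open>s < x\<close> by (intro mult_nonneg_nonneg divide_nonneg_nonneg) auto
        then show "- p * real (N - 1) / x * \<bar>u' x\<bar> powr p \<le> 0" by simp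
      qed
    next
      show "continuous_on {s..t} radsol_energy"
        using that by (intro continuous_on_subset [OF radsol_energy_cont]) auto
    qed
  qed
  have "u 0 = 0"
  proof (cases "r0 = 0")
    case False
    then have r0': "0 < r0" using r0 by simp
    \<comment> \<open>The exponent for which m * (p - 1) * |u'|^p cancels the friction loss p * (N -
      1) * |u'|^p, leaving the nonnegative term m * \<mu> * |u|^p.\<close>
    define m where "m = p * real (N - 1) / (p - 1)"
    have m: "m \<ge> 0" "m * (p - 1) = p * real (N - 1)" using p by (auto simp: m_def)
    have zero: "radsol_energy s = 0" if s: "0 < s" "s < r0" for s
    proof -
      have "radsol_energy s * s powr m \<le> radsol_energy r0 * r0 powr m"
      proof (rule DERIV_nonneg_imp_increasing_open [OF less_imp_le [OF s(2)]])
        fix x assume x: "s < x" "x < r0"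
        have D: "((\<lambda>s. radsol_energy s * s powr m) has_real_derivative
           (- p * real (N - 1) / x * \<bar>u' x\<bar> powr p) * x powr m + m * x powr (m - 1) * radsol_energy x) (at x)"
          using x s r0 by (intro DERIV_mult radsol_energy_deriv has_real_derivative_powr) auto
        have e: "x powr (m - 1) = x powr m / x"
          using x s by (simp add: powr_diff)
        have "(- p * real (N - 1) / x * \<bar>u' x\<bar> powr p) * x powr m + m * x powr (m - 1) * radsol_energy x
            = x powr m / x * (m * radsol_energy x - p * real (N - 1) * \<bar>u' x\<bar> powr p)"
          using x s by (simp add: e field_simps)
        also have "m * radsol_energy x - p * real (N - 1) * \<bar>u' x\<bar> powr p = m * (\<mu> * \<bar>u x\<bar> powr p)"
        proof -
          have "m * radsol_energy x = (m * (p - 1)) * \<bar>u' x\<bar> powr p + m * (\<mu> * \<bar>u x\<bar> powr p)"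
            by (simp add: radsol_energy_def algebra_simps)
          then show ?thesis by (simp only: m(2))
        qed
        finally have "(- p * real (N - 1) / x * \<bar>u' x\<bar> powr p) * x powr m + m * x powr (m - 1) * radsol_energy x \<ge> 0"
          using x s m mu by simp
        with D show "\<exists>y. ((\<lambda>s. radsol_energy s * s powr m) has_real_derivative y) (at x) \<and> 0 \<le> y"
          by blast
      next
        show "continuous_on {s..r0} (\<lambda>s. radsol_energy s * s powr m)"
          using s r0 by (intro continuous_intros continuous_on_subset [OF radsol_energy_cont]) auto
      qed
      also have "radsol_energy r0 = 0" using r0 p by (simp add: radsol_energy_def)
      finally have "radsol_energy s \<le> 0" using s by (simp add: mult_le_0_iff)
      with nonneg [of s] show ?thesis by simp
    qed
    have "((\<lambda>s. u s) \<longlongrightarrow> u 0) (at 0 within {0..R})"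
      using radsol_cont R by (auto simp: continuous_on_def)
    then have 1: "(u \<longlongrightarrow> u 0) (at 0 within {0<..<r0})"
      by (rule tendsto_within_subset) (use r0 in auto)
    have 2: "(u \<longlongrightarrow> 0) (at 0 within {0<..<r0})"
      by (rule tendsto_eventually) (auto simp: eventually_at_topological intro!: exI [of _ UNIV] E0 zero)
    have "at 0 within {0<..<r0} \<noteq> bot"
      using r0' by (simp add: at_within_eq_bot_iff)
    from tendsto_unique [OF this 1 2] show ?thesis .
  qed (use r0 in simp)
  then have "radsol_energy 0 = 0"
    using p by (simp add: radsol_energy_def radsol_deriv0)
  with decr [of 0 r] r nonneg [of r] have "radsol_energy r = 0" by simp
  then show ?thesis by (rule E0)
qed

text \<open>At an accumulation point of zeros u vanishes by continuity, and difference quotients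
  taken along the zeros show that u' vanishes too, against \<open>radsol_zero\<close>.\<close>

lemma radsol_finite_zeros:
  assumes mu: "\<mu> > 0" and R: "R > 0" and nt: "r1 \<in> {0..R}" "u r1 \<noteq> 0"
  shows "finite {r\<in>{0..R}. u r = 0}"
proof (rule ccontr)
  let ?Z = "{r\<in>{0..R}. u r = 0}"
  assume inf: "infinite ?Z"
  have sub: "?Z \<subseteq> {0..R}" by auto
  obtain z where z: "z \<in> {0..R}" "z islimpt ?Z"
    using Heine_Borel_imp_Bolzano_Weierstrass [OF compact_Icc inf sub] by (rule bexE)
  have "closed ?Z"
    by (rule continuous_closed_preimage_constant [OF radsol_cont closed_atLeastAtMost])
  then have "z \<in> ?Z" using z(2) unfolding closed_limpt by iprover
  then have uz: "u z = 0" by simp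
  have "((\<lambda>s. (u s - u z) / (s - z)) \<longlongrightarrow> u' z) (at z within {0..R})"
    using radsol_deriv_within [OF z(1)] by (simp add: has_field_derivative_iff)
  then have 1: "((\<lambda>s. (u s - u z) / (s - z)) \<longlongrightarrow> u' z) (at z within ?Z)"
    by (rule tendsto_within_subset) auto
  have 2: "((\<lambda>s. (u s - u z) / (s - z)) \<longlongrightarrow> 0) (at z within ?Z)"
    by (rule tendsto_eventually) (auto simp: eventually_at_topological uz intro!: exI [of _ UNIV])
  have "at z within ?Z \<noteq> bot"
    using z(2) unfolding trivial_limit_within by simp
  from tendsto_unique [OF this 1 2] have "u' z = 0" .
  from radsol_zero [OF mu R z(1) uz this nt(1)] nt(2) show False by simp
qed

end

section \<open>Sturm comparison and the radial eigenvalues\<close>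

lemma radsol_at_0_nonzero:
  assumes "p > 1" "radsol N p \<mu> R u u'" "\<mu> > 0" "R > 0" "r1 \<in> {0..R}" "u r1 \<noteq> 0"
  shows "u 0 \<noteq> 0"
  using radsol_zero [OF assms(1-4), of 0 r1] radsol_deriv0 [OF assms(1,2)] assms by auto

lemma radsol_zero_simple:
  assumes "p > 1" "radsol N p \<mu> R u u'" "\<mu> > 0" "R > 0" "r1 \<in> {0..R}" "u r1 \<noteq> 0"
    and "r \<in> {0..R}" "u r = 0"
  shows "u' r \<noteq> 0"
  using radsol_zero [OF assms(1-4), of r r1] assms by auto

text \<open>At a common zero, dividing numerator and denominator by r - c turns the quotient into a
  quotient of difference quotients. In the Sturm comparison this controls u / v at end points where
  v has a simple zero.\<close>

lemma has_derivative_quotient_limit: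
  fixes u v :: "real \<Rightarrow> real"
  assumes u: "(u has_real_derivative a) (at c within S)" and v: "(v has_real_derivative b) (at c within S)"
    and "u c = 0" "v c \<noteq> 0 \<or> b \<noteq> 0"
  obtains L where "((\<lambda>r. u r / v r) \<longlongrightarrow> L) (at c within S)"
proof (cases "v c = 0")
  case False
  have "(u \<longlongrightarrow> u c) (at c within S)" "(v \<longlongrightarrow> v c) (at c within S)"
    using DERIV_continuous [OF u] DERIV_continuous [OF v] by (auto simp: continuous_within)
  then show ?thesis using that tendsto_divide False by blast
next
  case True
  with assms have b: "b \<noteq> 0" by simp
  have "((\<lambda>r. ((u r - u c) / (r - c)) / ((v r - v c) / (r - c))) \<longlongrightarrow> a / b) (at c within S)"
    using u v b by (intro tendsto_divide) (auto simp: has_field_derivative_iff)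
  then have "((\<lambda>r. u r / v r) \<longlongrightarrow> a / b) (at c within S)"
    by (rule Lim_transform_eventually) (simp add: eventually_at_filter True assms)
  then show ?thesis by (rule that)
qed

lemma phi_p_divide: "v \<noteq> 0 \<Longrightarrow> phi_p p (u / v) = phi_p p u / phi_p p v"
  using phi_p_mult [of p "u / v" v] by (simp add: field_simps)

text \<open>Young's inequality in the tangent form \<open>powr_tangent_le\<close>, with X = |d| and
  Y = |s * u|. In the application d is u' and s is v'/v.\<close>

lemma picone_bracket_nonneg:
  assumes "p > 1"
  shows "\<bar>d\<bar> powr p - p * phi_p p s * phi_p p u * d + (p - 1) * \<bar>s\<bar> powr p * \<bar>u\<bar> powr p \<ge> (0::real)"
proof -
  let ?Y = "\<bar>s * u\<bar>"
  have "phi_p p s * phi_p p u * d \<le> \<bar>phi_p p (s * u) * d\<bar>"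
    by (simp add: phi_p_mult)
  also have "\<dots> = ?Y powr (p - 1) * \<bar>d\<bar>"
    by (simp add: abs_mult abs_phi_p)
  finally have 1: "p * (phi_p p s * phi_p p u * d) \<le> p * (?Y powr (p - 1) * \<bar>d\<bar>)"
    using assms by simp
  have 2: "?Y powr (p - 1) * ?Y = ?Y powr p"
    using powr_mult_base [of ?Y "p - 1"] by (simp add: mult.commute)
  have 3: "?Y powr p = \<bar>s\<bar> powr p * \<bar>u\<bar> powr p"
    by (simp add: abs_mult powr_mult)
  have "?Y powr p + p * ?Y powr (p - 1) * (\<bar>d\<bar> - ?Y) \<le> \<bar>d\<bar> powr p"
    using powr_tangent_le [OF assms, of "\<bar>d\<bar>" ?Y] by simp
  then have "?Y powr p + p * (?Y powr (p - 1) * \<bar>d\<bar>) - p * (?Y powr (p - 1) * ?Y) \<le> \<bar>d\<bar> powr p"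
    by (simp add: algebra_simps)
  with 1 show ?thesis unfolding 2 3 by (simp add: algebra_simps)
qed

text \<open>Picone's identity: \<open>P\<close> vanishes at both ends of a nodal interval of \<open>u\<close>, but would be
  strictly increasing if \<open>v\<close> had no zero there.\<close>

lemma sturm_comparison:
  assumes p: "p > 1" and u: "radsol N p \<nu> R u u'" and v: "radsol N p \<mu> R v v'"
    and less: "\<nu> < \<mu>" "0 < \<mu>" and R: "R > 0" and nt: "r1 \<in> {0..R}" "v r1 \<noteq> 0"
    and ab: "0 \<le> a" "a < b" "b \<le> R" "u b = 0" "a = 0 \<or> u a = 0"
    and ne: "\<And>r. a < r \<Longrightarrow> r < b \<Longrightarrow> u r \<noteq> 0"
  shows "\<exists>z\<in>{a<..<b}. v z = 0"
proof (rule ccontr)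
  assume "\<not> ?thesis"
  then have vne: "v r \<noteq> 0" if "a < r" "r < b" for r using that by auto
  note v0 = radsol_at_0_nonzero [OF p v less(2) R nt]
  \<comment> \<open>Since x / 0 = 0, Q vanishes at zeros of v. In \<open>{a..b}\<close> these can
    only be end points at which u vanishes as well, so this is also the limit value there.\<close>
  define Q where "Q r = \<bar>u r\<bar> powr p / phi_p p (v r)" for r
  define P where "P r = r ^ (N - 1) * phi_p p (u' r) * u r - r ^ (N - 1) * phi_p p (v' r) * Q r" for r
  \<comment> \<open>This form isolates u / v, which has a limit even at a common zero.\<close>
  have Qeq: "Q r = phi_p p (u r / v r) * u r" for r
  proof (cases "v r = 0")
    case False
    then show ?thesis
      by (simp add: Q_def phi_p_divide phi_p_times_self [OF p, symmetric])
  qed (simp add: Q_def)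
  have sub: "{a..b} \<subseteq> {0..R}" using ab by auto
  have Qcont: "continuous_on {a..b} Q"
    unfolding continuous_on_eq_continuous_within
  proof
    fix c assume c: "c \<in> {a..b}"
    have cR: "c \<in> {0..R}" using c sub by auto
    have du: "(u has_real_derivative u' c) (at c within {a..b})"
      by (rule DERIV_subset [OF radsol_deriv_within [OF p u cR] sub])
    have dv: "(v has_real_derivative v' c) (at c within {a..b})"
      by (rule DERIV_subset [OF radsol_deriv_within [OF p v cR] sub])
    have lu: "(u \<longlongrightarrow> u c) (at c within {a..b})" and lv: "(v \<longlongrightarrow> v c) (at c within {a..b})"
      using DERIV_continuous [OF du] DERIV_continuous [OF dv] by (auto simp: continuous_within)
    show "continuous (at c within {a..b}) Q"
    proof (cases "v c = 0")
      case False
      then have "((\<lambda>r. phi_p p (u r / v r) * u r) \<longlongrightarrow> phi_p p (u c / v c) * u c) (at c within {a..b})"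
        by (intro tendsto_mult tendsto_phi_p p tendsto_divide lu lv)
      then show ?thesis unfolding continuous_within Qeq .
    next
      case True
      then have "c \<noteq> 0" using v0 by auto
      moreover have "c = a \<or> c = b" using True vne [of c] c by fastforce
      ultimately have uc: "u c = 0" using ab by auto
      have "v' c \<noteq> 0" by (rule radsol_zero_simple [OF p v less(2) R nt cR True])
      then obtain L where L: "((\<lambda>r. u r / v r) \<longlongrightarrow> L) (at c within {a..b})"
        using has_derivative_quotient_limit [OF du dv uc] by blast
      have "((\<lambda>r. phi_p p (u r / v r) * u r) \<longlongrightarrow> phi_p p L * u c) (at c within {a..b})"
        by (intro tendsto_mult tendsto_phi_p p lu L)
      then show ?thesis unfolding continuous_within Qeq by (simp add: uc)
    qed
  qed
  have "continuous_on {a..b} u'" "continuous_on {a..b} v'" "continuous_on {a..b} u"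
    by (rule continuous_on_subset [OF radsol_cont' [OF p u] sub]
             continuous_on_subset [OF radsol_cont' [OF p v] sub]
             continuous_on_subset [OF radsol_cont [OF p u] sub])+
  then have Pcont: "continuous_on {a..b} P"
    unfolding P_def using Qcont p by (intro continuous_intros continuous_on_phi_p) auto
  have "P a < P b"
  proof (rule DERIV_pos_imp_increasing_open [OF ab(2) _ Pcont])
    fix r assume r: "a < r" "r < b"
    then have rR: "r \<in> {0<..<R}" and r0: "r > 0" using ab by auto
    have vr: "v r \<noteq> 0" and ur: "u r \<noteq> 0" using vne ne r by auto
    let ?n = "r ^ (N - 1)"
    let ?Q' = "((p * phi_p p (u r)) * u' r * phi_p p (v r)
        - \<bar>u r\<bar> powr p * ((p - 1) * \<bar>v r\<bar> powr (p - 2) * v' r)) / (phi_p p (v r) * phi_p p (v r))"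
    have dQ: "(Q has_real_derivative ?Q') (at r)"
      unfolding Q_def using vr
      by (intro DERIV_divide DERIV_chain2 [OF has_derivative_abs_powr [OF p] radsol_deriv [OF p u rR]]
          DERIV_chain2 [OF has_derivative_phi_p radsol_deriv [OF p v rR]]) auto
    have dP: "(P has_real_derivative
       (- \<nu> * ?n * phi_p p (u r)) * u r + u' r * (?n * phi_p p (u' r))
       - ((- \<mu> * ?n * phi_p p (v r)) * Q r + ?Q' * (?n * phi_p p (v' r)))) (at r)"
      unfolding P_def
      by (intro DERIV_diff DERIV_mult radsol_flux_deriv [OF p u rR] radsol_flux_deriv [OF p v rR]
          radsol_deriv [OF p u rR] dQ)
    \<comment> \<open>In terms of the logarithmic derivative s of v, the derivative of P is r^(N-1)
      times (\<mu> - \<nu>) * |u|^p plus the Picone bracket; the first term makes it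
      positive.\<close>
    define s where "s = v' r / v r"
    have phis: "phi_p p (v' r) = phi_p p s * phi_p p (v r)"
      using vr phi_p_mult [of p s "v r"] by (simp add: s_def)
    have vs: "v' r = s * v r" using vr by (simp add: s_def)
    have pv: "phi_p p (v r) \<noteq> 0" using vr by simp
    have e1: "phi_p p (v r) * Q r = \<bar>u r\<bar> powr p" using pv by (simp add: Q_def)
    have e2: "\<bar>v r\<bar> powr (p - 2) * v r = phi_p p (v r)"
    proof -
      have "\<bar>v r\<bar> powr (p - 1) = \<bar>v r\<bar> powr (p - 2) * \<bar>v r\<bar>"
        using powr_mult_base [of "\<bar>v r\<bar>" "p - 2"] by (simp add: mult.commute)
      then show ?thesis by (simp add: phi_p_def) (metis mult.commute mult.left_commute mult_sgn_abs)
    qed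
    have "?Q' * phi_p p (v' r) = p * phi_p p s * phi_p p (u r) * u' r
        - \<bar>u r\<bar> powr p * (p - 1) * (\<bar>v r\<bar> powr (p - 2) * v r) * s * phi_p p s / phi_p p (v r)"
      unfolding phis using pv by (simp add: vs field_simps)
    also have "\<dots> = p * phi_p p s * phi_p p (u r) * u' r - (p - 1) * (phi_p p s * s) * \<bar>u r\<bar> powr p"
      unfolding e2 using pv by simp
    finally have e3: "?Q' * phi_p p (v' r)
        = p * phi_p p s * phi_p p (u r) * u' r - (p - 1) * \<bar>s\<bar> powr p * \<bar>u r\<bar> powr p"
      by (simp only: phi_p_times_self [OF p])
    have "(- \<nu> * ?n * phi_p p (u r)) * u r + u' r * (?n * phi_p p (u' r))
       - ((- \<mu> * ?n * phi_p p (v r)) * Q r + ?Q' * (?n * phi_p p (v' r)))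
       = ?n * (- \<nu> * (phi_p p (u r) * u r) + phi_p p (u' r) * u' r
           + \<mu> * (phi_p p (v r) * Q r) - ?Q' * phi_p p (v' r))"
      by (simp only: ring_distribs) (simp only: mult_ac minus_mult_left minus_mult_right minus_minus diff_conv_add_uminus minus_add_distrib add_ac)
    also have "\<dots> = ?n * ((\<mu> - \<nu>) * \<bar>u r\<bar> powr p + (\<bar>u' r\<bar> powr p
        - p * phi_p p s * phi_p p (u r) * u' r + (p - 1) * \<bar>s\<bar> powr p * \<bar>u r\<bar> powr p))"
      unfolding e1 e3 phi_p_times_self [OF p] by (simp add: algebra_simps)
    also have "\<dots> > 0"
    proof -
      have "(\<mu> - \<nu>) * \<bar>u r\<bar> powr p > 0" using less ur by simp
      then show ?thesis
        using picone_bracket_nonneg [OF p, of "u' r" s "u r"] r0 by (intro mult_pos_pos) auto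
    qed
    finally show "\<exists>y. (P has_real_derivative y) (at r) \<and> 0 < y"
      using dP by blast
  qed
  \<comment> \<open>At a = 0 both fluxes vanish because u' 0 = v' 0 = 0; otherwise u a = 0
    annihilates both terms.\<close>
  moreover have "P a = 0"
    using ab p radsol_deriv0 [OF p u] radsol_deriv0 [OF p v] by (auto simp: P_def Q_def)
  moreover have "P b = 0"
    using ab p by (simp add: P_def Q_def)
  ultimately show False by simp
qed

section \<open>Counting zeros of eigenfunctions\<close>

definition radzeros :: "(real \<Rightarrow> real) \<Rightarrow> real set" where
  "radzeros u = {r\<in>{0<..<1}. u r = 0}"

lemma finite_radzeros:
  assumes "p > 1" "radsol N p \<mu> 1 u u'" "\<mu> > 0" "r1 \<in> {0..1}" "u r1 \<noteq> 0"
  shows "finite (radzeros u)"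
  by (rule finite_subset [OF _ radsol_finite_zeros [OF assms(1-3) _ assms(4-5)]])
    (auto simp: radzeros_def)

text \<open>To each zero y of u in (0, 1], the end point 1 included, Sturm comparison assigns a zero
  of v strictly between y and its predecessor. The assignment is injective, and the end point 1
  accounts for the extra zero of v.\<close>

lemma card_radzeros_less:
  assumes p: "p > 1" and u: "radsol N p \<nu> 1 u u'" and v: "radsol N p \<mu> 1 v v'"
    and less: "0 < \<nu>" "\<nu> < \<mu>" and ntu: "r0 \<in> {0..1}" "u r0 \<noteq> 0"
    and ntv: "r1 \<in> {0..1}" "v r1 \<noteq> 0" and u1: "u 1 = 0"
  shows "card (radzeros u) < card (radzeros v)"
proof -
  define A where "A = insert 1 (radzeros u)"
  \<comment> \<open>The zero of u before y, or 0 if y is the first one; 0 may serve as a left end in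
    \<open>sturm_comparison\<close>.\<close>
  define prev where "prev y = Max (insert 0 {r\<in>A. r < y})" for y
  have finu: "finite (radzeros u)" by (rule finite_radzeros [OF p u less(1) ntu])
  have finv: "finite (radzeros v)" using finite_radzeros [OF p v _ ntv] less by simp
  have finA: "finite A" by (simp add: A_def finu)
  have A01: "y \<in> A \<Longrightarrow> 0 < y \<and> y \<le> 1 \<and> u y = 0" for y
    using u1 by (auto simp: A_def radzeros_def)
  have prev: "prev y \<in> insert 0 {r\<in>A. r < y}" for y
    unfolding prev_def by (rule Max_in) (use finA in auto)
  have prev_ge: "x \<le> prev y" if "x \<in> A" "x < y" for x y
    unfolding prev_def using that finA by (intro Max_ge) auto
  have "\<exists>z\<in>radzeros v. prev y < z \<and> z < y" if y: "y \<in> A" for y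
  proof -
    have "\<exists>z\<in>{prev y<..<y}. v z = 0"
    proof (rule sturm_comparison [OF p u v less(2) _ _ ntv])
      show "u r \<noteq> 0" if "prev y < r" "r < y" for r
      proof
        assume "u r = 0"
        moreover have "0 < r" "r < 1" using that prev [of y] A01 y by fastforce+
        ultimately have "r \<in> A" by (simp add: A_def radzeros_def)
        then show False using prev_ge [of r y] that by simp
      qed
    qed (use less y A01 prev [of y] in fastforce)+
    then obtain z where z: "prev y < z" "z < y" "v z = 0" by auto
    have "0 \<le> prev y" using prev [of y] A01 by fastforce
    then have "z \<in> radzeros v" using z A01 [OF y] by (auto simp: radzeros_def)
    then show ?thesis using z by blast
  qed
  then obtain f where f: "\<And>y. y \<in> A \<Longrightarrow> f y \<in> radzeros v \<and> prev y < f y \<and> f y < y"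
    by metis
  have fless: "f x < f y" if "x \<in> A" "y \<in> A" "x < y" for x y
    using f [OF that(1)] f [OF that(2)] prev_ge [OF that(1,3)] by linarith
  have "inj_on f A"
    using fless by (auto simp: inj_on_def) (metis less_irrefl linorder_less_linear)
  then have "card A \<le> card (radzeros v)"
    by (rule card_inj_on_le) (use f finv in auto)
  moreover have "card A = Suc (card (radzeros u))"
    unfolding A_def using finu by (subst card_insert_disjoint) (auto simp: radzeros_def)
  ultimately show ?thesis by simp
qed

text \<open>By homogeneity: the flux picks up the factor \<open>phi_p p c\<close>, differentiating
  it a further factor c, and \<open>phi_p p c * c = c powr p\<close>.\<close>

lemma radsol_scale:
  assumes p: "p > 1" and u: "radsol N p \<mu> R u u'" and c: "c > 0"
  shows "radsol N p (\<mu> * c powr p) (R / c) (\<lambda>s. u (c * s)) (\<lambda>s. c * u' (c * s))"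
  unfolding radsol_def
proof (intro conjI ballI)
  have sub: "(\<lambda>s. c * s) ` {0..R / c} \<subseteq> {0..R}"
    using c by (auto simp: field_simps)
  fix r assume r: "r \<in> {0..R / c}"
  then have cr: "c * r \<in> {0..R}" using c by (auto simp: field_simps)
  have "((\<lambda>s. u (c * s)) has_real_derivative u' (c * r) * c) (at r within {0..R / c})"
  proof -
    have "((\<lambda>s. c * s) has_real_derivative c) (at r within {0..R / c})"
      by (auto intro!: derivative_eq_intros)
    from DERIV_image_chain [OF DERIV_subset [OF radsol_deriv_within [OF p u cr] sub] this]
    show ?thesis by (simp add: o_def)
  qed
  then show "((\<lambda>s. u (c * s)) has_real_derivative c * u' (c * r)) (at r within {0..R / c})"
    by (simp add: mult.commute)
next
  have "continuous_on {0..R / c} (\<lambda>s. u' (c * s))"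
    using c by (intro continuous_on_compose2 [OF radsol_cont' [OF p u]] continuous_intros) (auto simp: field_simps)
  then show "continuous_on {0..R / c} (\<lambda>s. c * u' (c * s))" by (intro continuous_intros)
next
  show "c * u' (c * 0) = 0" using radsol_deriv0 [OF p u] by simp
next
  fix r assume "r \<in> {0<..<R / c}"
  then have cr: "c * r \<in> {0<..<R}" using c by (auto simp: field_simps)
  let ?k = "phi_p p c / c ^ (N - 1)"
  have "((\<lambda>s. ?k * ((c * s) ^ (N - 1) * phi_p p (u' (c * s)))) has_real_derivative
       ?k * ((- \<mu> * (c * r) ^ (N - 1) * phi_p p (u (c * r))) * c)) (at r)"
  proof -
    have "((\<lambda>s. c * s) has_real_derivative c) (at r)"
      by (auto intro!: derivative_eq_intros)
    from DERIV_chain2 [where g = "\<lambda>s. c * s", OF radsol_flux_deriv [OF p u cr] this]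
    show ?thesis by (intro DERIV_cmult)
  qed
  moreover have "?k * ((c * s) ^ (N - 1) * phi_p p (u' (c * s))) = s ^ (N - 1) * phi_p p (c * u' (c * s))" for s
    using c by (simp add: phi_p_mult power_mult_distrib)
  moreover have "?k * ((- \<mu> * (c * r) ^ (N - 1) * phi_p p (u (c * r))) * c)
       = - (\<mu> * c powr p) * r ^ (N - 1) * phi_p p (u (c * r))"
  proof -
    have "?k * ((- \<mu> * (c * r) ^ (N - 1) * phi_p p (u (c * r))) * c)
       = - (\<mu> * (phi_p p c * c)) * r ^ (N - 1) * phi_p p (u (c * r))"
      using c by (simp add: power_mult_distrib)
    then show ?thesis using phi_p_times_self [OF p, of c] c by simp
  qed
  ultimately show "((\<lambda>s. s ^ (N - 1) * phi_p p (c * u' (c * s))) has_real_derivative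
            - (\<mu> * c powr p) * r ^ (N - 1) * phi_p p (u (c * r))) (at r)"
    by simp
qed

lemma radsol_restrict:
  assumes u: "radsol N p \<mu> R u u'" and le: "R' \<le> R"
  shows "radsol N p \<mu> R' u u'"
proof -
  have sub: "{0..R'} \<subseteq> {0..R}" using le by auto
  show ?thesis
    using u unfolding radsol_def
    using DERIV_subset [OF _ sub] continuous_on_subset [OF _ sub] le by (auto 0 3)
qed

text \<open>For \<nu> \<le> 0 the product F of flux and u has derivative r^(N-1) * (|u'|^p - \<nu> *
  |u|^p) \<ge> 0. It vanishes at both ends, hence identically, so u' = 0 and u is the constant u 1 =
  0.\<close>

lemma radial_eig_pos:
  assumes p: "p > 1" and "radial_eig N p \<nu>"
  shows "\<nu> > 0"
proof (rule ccontr)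
  assume "\<not> \<nu> > 0"
  then have nu: "\<nu> \<le> 0" by simp
  obtain u u' r0 where u: "radsol N p \<nu> 1 u u'" and u1: "u 1 = 0" and r0: "r0 \<in> {0..1}" "u r0 \<noteq> 0"
    using assms(2) unfolding radial_eig_iff by blast
  define F where "F r = r ^ (N - 1) * phi_p p (u' r) * u r" for r
  have dF: "(F has_real_derivative r ^ (N - 1) * (\<bar>u' r\<bar> powr p - \<nu> * \<bar>u r\<bar> powr p)) (at r)"
    if r: "r \<in> {0<..<1}" for r
  proof -
    have "(F has_real_derivative (- \<nu> * r ^ (N - 1) * phi_p p (u r)) * u r + u' r * (r ^ (N - 1) * phi_p p (u' r))) (at r)"
      unfolding F_def by (intro DERIV_mult radsol_flux_deriv [OF p u r] radsol_deriv [OF p u r])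
    then show ?thesis
      by (rule DERIV_cong) (simp add: phi_p_times_self [OF p, symmetric] algebra_simps)
  qed
  have Fcont: "continuous_on {0..1} F"
    unfolding F_def by (intro continuous_intros continuous_on_phi_p p radsol_cont [OF p u] radsol_cont' [OF p u])
  have mono: "F x \<le> F y" if "0 \<le> x" "x \<le> y" "y \<le> 1" for x y
  proof (rule DERIV_nonneg_imp_increasing_open [OF that(2)])
    fix r assume "x < r" "r < y"
    then have r: "r \<in> {0<..<1}" using that by auto
    have "\<nu> * \<bar>u r\<bar> powr p \<le> 0"
      using nu by (simp add: mult_nonpos_nonneg)
    then have "\<bar>u' r\<bar> powr p - \<nu> * \<bar>u r\<bar> powr p \<ge> 0"
      using powr_ge_zero [of "\<bar>u' r\<bar>" p] by linarith
    with dF [OF r] r show "\<exists>y. (F has_real_derivative y) (at r) \<and> 0 \<le> y"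
      by (intro exI conjI) auto
  next
    show "continuous_on {x..y} F"
      by (rule continuous_on_subset [OF Fcont]) (use that in auto)
  qed
  have F0: "F r = 0" if "r \<in> {0..1}" for r
    using mono [of 0 r] mono [of r 1] that radsol_deriv0 [OF p u] u1 by (auto simp: F_def)
  have u'0: "u' r = 0" if r: "r \<in> {0<..<1}" for r
  proof -
    have "((\<lambda>_. 0) has_real_derivative r ^ (N - 1) * (\<bar>u' r\<bar> powr p - \<nu> * \<bar>u r\<bar> powr p)) (at r)"
      by (rule has_field_derivative_transform_within_open [OF dF [OF r], of "{0<..<1}"]) (use r F0 in auto)
    then have "r ^ (N - 1) * (\<bar>u' r\<bar> powr p - \<nu> * \<bar>u r\<bar> powr p) = 0"
      using DERIV_unique [OF _ DERIV_const [of 0]] by blast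
    then have "\<bar>u' r\<bar> powr p = \<nu> * \<bar>u r\<bar> powr p" using r by simp
    moreover have "\<nu> * \<bar>u r\<bar> powr p \<le> 0" using nu by (simp add: mult_nonpos_nonneg)
    ultimately have "\<bar>u' r\<bar> powr p = 0" using powr_ge_zero [of "\<bar>u' r\<bar>" p] by linarith
    then show ?thesis by simp
  qed
  have "u r0 = u 1"
  proof (cases "r0 = 1")
    case False
    then have "r0 < 1" using r0 by simp
    then show ?thesis
    proof (rule DERIV_isconst_end [symmetric])
      show "continuous_on {r0..1} u"
        by (rule continuous_on_subset [OF radsol_cont [OF p u]]) (use r0 in auto)
      show "\<And>x. r0 < x \<Longrightarrow> x < 1 \<Longrightarrow> DERIV u x :> 0"
      proof -
        fix x assume "r0 < x" "x < 1"
        then have x: "x \<in> {0<..<1}" using r0 by auto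
        show "DERIV u x :> 0" using radsol_deriv [OF p u x] u'0 [OF x] by simp
      qed
    qed
  qed simp
  then show False using u1 r0 by simp
qed

text \<open>Rescaling U so that z j goes to 1 gives the eigenvalue (z j)^p with j - 1 interior
  zeros. Because the zero count increases strictly with the eigenvalue, no further eigenvalue fits
  below (z k)^p, and exactly k - 1 eigenvalues lie there, as the definition of \<open>mu_rad\<close>
  demands.\<close>

lemma mu_rad_eqI:
  assumes p: "p > 1" and k: "k \<ge> 2" and U: "radsol N p 1 R U U'" and nt: "r0 \<in> {0..R}" "U r0 \<noteq> 0"
    and z0: "z 0 = 0" and zR: "z k \<le> R" and zmono: "\<And>i. i < k \<Longrightarrow> z i < z (Suc i)"
    and zz: "\<And>i. 1 \<le> i \<Longrightarrow> i \<le> k \<Longrightarrow> U (z i) = 0"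
    and nz: "\<And>i r. i < k \<Longrightarrow> z i < r \<Longrightarrow> r < z (Suc i) \<Longrightarrow> U r \<noteq> 0"
  shows "mu_rad N p k = z k powr p"
proof -
  have zless: "z i < z j" if "i < j" "j \<le> k" for i j
    using that
  proof (induction j)
    case (Suc j)
    then show ?case using zmono [of j] by (cases "i = j") auto
  qed simp
  have zpos: "0 < z i" if "1 \<le> i" "i \<le> k" for i using zless [of 0 i] that z0 by simp
  have Rpos: "R > 0" using zpos [of k] zR k by simp
  have U0: "U 0 \<noteq> 0" by (rule radsol_at_0_nonzero [OF p U _ Rpos nt]) simp
  have zeros: "{r. 0 < r \<and> r < z j \<and> U r = 0} = z ` {1..<j}" if "j \<le> k" for j
    using that
  proof (induction j)
    case 0
    then show ?case using z0 by auto
  next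
    case (Suc j)
    have eq: "{r. 0 < r \<and> r < z (Suc j) \<and> U r = 0}
        = {r. 0 < r \<and> r < z j \<and> U r = 0} \<union> (if j = 0 then {} else {z j})"
    proof (intro equalityI subsetI)
      fix r assume r: "r \<in> {r. 0 < r \<and> r < z (Suc j) \<and> U r = 0}"
      then have "\<not> z j < r" using nz [of j r] Suc.prems by auto
      then show "r \<in> {r. 0 < r \<and> r < z j \<and> U r = 0} \<union> (if j = 0 then {} else {z j})"
        using r z0 by (cases "j = 0") auto
    next
      fix r assume r: "r \<in> {r. 0 < r \<and> r < z j \<and> U r = 0} \<union> (if j = 0 then {} else {z j})"
      have "z j < z (Suc j)" using zmono Suc.prems by simp
      then show "r \<in> {r. 0 < r \<and> r < z (Suc j) \<and> U r = 0}"
        using r zz [of j] zpos [of j] Suc.prems by (auto split: if_splits)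
    qed
    show ?case
      unfolding eq using Suc by (cases "j = 0") (auto simp: atLeastLessThanSuc)
  qed
  \<comment> \<open>\<open>W\<close> relates an eigenvalue to the number of interior zeros of one of
    its eigenfunctions; \<open>Wmono\<close> makes this relation strictly increasing.\<close>
  define W where "W \<nu> n \<longleftrightarrow> (\<exists>u u' r. radsol N p \<nu> 1 u u' \<and> u 1 = 0 \<and> r \<in> {0..1} \<and> u r \<noteq> 0 \<and> card (radzeros u) = n)"
    for \<nu> n
  have EW: "radial_eig N p \<nu> \<longleftrightarrow> (\<exists>n. W \<nu> n)" for \<nu>
    unfolding radial_eig_iff W_def by blast
  have Wpos: "W \<nu> n \<Longrightarrow> 0 < \<nu>" for \<nu> n
    using radial_eig_pos [OF p] EW by blast
  have Wmono: "n < m" if W: "W \<nu> n" "W \<mu> m" "\<nu> < \<mu>" for \<nu> \<mu> n m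
  proof -
    obtain u u' r where u: "radsol N p \<nu> 1 u u'" "u 1 = 0" "r \<in> {0..1}" "u r \<noteq> 0" "card (radzeros u) = n"
      using W(1) unfolding W_def by blast
    obtain v v' s where v: "radsol N p \<mu> 1 v v'" "s \<in> {0..1}" "v s \<noteq> 0" "card (radzeros v) = m"
      using W(2) unfolding W_def by blast
    show ?thesis
      using card_radzeros_less [OF p u(1) v(1) Wpos [OF W(1)] W(3) u(3,4) v(2,3) u(2)] u(5) v(4) by simp
  qed
  define e where "e j = z j powr p" for j
  have We: "W (e j) (j - 1)" if j: "1 \<le> j" "j \<le> k" for j
  proof -
    have zj: "0 < z j" by (rule zpos [OF j])
    have "z j \<le> R" using zless [of j k] j zR by (cases "j = k") auto
    then have "radsol N p (e j) 1 (\<lambda>s. U (z j * s)) (\<lambda>s. z j * U' (z j * s))"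
      using radsol_restrict [OF radsol_scale [OF p U zj], of 1] zj by (simp add: e_def)
    moreover have "card (radzeros (\<lambda>s. U (z j * s))) = j - 1"
    proof -
      have "{r. 0 < r \<and> r < z j \<and> U r = 0} = (\<lambda>s. z j * s) ` radzeros (\<lambda>s. U (z j * s))"
      proof (intro equalityI subsetI)
        fix r assume "r \<in> {r. 0 < r \<and> r < z j \<and> U r = 0}"
        then show "r \<in> (\<lambda>s. z j * s) ` radzeros (\<lambda>s. U (z j * s))"
          using zj by (intro image_eqI [where x = "r / z j"]) (auto simp: radzeros_def)
      qed (use zj in \<open>auto simp: radzeros_def\<close>)
      then have "card (radzeros (\<lambda>s. U (z j * s))) = card (z ` {1..<j})"
        unfolding zeros [OF j(2), symmetric]
        using zj by (simp add: card_image inj_on_def)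
      also have "\<dots> = card {1..<j}"
      proof (rule card_image)
        show "inj_on z {1..<j}"
        proof (rule linorder_inj_onI)
          fix x y assume "x < y" "x \<in> {1..<j}" "y \<in> {1..<j}"
          then show "z x \<noteq> z y" using zless [of x y] j by auto
        qed auto
      qed
      finally show ?thesis by simp
    qed
    ultimately show ?thesis
      unfolding W_def using zz [OF j] U0
      by (intro exI [of _ "\<lambda>s. U (z j * s)"] exI [of _ "\<lambda>s. z j * U' (z j * s)"] exI [of _ 0]) auto
  qed
  have emono: "e i < e j" if "1 \<le> i" "i < j" "j \<le> k" for i j
    unfolding e_def using that zless [of i j] zpos [of i] p by (intro powr_less_mono2) auto
  \<comment> \<open>An eigenvalue below \<open>e k\<close> has some number n < k - 1 of zeros. As
    \<open>e (Suc n)\<close> has n zeros too, the two coincide, since different eigenvalues cannot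
    share a zero count.\<close>
  have set_eq: "{\<nu>. radial_eig N p \<nu> \<and> \<nu> < e k} = e ` {1..<k}"
  proof (intro equalityI subsetI)
    fix \<nu> assume "\<nu> \<in> {\<nu>. radial_eig N p \<nu> \<and> \<nu> < e k}"
    then obtain n where n: "W \<nu> n" "\<nu> < e k" unfolding EW by blast
    have "n < k - 1" using Wmono [OF n(1) We [of k] n(2)] k by simp
    then have j: "1 \<le> Suc n" "Suc n \<le> k" "Suc n < k" by auto
    have "W (e (Suc n)) n" using We [OF j(1,2)] by simp
    then have "\<nu> = e (Suc n)"
      using Wmono [of \<nu> n "e (Suc n)" n] Wmono [of "e (Suc n)" n \<nu> n] n(1)
      by (metis less_irrefl linorder_less_linear)
    then show "\<nu> \<in> e ` {1..<k}" using j by auto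
  next
    fix \<nu> assume "\<nu> \<in> e ` {1..<k}"
    then obtain j where j: "1 \<le> j" "j < k" and \<nu>: "\<nu> = e j" by auto
    have "radial_eig N p (e j)" unfolding EW using We [of j] j by (intro exI [of _ "j - 1"]) simp
    moreover have "e j < e k" using emono [of j k] j by simp
    ultimately show "\<nu> \<in> {\<nu>. radial_eig N p \<nu> \<and> \<nu> < e k}"
      by (simp add: \<nu>)
  qed
  have fin: "finite {\<nu>. radial_eig N p \<nu> \<and> \<nu> < e k}" unfolding set_eq by simp
  have card_eq: "card {\<nu>. radial_eig N p \<nu> \<and> \<nu> < e k} = k - 1"
  proof -
    have "inj_on e {1..<k}"
    proof (rule linorder_inj_onI)
      fix x y assume "x < y" "x \<in> {1..<k}" "y \<in> {1..<k}"
      then show "e x \<noteq> e y" using emono [of x y] by auto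
    qed auto
    then show ?thesis unfolding set_eq by (simp add: card_image)
  qed
  have eig: "radial_eig N p (e k)"
    unfolding EW using We [of k] k by (intro exI [of _ "k - 1"]) simp
  show ?thesis
    unfolding mu_rad_def e_def [symmetric]
  proof (rule the_equality)
    show "radial_eig N p (e k) \<and> card {\<nu>. radial_eig N p \<nu> \<and> \<nu> < e k} = k - 1"
      using eig card_eq by simp
    fix \<mu> assume mu: "radial_eig N p \<mu> \<and> card {\<nu>. radial_eig N p \<nu> \<and> \<nu> < \<mu>} = k - 1"
    show "\<mu> = e k"
    proof (rule ccontr)
      assume "\<mu> \<noteq> e k"
      then consider "\<mu> < e k" | "e k < \<mu>" by linarith
      then show False
      proof cases
        case 1
        have "\<mu> \<in> {\<nu>. radial_eig N p \<nu> \<and> \<nu> < e k}" "\<mu> \<notin> {\<nu>. radial_eig N p \<nu> \<and> \<nu> < \<mu>}"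
          using mu 1 by simp_all
        moreover have "{\<nu>. radial_eig N p \<nu> \<and> \<nu> < \<mu>} \<subseteq> {\<nu>. radial_eig N p \<nu> \<and> \<nu> < e k}"
          using 1 by (intro Collect_mono) simp
        ultimately have "{\<nu>. radial_eig N p \<nu> \<and> \<nu> < \<mu>} \<subset> {\<nu>. radial_eig N p \<nu> \<and> \<nu> < e k}"
          by (intro psubsetI) (auto simp only:)
        from psubset_card_mono [OF fin this] show False using mu card_eq by simp
      next
        case 2
        have "e k \<in> {\<nu>. radial_eig N p \<nu> \<and> \<nu> < \<mu>}" "e k \<notin> {\<nu>. radial_eig N p \<nu> \<and> \<nu> < e k}"
          using eig 2 by simp_all
        moreover have "{\<nu>. radial_eig N p \<nu> \<and> \<nu> < e k} \<subseteq> {\<nu>. radial_eig N p \<nu> \<and> \<nu> < \<mu>}"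
          using 2 by (intro Collect_mono) simp
        ultimately have sub: "{\<nu>. radial_eig N p \<nu> \<and> \<nu> < e k} \<subset> {\<nu>. radial_eig N p \<nu> \<and> \<nu> < \<mu>}"
          by (intro psubsetI) (auto simp only:)
        \<comment> \<open>\<open>card\<close> is 0 on infinite sets, so the positive value k - 1
          certifies finiteness; this is where k \<ge> 2 enters.\<close>
        have "finite {\<nu>. radial_eig N p \<nu> \<and> \<nu> < \<mu>}"
          using mu k by (intro card_ge_0_finite) simp
        from psubset_card_mono [OF this sub] show False using mu card_eq by simp
      qed
    qed
  qed
qed

section \<open>Existence and oscillation of solutions\<close>

text \<open>Integrating the flux equation once from 0 gives \<open>phi_p p (u' s)\<close> as minus
  this expression, for n = N - 1, \<mu> = 1 and g = \<open>phi_p p\<close> of u.\<close>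

definition radavg :: "nat \<Rightarrow> (real \<Rightarrow> real) \<Rightarrow> real \<Rightarrow> real" where
  "radavg n g s = integral {0..s} (\<lambda>t. t ^ n * g t) / s ^ n"

lemma radavg_bound:
  assumes "0 \<le> s" "continuous_on {0..s} g" "\<And>t. t \<in> {0..s} \<Longrightarrow> \<bar>g t\<bar> \<le> B"
  shows "\<bar>radavg n g s\<bar> \<le> s * B"
proof (cases "s = 0")
  case False
  then have s: "s > 0" using assms by simp
  have B: "0 \<le> B" using assms(3) [of 0] assms(1) by force
  have "norm (integral {0..s} (\<lambda>t. t ^ n * g t)) \<le> (s ^ n * B) * (s - 0)"
  proof (rule integral_bound)
    show "continuous_on {0..s} (\<lambda>t. t ^ n * g t)"
      by (intro continuous_intros assms)
    fix t assume t: "t \<in> {0..s}"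
    then have "\<bar>t ^ n\<bar> \<le> s ^ n" by (simp add: power_mono)
    then show "norm (t ^ n * g t) \<le> s ^ n * B"
      using assms(3) [OF t] s by (simp add: abs_mult mult_mono)
  qed (use s in simp)
  then have "norm (integral {0..s} (\<lambda>t. t ^ n * g t)) \<le> s ^ n * (s * B)"
    by (simp add: mult_ac)
  then show ?thesis
    using s by (simp add: radavg_def abs_divide divide_le_eq mult_ac)
qed (simp add: radavg_def)

text \<open>Only s = 0 is delicate, and there \<open>radavg_bound\<close> forces the value to be at
  most s times a bound for g.\<close>

lemma radavg_cont:
  assumes g: "continuous_on {0..R} g"
  shows "continuous_on {0..R} (radavg n g)"
  unfolding continuous_on_eq_continuous_within
proof
  fix c assume c: "c \<in> {0..R}"
  have icont: "continuous_on {0..R} (\<lambda>s. integral {0..s} (\<lambda>t. t ^ n * g t))"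
    by (intro indefinite_integral_continuous_1 integrable_continuous_interval continuous_intros g)
  show "continuous (at c within {0..R}) (radavg n g)"
  proof (cases "c = 0")
    case False
    then show ?thesis
      unfolding radavg_def using icont c
      by (intro continuous_divide continuous_intros) (auto simp: continuous_on_eq_continuous_within)
  next
    case True
    obtain B where B: "\<forall>t\<in>{0..R}. \<bar>g t\<bar> \<le> B"
      using compact_imp_bounded [OF compact_continuous_image [OF g compact_Icc]]
      by (auto simp: bounded_iff)
    have "(radavg n g \<longlongrightarrow> 0) (at 0 within {0..R})"
    proof (rule Lim_null_comparison)
      show "\<forall>\<^sub>F s in at 0 within {0..R}. norm (radavg n g s) \<le> s * B"
        unfolding eventually_at_filter
        by (intro always_eventually allI impI)
           (use B in \<open>auto intro!: radavg_bound continuous_on_subset [OF g]\<close>)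
      show "((\<lambda>s. s * B) \<longlongrightarrow> 0) (at 0 within {0..R})"
        by (auto intro!: tendsto_eq_intros)
    qed
    moreover have "radavg n g 0 = 0" by (simp add: radavg_def)
    ultimately show ?thesis by (simp add: True continuous_within)
  qed
qed

lemma radavg_cong:
  assumes "\<And>t. t \<in> {0..s} \<Longrightarrow> f t = g t" shows "radavg n f s = radavg n g s"
proof -
  have "integral {0..s} (\<lambda>t. t ^ n * f t) = integral {0..s} (\<lambda>t. t ^ n * g t)"
    by (rule Henstock_Kurzweil_Integration.integral_cong) (simp add: assms)
  then show ?thesis by (simp add: radavg_def)
qed

text \<open>One step of Tonelli's delayed approximation to the integral form of the equation.\<close>

definition radstep :: "nat \<Rightarrow> real \<Rightarrow> real \<Rightarrow> (real \<Rightarrow> real) \<Rightarrow> real \<Rightarrow> real" where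
  "radstep n p h u r = 1 - integral {0..r}
     (\<lambda>s. phi_p (1 + 1 / (p - 1)) (radavg n (\<lambda>t. phi_p p (u (max 0 (t - h)))) s))"

context
  fixes n :: nat and p R C :: real
  assumes p: "p > 1" and R: "R > 0"
  defines "C \<equiv> R powr (1 / (p - 1))"
begin

text \<open>The exponent is p / (p - 1), conjugate to p; its signed power inverts
  \<open>phi_p p\<close> and recovers u' from the flux.\<close>

lemma conj_exp: "1 + 1 / (p - 1) > 1" "(1 + 1 / (p - 1) - 1) * (p - 1) = 1"
  using p by auto

lemma shift_cont:
  assumes "continuous_on {0..R} u" "h \<ge> 0"
  shows "continuous_on {0..R} (\<lambda>t. phi_p p (u (max 0 (t - h))))"
  by (intro continuous_on_phi_p p continuous_on_compose2 [OF assms(1)] continuous_intros)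
    (use assms in auto)

lemma integrand_cont:
  assumes "continuous_on {0..R} u" "h \<ge> 0"
  shows "continuous_on {0..R}
    (\<lambda>s. phi_p (1 + 1 / (p - 1)) (radavg n (\<lambda>t. phi_p p (u (max 0 (t - h)))) s))"
  by (intro continuous_on_phi_p conj_exp radavg_cont shift_cont assms)

text \<open>The constant C is made for this step: a bound exp (C * s) on u becomes exp (C * s)^(p-1)
  under \<open>phi_p p\<close>, averaging adds a factor s \<le> R, and the final power 1/(p-1) turns
  R into C.\<close>

lemma integrand_bound:
  assumes u: "continuous_on {0..R} u" and h: "h \<ge> 0"
    and b: "\<And>r. r \<in> {0..R} \<Longrightarrow> \<bar>u r\<bar> \<le> exp (C * r)" and s: "s \<in> {0..R}"
  shows "\<bar>phi_p (1 + 1 / (p - 1)) (radavg n (\<lambda>t. phi_p p (u (max 0 (t - h)))) s)\<bar> \<le> C * exp (C * s)"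
proof -
  have C0: "C \<ge> 0" by (simp add: C_def)
  have "\<bar>radavg n (\<lambda>t. phi_p p (u (max 0 (t - h)))) s\<bar> \<le> s * exp (C * s) powr (p - 1)"
  proof (rule radavg_bound)
    show "continuous_on {0..s} (\<lambda>t. phi_p p (u (max 0 (t - h))))"
      by (rule continuous_on_subset [OF shift_cont [OF u h]]) (use s in auto)
    fix t assume t: "t \<in> {0..s}"
    have "\<bar>u (max 0 (t - h))\<bar> \<le> exp (C * max 0 (t - h))" using t s h by (intro b) auto
    also have "\<dots> \<le> exp (C * s)" using t h C0 by (auto intro!: mult_left_mono)
    finally show "\<bar>phi_p p (u (max 0 (t - h)))\<bar> \<le> exp (C * s) powr (p - 1)"
      using p by (simp add: abs_phi_p powr_mono2)
  qed (use s in auto)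
  also have "\<dots> \<le> R * exp (C * s) powr (p - 1)"
    using s by (intro mult_right_mono) auto
  finally have "\<bar>radavg n (\<lambda>t. phi_p p (u (max 0 (t - h)))) s\<bar> powr (1 / (p - 1))
      \<le> (R * exp (C * s) powr (p - 1)) powr (1 / (p - 1))"
    using p by (intro powr_mono2) auto
  also have "\<dots> = C * exp (C * s)"
    using p R by (simp add: powr_mult powr_powr C_def)
  finally show ?thesis by (simp add: abs_phi_p)
qed

lemma radstep_cont:
  assumes "continuous_on {0..R} u" "h \<ge> 0"
  shows "continuous_on {0..R} (radstep n p h u)"
  unfolding radstep_def
  by (intro continuous_intros indefinite_integral_continuous_1 integrable_continuous_interval integrand_cont assms)

text \<open>The integral of C * exp (C * s) over (0, r) is exp (C * r) - 1, and the initial value 1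
  restores exp (C * r). So the same exponential bound survives every step, for every delay.\<close>

lemma radstep_bound:
  assumes u: "continuous_on {0..R} u" and h: "h \<ge> 0"
    and b: "\<And>r. r \<in> {0..R} \<Longrightarrow> \<bar>u r\<bar> \<le> exp (C * r)" and r: "r \<in> {0..R}"
  shows "\<bar>radstep n p h u r\<bar> \<le> exp (C * r)"
proof -
  have r0: "0 \<le> r" using r by simp
  have "((\<lambda>s. C * exp (C * s)) has_integral exp (C * r) - exp (C * 0)) {0..r}"
    using r0 by (intro fundamental_theorem_of_calculus)
      (auto intro!: derivative_eq_intros simp: has_real_derivative_iff_has_vector_derivative [symmetric])
  then have hi: "((\<lambda>s. C * exp (C * s)) has_integral exp (C * r) - 1) {0..r}" by simp
  have "norm (integral {0..r} (\<lambda>s. phi_p (1 + 1 / (p - 1)) (radavg n (\<lambda>t. phi_p p (u (max 0 (t - h)))) s)))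
     \<le> integral {0..r} (\<lambda>s. C * exp (C * s))"
  proof (rule integral_norm_bound_integral)
    show "(\<lambda>s. phi_p (1 + 1 / (p - 1)) (radavg n (\<lambda>t. phi_p p (u (max 0 (t - h)))) s)) integrable_on {0..r}"
      by (intro integrable_continuous_interval continuous_on_subset [OF integrand_cont [OF u h]]) (use r in auto)
    show "(\<lambda>s. C * exp (C * s)) integrable_on {0..r}" using hi by blast
    show "\<And>x. x \<in> {0..r} \<Longrightarrow> norm (phi_p (1 + 1 / (p - 1)) (radavg n (\<lambda>t. phi_p p (u (max 0 (t - h)))) x)) \<le> C * exp (C * x)"
      unfolding real_norm_def by (rule integrand_bound [OF u h b]) (use r in auto)
  qed
  then show ?thesis using integral_unique [OF hi] by (simp add: radstep_def)
qed

text \<open>The constant does not depend on h, which provides the equicontinuity for the passage h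
  \<rightarrow> 0.\<close>

lemma radstep_lipschitz:
  assumes u: "continuous_on {0..R} u" and h: "h \<ge> 0"
    and b: "\<And>r. r \<in> {0..R} \<Longrightarrow> \<bar>u r\<bar> \<le> exp (C * r)" and xy: "x \<in> {0..R}" "y \<in> {0..R}"
  shows "\<bar>radstep n p h u x - radstep n p h u y\<bar> \<le> C * exp (C * R) * \<bar>x - y\<bar>"
proof -
  let ?F = "\<lambda>s. phi_p (1 + 1 / (p - 1)) (radavg n (\<lambda>t. phi_p p (u (max 0 (t - h)))) s)"
  have *: "\<bar>radstep n p h u x - radstep n p h u y\<bar> \<le> C * exp (C * R) * \<bar>x - y\<bar>"
    if "x \<in> {0..R}" "y \<in> {0..R}" "x \<le> y" for x y
  proof -
    have "integral {0..x} ?F + integral {x..y} ?F = integral {0..y} ?F"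
      by (rule Henstock_Kurzweil_Integration.integral_combine)
        (use that in \<open>auto intro!: integrable_continuous_interval continuous_on_subset [OF integrand_cont [OF u h]]\<close>)
    moreover have "norm (integral {x..y} ?F) \<le> C * exp (C * R) * (y - x)"
    proof (rule integral_bound)
      show "continuous_on {x..y} ?F"
        by (rule continuous_on_subset [OF integrand_cont [OF u h]]) (use that in auto)
      fix t assume t: "t \<in> {x..y}"
      have "norm (?F t) \<le> C * exp (C * t)"
        unfolding real_norm_def by (rule integrand_bound [OF u h b]) (use t that in auto)
      also have "\<dots> \<le> C * exp (C * R)"
        using t that by (intro mult_left_mono) (auto simp: C_def intro!: mult_left_mono)
      finally show "norm (?F t) \<le> C * exp (C * R)" .
    qed (use that in auto)
    ultimately show ?thesis using that by (simp add: radstep_def)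
  qed
  show ?thesis
    using * [of x y] * [of y x] xy by (cases "x \<le> y") (auto simp: abs_minus_commute)
qed

text \<open>With delay h, the value at r only looks at arguments up to r - h. Agreement therefore
  spreads by h with each step.\<close>

lemma radstep_agree:
  assumes "\<And>r. 0 \<le> r \<Longrightarrow> r \<le> c \<Longrightarrow> u r = v r" "0 \<le> c" "r \<le> c + h"
  shows "radstep n p h u r = radstep n p h v r"
proof -
  have "integral {0..r} (\<lambda>s. phi_p (1 + 1 / (p - 1)) (radavg n (\<lambda>t. phi_p p (u (max 0 (t - h)))) s))
    = integral {0..r} (\<lambda>s. phi_p (1 + 1 / (p - 1)) (radavg n (\<lambda>t. phi_p p (v (max 0 (t - h)))) s))"
  proof (rule Henstock_Kurzweil_Integration.integral_cong)
    fix s assume s: "s \<in> {0..r}"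
    have "radavg n (\<lambda>t. phi_p p (u (max 0 (t - h)))) s = radavg n (\<lambda>t. phi_p p (v (max 0 (t - h)))) s"
    proof (rule radavg_cong)
      fix t assume t: "t \<in> {0..s}"
      have "u (max 0 (t - h)) = v (max 0 (t - h))"
        using t s assms by (intro assms(1)) auto
      then show "phi_p p (u (max 0 (t - h))) = phi_p p (v (max 0 (t - h)))" by simp
    qed
    then show "phi_p (1 + 1 / (p - 1)) (radavg n (\<lambda>t. phi_p p (u (max 0 (t - h)))) s)
      = phi_p (1 + 1 / (p - 1)) (radavg n (\<lambda>t. phi_p p (v (max 0 (t - h)))) s)" by simp
  qed
  then show ?thesis by (simp add: radstep_def)
qed

text \<open>The iterates with numbers j and j + 1 agree on (0, j * h), starting from their common
  value 1 at 0. Once j * h \<ge> R the iterate is a fixed point on the whole interval, without any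
  contraction estimate.\<close>

lemma ex_radstep_fixpoint:
  assumes h: "h > 0"
  shows "\<exists>u. continuous_on {0..R} u \<and> (\<forall>r\<in>{0..R}. \<bar>u r\<bar> \<le> exp (C * r)) \<and>
    (\<forall>r\<in>{0..R}. u r = radstep n p h u r)"
proof -
  define W where "W j = (radstep n p h ^^ j) (\<lambda>_. 1)" for j
  have W_Suc: "W (Suc j) = radstep n p h (W j)" for j by (simp add: W_def)
  have Wc: "continuous_on {0..R} (W j)" for j
  proof (induction j)
    case (Suc j)
    then show ?case unfolding W_Suc using h by (intro radstep_cont) auto
  qed (simp add: W_def)
  have Wb: "\<forall>r\<in>{0..R}. \<bar>W j r\<bar> \<le> exp (C * r)" for j
  proof (induction j)
    case (Suc j)
    then show ?case unfolding W_Suc using h Wc by (intro ballI radstep_bound) auto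
  next
    case 0
    then show ?case by (simp add: W_def C_def)
  qed
  have agree: "W j r = W (Suc j) r" if "0 \<le> r" "r \<le> real j * h" for j r
    using that
  proof (induction j arbitrary: r)
    case 0
    then show ?case by (simp add: W_Suc radstep_def) (simp add: W_def)
  next
    case (Suc j)
    have "radstep n p h (W j) r = radstep n p h (W (Suc j)) r"
      by (rule radstep_agree [of "real j * h"]) (use Suc h in \<open>auto simp: algebra_simps\<close>)
    then show ?case by (simp only: W_Suc [symmetric])
  qed
  obtain J :: nat where J: "R / h \<le> real J" using real_arch_simple by blast
  then have "R \<le> real J * h" using h by (simp add: divide_le_eq)
  then have "\<forall>r\<in>{0..R}. W J r = radstep n p h (W J) r"
    using agree [of _ J] unfolding W_Suc by auto
  then show ?thesis using Wc Wb by blast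
qed

text \<open>By the Arzela--Ascoli theorem the delayed solutions converge along a subsequence as the delay
  tends to \<open>0\<close>.\<close>

lemma ex_radial_integral_solution:
  "\<exists>g. continuous_on {0..R} g \<and> (\<forall>r\<in>{0..R}. g r = radstep n p 0 g r)"
proof -
  let ?q = "1 + 1 / (p - 1)"
  define h where "h j = inverse (real (Suc j))" for j
  have h0: "h j > 0" for j by (simp add: h_def)
  obtain u where uc: "\<And>j. continuous_on {0..R} (u j)"
    and ub: "\<And>j r. r \<in> {0..R} \<Longrightarrow> \<bar>u j r\<bar> \<le> exp (C * r)"
    and ueq: "\<And>j r. r \<in> {0..R} \<Longrightarrow> u j r = radstep n p (h j) (u j) r"
    using ex_radstep_fixpoint [OF h0] by metis
  define L where "L = C * exp (C * R) + 1"
  have C0: "C \<ge> 0" by (simp add: C_def)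
  have L: "L > 0" using C0 by (simp add: L_def add_nonneg_pos)
  have ulip: "\<bar>u j x - u j y\<bar> \<le> L * \<bar>x - y\<bar>" if "x \<in> {0..R}" "y \<in> {0..R}" for j x y
  proof -
    have "\<bar>u j x - u j y\<bar> \<le> C * exp (C * R) * \<bar>x - y\<bar>"
      unfolding ueq [OF that(1)] ueq [OF that(2)]
      by (rule radstep_lipschitz [OF uc less_imp_le [OF h0] ub that])
    also have "\<dots> \<le> L * \<bar>x - y\<bar>" by (intro mult_right_mono) (auto simp: L_def)
    finally show ?thesis .
  qed
  have ubR: "\<bar>u j r\<bar> \<le> exp (C * R)" if "r \<in> {0..R}" for j r
  proof -
    have "exp (C * r) \<le> exp (C * R)" using that C0 by (simp add: mult_left_mono)
    with ub [OF that, of j] show ?thesis by linarith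
  qed
  obtain g k where gc: "continuous_on {0..R} g" and k: "strict_mono (k :: nat \<Rightarrow> nat)"
    and conv: "\<And>e. 0 < e \<Longrightarrow> \<exists>N. \<forall>j x. j \<ge> N \<and> x \<in> {0..R} \<longrightarrow> norm (u (k j) x - g x) < e"
  proof (rule Arzela_Ascoli [of "{0..R}" u "exp (C * R)"])
    show "\<And>j x. x \<in> {0..R} \<Longrightarrow> norm (u j x) \<le> exp (C * R)" using ubR by simp
    fix x e :: real assume x: "x \<in> {0..R}" and e: "0 < e"
    show "\<exists>d>0. \<forall>n y. y \<in> {0..R} \<and> norm (x - y) < d \<longrightarrow> norm (u n x - u n y) < e"
    proof (intro exI conjI allI impI)
      show "0 < e / L" using e L by simp
      fix j y assume y: "y \<in> {0..R} \<and> norm (x - y) < e / L"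
      have "norm (u j x - u j y) \<le> L * \<bar>x - y\<bar>" using ulip [OF x, of y j] y by simp
      also have "\<dots> < e" using y L by (simp add: field_simps)
      finally show "norm (u j x - u j y) < e" .
    qed
  qed auto
  have lim: "(\<lambda>j. u (k j) x) \<longlonglongrightarrow> g x" if "x \<in> {0..R}" for x
    unfolding LIMSEQ_iff using conv that by meson
  have "h \<longlonglongrightarrow> 0" unfolding h_def using LIMSEQ_inverse_real_of_nat by simp
  then have hk: "(\<lambda>j. h (k j)) \<longlonglongrightarrow> 0"
    using LIMSEQ_subseq_LIMSEQ [OF _ k] by (simp add: o_def)
  have shift_in: "max 0 (t - h j) \<in> {0..R}" if "t \<in> {0..R}" for t j
    using that h0 [of j] by auto
  \<comment> \<open>The delayed argument is within h of t, so the common Lipschitz constant absorbs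
    the delay in the limit.\<close>
  have lims: "(\<lambda>j. u (k j) (max 0 (t - h (k j)))) \<longlonglongrightarrow> g t" if t: "t \<in> {0..R}" for t
  proof -
    have "(\<lambda>j. u (k j) (max 0 (t - h (k j))) - u (k j) t) \<longlonglongrightarrow> 0"
    proof (rule Lim_null_comparison)
      have "norm (u (k j) (max 0 (t - h (k j))) - u (k j) t) \<le> L * h (k j)" for j
      proof -
        have "norm (u (k j) (max 0 (t - h (k j))) - u (k j) t) \<le> L * \<bar>max 0 (t - h (k j)) - t\<bar>"
          unfolding real_norm_def by (rule ulip [OF shift_in [OF t] t])
        also have "\<dots> \<le> L * h (k j)"
          using L t h0 [of "k j"] by (intro mult_left_mono) auto
        finally show ?thesis .
      qed
      then show "\<forall>\<^sub>F j in sequentially. norm (u (k j) (max 0 (t - h (k j))) - u (k j) t) \<le> L * h (k j)"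
        by simp
      show "(\<lambda>j. L * h (k j)) \<longlonglongrightarrow> 0" using tendsto_mult_right_zero [OF hk] .
    qed
    from tendsto_add [OF this lim [OF t]] show ?thesis by simp
  qed
  have avglim: "(\<lambda>j. radavg n (\<lambda>t. phi_p p (u (k j) (max 0 (t - h (k j))))) s)
      \<longlonglongrightarrow> radavg n (\<lambda>t. phi_p p (g t)) s" if s: "s \<in> {0..R}" for s
  proof -
    have sub: "{0..s} \<subseteq> {0..R}" using s by auto
    have "(\<lambda>j. integral {0..s} (\<lambda>t. t ^ n * phi_p p (u (k j) (max 0 (t - h (k j))))))
      \<longlonglongrightarrow> integral {0..s} (\<lambda>t. t ^ n * phi_p p (g t))"
    proof (rule dominated_convergence(2))
      show "(\<lambda>t. t ^ n * phi_p p (u (k j) (max 0 (t - h (k j))))) integrable_on {0..s}" for j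
        by (intro integrable_continuous_interval continuous_intros
            continuous_on_subset [OF shift_cont [OF uc less_imp_le [OF h0]] sub])
      show "(\<lambda>t. s ^ n * exp (C * R) powr (p - 1)) integrable_on {0..s}" by (rule integrable_on_const) simp
      fix j t assume t: "t \<in> {0..s}"
      then have tR: "t \<in> {0..R}" using sub by auto
      have "\<bar>phi_p p (u (k j) (max 0 (t - h (k j))))\<bar> \<le> exp (C * R) powr (p - 1)"
        unfolding abs_phi_p using p ubR [OF shift_in [OF tR]] by (intro powr_mono2) auto
      moreover have "\<bar>t ^ n\<bar> \<le> s ^ n" using t by (simp add: power_mono)
      ultimately show "norm (t ^ n * phi_p p (u (k j) (max 0 (t - h (k j))))) \<le> s ^ n * exp (C * R) powr (p - 1)"
        unfolding real_norm_def abs_mult using s by (intro mult_mono) auto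
    next
      fix t assume t: "t \<in> {0..s}"
      then have tR: "t \<in> {0..R}" using sub by auto
      show "(\<lambda>j. t ^ n * phi_p p (u (k j) (max 0 (t - h (k j))))) \<longlonglongrightarrow> t ^ n * phi_p p (g t)"
        by (intro tendsto_mult tendsto_const tendsto_phi_p p lims tR)
    qed
    then show ?thesis
      unfolding radavg_def divide_inverse by (intro tendsto_mult tendsto_const)
  qed
  have "g r = radstep n p 0 g r" if r: "r \<in> {0..R}" for r
  proof -
    have sub: "{0..r} \<subseteq> {0..R}" using r by auto
    have "(\<lambda>j. integral {0..r} (\<lambda>s. phi_p ?q (radavg n (\<lambda>t. phi_p p (u (k j) (max 0 (t - h (k j))))) s)))
      \<longlonglongrightarrow> integral {0..r} (\<lambda>s. phi_p ?q (radavg n (\<lambda>t. phi_p p (g t)) s))"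
    proof (rule dominated_convergence(2))
      show "(\<lambda>s. phi_p ?q (radavg n (\<lambda>t. phi_p p (u (k j) (max 0 (t - h (k j))))) s)) integrable_on {0..r}" for j
        by (intro integrable_continuous_interval
            continuous_on_subset [OF integrand_cont [OF uc less_imp_le [OF h0]] sub])
      show "(\<lambda>s. C * exp (C * R)) integrable_on {0..r}" by (rule integrable_on_const) simp
      fix j s assume "s \<in> {0..r}"
      then have s: "s \<in> {0..R}" using sub by auto
      have "norm (phi_p ?q (radavg n (\<lambda>t. phi_p p (u (k j) (max 0 (t - h (k j))))) s)) \<le> C * exp (C * s)"
        unfolding real_norm_def by (rule integrand_bound [OF uc less_imp_le [OF h0] ub s])
      also have "\<dots> \<le> C * exp (C * R)"
        using s C0 by (intro mult_left_mono) (auto intro!: mult_left_mono)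
      finally show "norm (phi_p ?q (radavg n (\<lambda>t. phi_p p (u (k j) (max 0 (t - h (k j))))) s)) \<le> C * exp (C * R)" .
    next
      fix s assume "s \<in> {0..r}"
      then have s: "s \<in> {0..R}" using sub by auto
      show "(\<lambda>j. phi_p ?q (radavg n (\<lambda>t. phi_p p (u (k j) (max 0 (t - h (k j))))) s))
        \<longlonglongrightarrow> phi_p ?q (radavg n (\<lambda>t. phi_p p (g t)) s)"
        by (intro tendsto_phi_p conj_exp avglim s)
    qed
    then have "(\<lambda>j. u (k j) r) \<longlonglongrightarrow> 1 - integral {0..r} (\<lambda>s. phi_p ?q (radavg n (\<lambda>t. phi_p p (g t)) s))"
      unfolding ueq [OF r] radstep_def by (intro tendsto_diff tendsto_const)
    with lim [OF r] have "g r = 1 - integral {0..r} (\<lambda>s. phi_p ?q (radavg n (\<lambda>t. phi_p p (g t)) s))"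
      by (rule LIMSEQ_unique)
    moreover have "integral {0..r} (\<lambda>s. phi_p ?q (radavg n (\<lambda>t. phi_p p (g t)) s))
      = integral {0..r} (\<lambda>s. phi_p ?q (radavg n (\<lambda>t. phi_p p (g (max 0 (t - 0)))) s))"
    proof (rule Henstock_Kurzweil_Integration.integral_cong)
      fix s assume "s \<in> {0..r}"
      have "radavg n (\<lambda>t. phi_p p (g t)) s = radavg n (\<lambda>t. phi_p p (g (max 0 (t - 0)))) s"
        by (rule radavg_cong) simp
      then show "phi_p ?q (radavg n (\<lambda>t. phi_p p (g t)) s)
         = phi_p ?q (radavg n (\<lambda>t. phi_p p (g (max 0 (t - 0)))) s)" by simp
    qed
    ultimately show ?thesis by (simp only: radstep_def)
  qed
  then show ?thesis using gc by blast
qed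

end

text \<open>Differentiating the undelayed integral equation once gives u' as minus the conjugate
  power of the average A. Applying \<open>phi_p p\<close> recovers -A, and multiplying by s^(N-1)
  leaves an integral whose derivative is the right-hand side.\<close>

lemma ex_radsol:
  assumes p: "p > 1" and R: "R > 0"
  shows "\<exists>u u'. radsol N p 1 R u u' \<and> u 0 = 1"
proof -
  let ?n = "N - 1" and ?q = "1 + 1 / (p - 1)"
  obtain u where uc: "continuous_on {0..R} u" and ueq: "\<And>r. r \<in> {0..R} \<Longrightarrow> u r = radstep ?n p 0 u r"
    using ex_radial_integral_solution [OF p R, of ?n] by blast
  define A where "A = radavg ?n (\<lambda>t. phi_p p (u (max 0 (t - 0))))"
  define u' where "u' r = - phi_p ?q (A r)" for r
  have Ac: "continuous_on {0..R} A"
    unfolding A_def by (intro radavg_cont shift_cont [OF p R uc]) simp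
  have Fc: "continuous_on {0..R} (\<lambda>s. phi_p ?q (A s))"
    by (intro continuous_on_phi_p Ac) (use p in auto)
  have "radsol N p 1 R u u'"
    unfolding radsol_def
  proof (intro conjI ballI)
    fix r assume r: "r \<in> {0..R}"
    have "((\<lambda>x. 1 - integral {0..x} (\<lambda>s. phi_p ?q (A s))) has_real_derivative 0 - phi_p ?q (A r)) (at r within {0..R})"
      by (intro DERIV_diff DERIV_const integral_has_real_derivative [OF Fc r])
    then have "((\<lambda>x. 1 - integral {0..x} (\<lambda>s. phi_p ?q (A s))) has_real_derivative u' r) (at r within {0..R})"
      by (simp add: u'_def)
    then show "(u has_real_derivative u' r) (at r within {0..R})"
      by (rule has_field_derivative_transform_within [where d = 1])
        (use r ueq in \<open>auto simp: radstep_def A_def\<close>)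
  next
    show "continuous_on {0..R} u'" unfolding u'_def by (intro continuous_intros Fc)
    show "u' 0 = 0" by (simp add: u'_def A_def radavg_def)
    fix r assume r: "r \<in> {0<..<R}"
    let ?G = "\<lambda>t. t ^ ?n * phi_p p (u t)"
    have Gc: "continuous_on {0..R} ?G"
      by (intro continuous_intros continuous_on_phi_p p uc)
    have "((\<lambda>x. integral {0..x} ?G) has_real_derivative ?G r) (at r within {0<..<R})"
      by (rule DERIV_subset [OF integral_has_real_derivative [OF Gc]]) (use r in auto)
    moreover have "at r within {0<..<R} = at r"
      by (rule at_within_open [OF r open_greaterThanLessThan])
    ultimately have "((\<lambda>x. integral {0..x} ?G) has_real_derivative ?G r) (at r)"
      by (simp only:)
    then have "((\<lambda>x. - integral {0..x} ?G) has_real_derivative - ?G r) (at r)"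
      by (rule DERIV_minus)
    then have "((\<lambda>s. s ^ ?n * phi_p p (u' s)) has_real_derivative - ?G r) (at r)"
    proof (rule has_field_derivative_transform_within_open [of _ _ _ "{0<..<R}"])
      fix s assume s: "s \<in> {0<..<R}"
      have "integral {0..s} (\<lambda>t. t ^ ?n * phi_p p (u (max 0 (t - 0)))) = integral {0..s} ?G"
        by (rule Henstock_Kurzweil_Integration.integral_cong) simp
      then have "A s = integral {0..s} ?G / s ^ ?n"
        by (simp only: A_def radavg_def)
      moreover have "phi_p p (u' s) = - A s"
        unfolding u'_def phi_p_minus using p by (subst phi_p_inverse) auto
      ultimately show "- integral {0..s} ?G = s ^ ?n * phi_p p (u' s)"
        using s by simp
    qed (use r in auto)
    then show "((\<lambda>s. s ^ ?n * phi_p p (u' s)) has_real_derivative - 1 * r ^ ?n * phi_p p (u r)) (at r)"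
      by simp
  qed
  moreover have "u 0 = 1" using ueq [of 0] R by (simp add: radstep_def)
  ultimately show ?thesis by blast
qed

section \<open>Oscillation through the Riccati equation\<close>

text \<open>The quantity (1 + f)^(1-q) lies between 0 and 1 and decreases at rate at least (q - 1) *
  c / 2^q, so there is no time for more. The factor 2^q comes from (1 + f)^q \<le> 2^q * (1 +
  f^q).\<close>

lemma blowup_time_bound:
  fixes f f' :: "real \<Rightarrow> real"
  assumes q: "q > 1" and c: "c > 0" and xy: "x \<le> y"
    and pos: "\<And>r. x \<le> r \<Longrightarrow> r \<le> y \<Longrightarrow> 0 < f r"
    and d: "\<And>r. x \<le> r \<Longrightarrow> r \<le> y \<Longrightarrow> (f has_real_derivative f' r) (at r)"
    and ge: "\<And>r. x \<le> r \<Longrightarrow> r \<le> y \<Longrightarrow> c * (1 + f r powr q) \<le> f' r"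
  shows "(q - 1) * c / 2 powr q * (y - x) \<le> 1"
proof -
  let ?k = "(q - 1) * c / 2 powr q"
  let ?h = "\<lambda>r. - ((1 + f r) powr (1 - q)) - ?k * r"
  have dh: "(?h has_real_derivative (q - 1) * (1 + f r) powr (- q) * f' r - ?k) (at r)" if "x \<le> r" "r \<le> y" for r
  proof -
    have *: "1 + f r > 0" using pos [OF that] by simp
    have "((\<lambda>r. (1 + f r) powr (1 - q)) has_real_derivative (1 - q) * (1 + f r) powr (1 - q - 1) * f' r) (at r)"
    proof (rule DERIV_chain2 [where f = "\<lambda>z. z powr (1 - q)" and g = "\<lambda>r. 1 + f r"])
      show "((\<lambda>z. z powr (1 - q)) has_real_derivative (1 - q) * (1 + f r) powr (1 - q - 1)) (at (1 + f r))"
        by (rule has_real_derivative_powr [OF *])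
      show "((\<lambda>r. 1 + f r) has_real_derivative f' r) (at r)"
        using DERIV_add [OF DERIV_const [of 1] d [OF that]] by simp
    qed
    then have "(?h has_real_derivative - ((1 - q) * (1 + f r) powr (1 - q - 1) * f' r) - ?k) (at r)"
      by (intro DERIV_diff DERIV_minus) (auto intro!: derivative_eq_intros)
    then show ?thesis by (rule DERIV_cong) (simp add: algebra_simps)
  qed
  have "?h x \<le> ?h y"
  proof (rule DERIV_nonneg_imp_nondecreasing [OF xy])
    fix r assume r: "x \<le> r" "r \<le> y"
    note f0 = pos [OF r]
    have "(1 + f r) powr q \<le> (2 * max 1 (f r)) powr q"
      using f0 q by (intro powr_mono2) auto
    also have "\<dots> = 2 powr q * max 1 (f r) powr q" using f0 by (simp add: powr_mult)
    also have "max 1 (f r) powr q \<le> 1 + f r powr q" by (auto simp: max_def)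
    finally have le: "(1 + f r) powr q \<le> 2 powr q * (1 + f r powr q)" by simp
    have "?k * (1 + f r) powr q \<le> ?k * (2 powr q * (1 + f r powr q))"
      by (rule mult_left_mono [OF le]) (use q c in auto)
    also have "\<dots> = (q - 1) * (c * (1 + f r powr q))" by simp
    also have "\<dots> \<le> (q - 1) * f' r" using ge [OF r] q by (intro mult_left_mono) auto
    finally have "?k * (1 + f r) powr q \<le> (q - 1) * f' r" .
    then have "?k * (1 + f r) powr q * (1 + f r) powr (- q) \<le> (q - 1) * f' r * (1 + f r) powr (- q)"
      by (rule mult_right_mono) simp
    moreover have "(1 + f r) powr q * (1 + f r) powr (- q) = 1"
      using f0 by (simp add: powr_minus)
    ultimately have "?k \<le> (q - 1) * f' r * (1 + f r) powr (- q)"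
      by (simp only: mult.assoc mult_1_right)
    moreover have "(q - 1) * f' r * (1 + f r) powr (- q) = (q - 1) * (1 + f r) powr (- q) * f' r"
      by simp
    ultimately have "0 \<le> (q - 1) * (1 + f r) powr (- q) * f' r - ?k" by linarith
    with dh [OF r] show "\<exists>z. (?h has_real_derivative z) (at r) \<and> 0 \<le> z" by blast
  qed
  moreover have "(1 + f x) powr (1 - q) \<le> 1 powr (1 - q)"
    using pos [of x] xy q by (intro powr_mono2') auto
  then have "(1 + f x) powr (1 - q) \<le> 1" by simp
  moreover have "(1 + f y) powr (1 - q) \<ge> 0" by simp
  ultimately have "?k * y - ?k * x \<le> 1" by linarith
  then show ?thesis by (simp add: right_diff_distrib)
qed

text \<open>The quotient of \<open>phi_p\<close> of u' and of u satisfies the generalised Riccati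
  equation, with q = p / (p - 1): w' = -1 - (N-1)/r * w - (p-1) * |w|^q.\<close>

lemma riccati_deriv:
  assumes p: "p > 1" and u: "radsol N p 1 R u u'" and r: "r \<in> {0<..<R}" and ne: "u r \<noteq> 0"
  shows "((\<lambda>s. phi_p p (u' s) / phi_p p (u s)) has_real_derivative
     - 1 - real (N - 1) / r * (phi_p p (u' r) / phi_p p (u r))
       - (p - 1) * \<bar>phi_p p (u' r) / phi_p p (u r)\<bar> powr (p / (p - 1))) (at r)"
proof -
  have pu: "phi_p p (u r) \<noteq> 0" using ne by simp
  have "((\<lambda>s. phi_p p (u' s) / phi_p p (u s)) has_real_derivative
     ((- 1 * phi_p p (u r) - real (N - 1) / r * phi_p p (u' r)) * phi_p p (u r)
       - phi_p p (u' r) * ((p - 1) * \<bar>u r\<bar> powr (p - 2) * u' r)) / (phi_p p (u r) * phi_p p (u r))) (at r)"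
    by (intro DERIV_divide radsol_phi_deriv [OF p u r] pu
        DERIV_chain2 [OF has_derivative_phi_p [OF ne] radsol_deriv [OF p u r]])
  moreover have "\<bar>phi_p p (u' r) / phi_p p (u r)\<bar> powr (p / (p - 1))
     = phi_p p (u' r) * u' r * \<bar>u r\<bar> powr (p - 2) / (phi_p p (u r) * phi_p p (u r))"
  proof -
    have "\<bar>phi_p p (u' r) / phi_p p (u r)\<bar> powr (p / (p - 1)) = \<bar>u' r\<bar> powr p / \<bar>u r\<bar> powr p"
      using p by (simp add: abs_phi_p powr_divide powr_powr)
    also have "\<bar>u r\<bar> powr p = \<bar>phi_p p (u r)\<bar> * \<bar>phi_p p (u r)\<bar> / \<bar>u r\<bar> powr (p - 2)"
      using ne by (simp add: abs_phi_p flip: powr_add powr_diff)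
    also have "\<bar>phi_p p (u r)\<bar> * \<bar>phi_p p (u r)\<bar> = phi_p p (u r) * phi_p p (u r)" by simp
    finally show ?thesis by (simp add: phi_p_times_self [OF p])
  qed
  ultimately show ?thesis
    using pu by (elim DERIV_cong) (simp add: field_simps)
qed

text \<open>Far from the origin the Riccati variable \<open>w\<close> satisfies \<open>w' \<le> - \<kappa> (1 + \<bar>w\<bar> powr q)\<close> with \<open>q > 1\<close>,
  so it blows up within a bounded time.\<close>

lemma radsol_oscillates:
  assumes p: "p > 1"
  obtains r0 L :: real where "r0 > 0" "L > 0"
    "\<And>R u u' a b. radsol N p 1 R u u' \<Longrightarrow> r0 \<le> a \<Longrightarrow> a + L \<le> b \<Longrightarrow> b \<le> R \<Longrightarrow> \<exists>r\<in>{a<..<b}. u r = 0"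
proof -
  define q where "q = p / (p - 1)"
  have q: "q > 1" using p by (simp add: q_def)
  \<comment> \<open>Half of the smaller coefficient in -1 - (p-1) * |w|^q. The other half pays for
    the friction term, using |w| \<le> 1 + |w|^q and (N-1)/r \<le> \<kappa> beyond
    \<open>r0\<close>.\<close>
  define \<kappa> where "\<kappa> = min 1 (p - 1) / 2"
  have k: "\<kappa> > 0" "2 * \<kappa> \<le> 1" "2 * \<kappa> \<le> p - 1" using p by (auto simp: \<kappa>_def)
  define r0 where "r0 = real (N - 1) / \<kappa> + 1"
  \<comment> \<open>The longest time that \<open>blowup_time_bound\<close> allows; a sign-definite
    stretch of length 5/4 * T is already a contradiction.\<close>
  define T where "T = 2 powr q / ((q - 1) * \<kappa>)"
  have T: "T > 0" using q k by (simp add: T_def)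
  have kT: "(q - 1) * \<kappa> / 2 powr q * T = 1" using q k by (simp add: T_def)
  define L where "L = 4 * T"
  have r0: "r0 > 0" using k by (simp add: r0_def add_nonneg_pos)
  have "\<exists>r\<in>{a<..<b}. u r = 0"
    if u: "radsol N p 1 R u u'" and a: "r0 \<le> a" and ab: "a + L \<le> b" and b: "b \<le> R" for R u u' a b
  proof (rule ccontr)
    assume "\<not> ?thesis"
    then have ne: "u r \<noteq> 0" if "a < r" "r < b" for r using that by auto
    define w where "w s = phi_p p (u' s) / phi_p p (u s)" for s
    define w' where "w' r = - 1 - real (N - 1) / r * w r - (p - 1) * \<bar>w r\<bar> powr q" for r
    have dw: "(w has_real_derivative w' r) (at r)" if r: "a < r" "r < b" for r
    proof -
      have "r \<in> {0<..<R}" using r a r0 b by auto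
      then show ?thesis
        unfolding w_def w'_def q_def by (rule riccati_deriv [OF p u _ ne [OF r]])
    qed
    have w'le: "w' r \<le> - (\<kappa> * (1 + \<bar>w r\<bar> powr q))" if r: "a < r" "r < b" for r
    proof -
      have rpos: "r > 0" using r a r0 by linarith
      have "real (N - 1) / \<kappa> \<le> r" using r a by (simp add: r0_def)
      then have le: "real (N - 1) / r \<le> \<kappa>"
        using rpos k by (simp add: divide_le_eq mult.commute)
      have wle: "\<bar>w r\<bar> \<le> 1 + \<bar>w r\<bar> powr q"
      proof (cases "\<bar>w r\<bar> \<le> 1")
        case False
        then have "\<bar>w r\<bar> powr 1 \<le> \<bar>w r\<bar> powr q" using q by (intro powr_mono) auto
        then show ?thesis by simp
      qed (simp add: add_increasing2)
      have "- (real (N - 1) / r * w r) = real (N - 1) / r * (- w r)" by simp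
      also have "\<dots> \<le> real (N - 1) / r * \<bar>w r\<bar>"
        using rpos by (intro mult_left_mono) auto
      also have "\<dots> \<le> \<kappa> * (1 + \<bar>w r\<bar> powr q)"
        using le wle rpos k by (intro mult_mono) auto
      finally have 1: "- (real (N - 1) / r * w r) \<le> \<kappa> * (1 + \<bar>w r\<bar> powr q)" .
      have "2 * \<kappa> * \<bar>w r\<bar> powr q \<le> (p - 1) * \<bar>w r\<bar> powr q"
        using k by (intro mult_right_mono) auto
      with 1 k show ?thesis by (simp add: w'_def algebra_simps)
    qed
    \<comment> \<open>As w decreases, it is positive to the left of m if w m \<ge> 0, and negative
      from m on otherwise. On either side of m there is room for a stretch longer than T.\<close>
    define m where "m = a + 2 * T"
    have m: "a < m" "m < b" using T ab by (auto simp: m_def L_def)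
    have decr: "w y < w x" if "a < x" "x < y" "y < b" for x y
    proof (rule DERIV_neg_imp_decreasing [OF that(2)])
      fix r assume "x \<le> r" "r \<le> y"
      then have r: "a < r" "r < b" using that by auto
      have "0 < \<kappa> * (1 + \<bar>w r\<bar> powr q)" using k by (intro mult_pos_pos add_pos_nonneg) auto
      then show "\<exists>z. (w has_real_derivative z) (at r) \<and> z < 0"
        using dw [OF r] w'le [OF r] by (intro exI [of _ "w' r"]) auto
    qed
    show False
    proof (cases "w m \<ge> 0")
      case True
      \<comment> \<open>Time is reversed, so that the decreasing positive function w becomes an
        increasing one.\<close>
      let ?x = "- (a + T * 7 / 4)" and ?y = "- (a + T / 2)"
      have in_ab: "a < - r" "- r < m" if "?x \<le> r" "r \<le> ?y" for r
        using that T by (auto simp: m_def)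
      have "(q - 1) * \<kappa> / 2 powr q * (?y - ?x) \<le> 1"
      proof (rule blowup_time_bound [where f = "\<lambda>r. w (- r)" and f' = "\<lambda>r. - w' (- r)", OF q k(1)])
        fix r assume r: "?x \<le> r" "r \<le> ?y"
        have ab: "a < - r" "- r < b" using in_ab [OF r] m by auto
        show pos: "0 < w (- r)" using decr [of "- r" m] in_ab [OF r] m True by auto
        show "((\<lambda>r. w (- r)) has_real_derivative - w' (- r)) (at r)"
          using DERIV_chain2 [where g = uminus and x = r, OF dw [OF ab] DERIV_minus [OF DERIV_ident]] by simp
        show "\<kappa> * (1 + w (- r) powr q) \<le> - w' (- r)"
          using w'le [OF ab] pos by simp
      qed (use T in auto)
      moreover have "?y - ?x = T * (5 / 4)" by simp
      then have "(q - 1) * \<kappa> / 2 powr q * (?y - ?x) = 5 / 4"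
        using kT by (simp only: mult.assoc [symmetric])
      ultimately have "5 / 4 \<le> (1 :: real)" by (simp only:)
      then show False by simp
    next
      case False
      let ?x = "m" and ?y = "m + T * 5 / 4"
      have "(q - 1) * \<kappa> / 2 powr q * (?y - ?x) \<le> 1"
      proof (rule blowup_time_bound [where f = "\<lambda>r. - w r" and f' = "\<lambda>r. - w' r", OF q k(1)])
        fix r assume r: "?x \<le> r" "r \<le> ?y"
        have ab: "a < r" "r < b" using r m ab T by (auto simp: m_def L_def)
        have "w r \<le> w m" using decr [of m r] r m ab by (cases "r = m") auto
        then show pos: "0 < - w r" using False by simp
        show "((\<lambda>r. - w r) has_real_derivative - w' r) (at r)"
          by (rule DERIV_minus [OF dw [OF ab]])
        show "\<kappa> * (1 + (- w r) powr q) \<le> - w' r"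
          using w'le [OF ab] pos by simp
      qed (use T in auto)
      moreover have "?y - ?x = T * (5 / 4)" by simp
      then have "(q - 1) * \<kappa> / 2 powr q * (?y - ?x) = 5 / 4"
        using kT by (simp only: mult.assoc [symmetric])
      ultimately have "5 / 4 \<le> (1 :: real)" by (simp only:)
      then show False by simp
    qed
  qed
  moreover have "L > 0" using T by (simp add: L_def)
  ultimately show ?thesis using that r0 by blast
qed

text \<open>Beyond \<open>r0\<close> each of k consecutive windows of length L contains a zero.
  Hence there are at least k zeros in \<open>{0..R}\<close>, and the first k of all zeros are listed
  in order.\<close>

lemma ex_radial_nodes:
  assumes p: "p > 1"
  obtains R U U' z where "radsol N p 1 R U U'" "R > 0" "U 0 \<noteq> 0" "z 0 = (0::real)" "z k \<le> R"
    "\<And>i. i < k \<Longrightarrow> z i < z (Suc i)" "\<And>i. 1 \<le> i \<Longrightarrow> i \<le> k \<Longrightarrow> U (z i) = 0"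
    "\<And>i r. i < k \<Longrightarrow> z i < r \<Longrightarrow> r < z (Suc i) \<Longrightarrow> U r \<noteq> 0"
proof -
  obtain r0 L where r0: "r0 > 0" and L: "L > 0"
    and osc: "\<And>R u u' a b. radsol N p 1 R u u' \<Longrightarrow> r0 \<le> a \<Longrightarrow> a + L \<le> b \<Longrightarrow> b \<le> R \<Longrightarrow> \<exists>r\<in>{a<..<b}. u r = 0"
    by (rule radsol_oscillates [OF p, where N = N]) (rule that)
  define R where "R = r0 + real k * L"
  have R: "R > 0" using r0 L by (simp add: R_def add_pos_nonneg)
  obtain U U' where U: "radsol N p 1 R U U'" and U0: "U 0 = 1" using ex_radsol [OF p R] by blast
  define Z where "Z = {r\<in>{0..R}. U r = 0}"
  have finZ: "finite Z"
    unfolding Z_def by (rule radsol_finite_zeros [OF p U _ R, of 0]) (use R U0 in auto)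
  have "\<exists>r\<in>{r0 + real j * L<..<r0 + real (Suc j) * L}. U r = 0" if "j < k" for j
  proof (rule osc [OF U])
    have "real (Suc j) * L \<le> real k * L" using that L by (intro mult_right_mono) auto
    then show "r0 + real (Suc j) * L \<le> R" by (simp add: R_def)
  qed (use L in \<open>auto simp: algebra_simps\<close>)
  then obtain y where y: "\<And>j. j < k \<Longrightarrow> r0 + real j * L < y j \<and> y j < r0 + real (Suc j) * L \<and> U (y j) = 0"
    by (metis greaterThanLessThan_iff)
  have "y ` {..<k} \<subseteq> Z"
  proof
    fix x assume "x \<in> y ` {..<k}"
    then obtain j where j: "j < k" "x = y j" by auto
    have "real (Suc j) * L \<le> real k * L" using j L by (intro mult_right_mono) auto
    moreover have "0 \<le> real j * L" using L by simp
    ultimately show "x \<in> Z" using y [OF j(1)] j r0 by (auto simp: Z_def R_def)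
  qed
  moreover have "inj_on y {..<k}"
  proof (rule linorder_inj_onI)
    fix i j assume ij: "i < j" "i \<in> {..<k}" "j \<in> {..<k}"
    have "real (Suc i) * L \<le> real j * L" using ij L by (intro mult_right_mono) auto
    then show "y i \<noteq> y j" using y [of i] y [of j] ij by auto
  qed auto
  ultimately have cardZ: "k \<le> card Z"
    using card_inj_on_le [of y "{..<k}" Z] finZ by simp
  define zs where "zs = sorted_list_of_set Z"
  have zs: "set zs = Z" "length zs = card Z" "sorted_wrt (<) zs"
    using finZ by (auto simp: zs_def)
  \<comment> \<open>The list of zeros is shifted by one to make room for z 0 = 0, which bounds the
    first nodal interval but is not a zero of U.\<close>
  define z where "z i = (case i of 0 \<Rightarrow> 0 | Suc j \<Rightarrow> zs ! j)" for i
  have zsZ: "zs ! j \<in> Z" if "j < k" for j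
    using that zs cardZ by (metis nth_mem order_less_le_trans)
  have Z0: "x > 0" if "x \<in> Z" for x using that U0 by (cases "x = 0") (auto simp: Z_def)
  show ?thesis
  proof (rule that [OF U R])
    show "U 0 \<noteq> 0" using U0 by simp
    show "z 0 = 0" by (simp add: z_def)
    show "z k \<le> R"
      using zsZ R by (cases k) (auto simp: z_def Z_def)
    show "z i < z (Suc i)" if i: "i < k" for i
    proof (cases i)
      case 0
      then show ?thesis using Z0 zsZ i by (simp add: z_def)
    next
      case (Suc j)
      then show ?thesis
        using sorted_wrt_nth_less [OF zs(3), of j "Suc j"] i zs(2) cardZ by (simp add: z_def)
    qed
    show "U (z i) = 0" if i: "1 \<le> i" "i \<le> k" for i
      using i zsZ [of "i - 1"] by (cases i) (auto simp: z_def Z_def)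
    show "U r \<noteq> 0" if i: "i < k" and r: "z i < r" "r < z (Suc i)" for i r
    proof
      assume "U r = 0"
      moreover have "0 \<le> r" using r(1) zsZ [of "i - 1"] i Z0 by (cases i) (force simp: z_def)+
      moreover have "r \<le> R" using r(2) zsZ [OF i] by (simp add: z_def Z_def)
      ultimately have "r \<in> set zs" by (simp add: zs Z_def)
      then obtain m where m: "m < length zs" "zs ! m = r" by (auto simp: in_set_conv_nth)
      have "m < i"
      proof (rule ccontr)
        assume "\<not> m < i"
        then have "zs ! i \<le> zs ! m"
          using sorted_wrt_nth_less [OF zs(3), of i m] m by (cases "i = m") auto
        then show False using r m by (simp add: z_def)
      qed
      then obtain j where j: "i = Suc j" "m \<le> j" by (cases i) auto
      then have "zs ! m \<le> zs ! j"
        using sorted_wrt_nth_less [OF zs(3), of m j] i zs(2) cardZ by (cases "m = j") auto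
      then show False using r m j by (simp add: z_def)
    qed
  qed
qed

section \<open>Mollification\<close>

text \<open>The sequence D carries the derivatives of all orders, so smoothness is proved by
  exhibiting one family of functions.\<close>

definition smooth1 :: "(real \<Rightarrow> real) \<Rightarrow> bool" where
  "smooth1 g \<longleftrightarrow> (\<exists>D. D 0 = g \<and> (\<forall>n t. (D n has_real_derivative D (Suc n) t) (at t)))"

lemma smooth1_deriv:
  assumes "smooth1 g"
  obtains g' where "smooth1 g'" "\<And>t. (g has_real_derivative g' t) (at t)"
proof -
  obtain D where D: "D 0 = g" "\<And>n t. (D n has_real_derivative D (Suc n) t) (at t)"
    using assms unfolding smooth1_def by blast
  have "smooth1 (D 1)"
    unfolding smooth1_def by (rule exI [of _ "\<lambda>n. D (Suc n)"]) (simp add: D)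
  moreover have "(g has_real_derivative D 1 t) (at t)" for t
    using D(2) [of 0 t] by (simp add: D(1))
  ultimately show ?thesis by (rule that)
qed

lemma smooth1_scale:
  assumes "smooth1 g" shows "smooth1 (\<lambda>t. g (c * t))"
proof -
  obtain D where D: "D 0 = g" "\<And>n t. (D n has_real_derivative D (Suc n) t) (at t)"
    using assms unfolding smooth1_def by blast
  have "((\<lambda>t. c ^ n * D n (c * t)) has_real_derivative c ^ Suc n * D (Suc n) (c * t)) (at t)" for n t
  proof -
    have "((\<lambda>t. c * t) has_real_derivative c) (at t)" by (auto intro!: derivative_eq_intros)
    from DERIV_cmult [OF DERIV_chain2 [where g = "\<lambda>t. c * t", OF D(2) this], of "c ^ n" n]
    show ?thesis by (rule DERIV_cong) simp
  qed
  then show ?thesis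
    unfolding smooth1_def by (intro exI [of _ "\<lambda>n t. c ^ n * D n (c * t)"]) (simp add: D(1))
qed

text \<open>A family closed under differentiation consists of smooth functions: choose a derivative
  inside the family and iterate the choice.\<close>

lemma smooth1I:
  assumes "\<And>g. g \<in> G \<Longrightarrow> \<exists>g'\<in>G. \<forall>t. (g has_real_derivative g' t) (at t)" "g \<in> G"
  shows "smooth1 g"
proof -
  obtain d where d: "\<And>g. g \<in> G \<Longrightarrow> d g \<in> G \<and> (\<forall>t. (g has_real_derivative d g t) (at t))"
    using assms(1) by metis
  have "(d ^^ n) g \<in> G" for n by (induction n) (use assms(2) d in auto)
  then show ?thesis
    unfolding smooth1_def using d by (intro exI [of _ "\<lambda>n. (d ^^ n) g"]) simp
qed

text \<open>The derivatives of \<open>exp (- s)\<close>, \<open>s = 1 / (1 - t\<^sup>2)\<close>, are linear combinations of the monomials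
  \<open>s ^ a * t ^ b * exp (- s)\<close>.\<close>

definition bump_mono :: "nat \<Rightarrow> nat \<Rightarrow> real \<Rightarrow> real" where
  "bump_mono a b t = (if \<bar>t\<bar> < 1 then (1 / (1 - t\<^sup>2)) ^ a * t ^ b * exp (- (1 / (1 - t\<^sup>2))) else 0)"

text \<open>From s/n \<le> exp (s/n) one gets s^n \<le> n^n * exp s. Taking n = a + 2 leaves two
  spare powers of 1/s = 1 - t^2, and this quadratic decay forces a zero derivative at |t| =
  1.\<close>

lemma abs_bump_mono_le: "\<bar>bump_mono a b t\<bar> \<le> real (a + 2) ^ (a + 2) * (1 - t\<^sup>2)\<^sup>2"
proof (cases "\<bar>t\<bar> < 1")
  case True
  define s where "s = 1 / (1 - t\<^sup>2)"
  have t: "1 - t\<^sup>2 > 0" using True by (simp add: abs_square_less_1)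
  then have s: "s > 0" "1 - t\<^sup>2 = 1 / s" by (auto simp: s_def)
  let ?n = "a + 2"
  have "s / real ?n \<le> exp (s / real ?n)"
    using exp_ge_add_one_self [of "s / real ?n"] by linarith
  then have "(s / real ?n) ^ ?n \<le> exp (s / real ?n) ^ ?n"
    using s by (intro power_mono) auto
  also have "\<dots> = exp s" by (simp only: exp_of_nat_mult [symmetric]) simp
  finally have "s ^ ?n \<le> real ?n ^ ?n * exp s"
    by (simp add: power_divide divide_le_eq mult.commute)
  then have "s ^ ?n * exp (- s) \<le> real ?n ^ ?n * exp s * exp (- s)"
    by (rule mult_right_mono) simp
  also have "\<dots> = real ?n ^ ?n" by (simp add: exp_minus)
  finally have "s ^ a * s\<^sup>2 * exp (- s) \<le> real ?n ^ ?n"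
    by (simp only: power_add)
  then have "s ^ a * s\<^sup>2 * exp (- s) * (1 / s)\<^sup>2 \<le> real ?n ^ ?n * (1 / s)\<^sup>2"
    by (rule mult_right_mono) simp
  moreover have "s ^ a * s\<^sup>2 * exp (- s) * (1 / s)\<^sup>2 = s ^ a * exp (- s)"
    using s by (simp add: power_divide)
  ultimately have le: "s ^ a * exp (- s) \<le> real ?n ^ ?n * (1 - t\<^sup>2)\<^sup>2"
    by (simp only: s(2))
  have "\<bar>bump_mono a b t\<bar> = s ^ a * \<bar>t\<bar> ^ b * exp (- s)"
    using True s by (simp add: bump_mono_def abs_mult power_abs flip: s_def)
  also have "\<dots> \<le> s ^ a * 1 * exp (- s)"
    using True s by (intro mult_right_mono mult_left_mono power_le_one) auto
  also have "\<dots> \<le> real ?n ^ ?n * (1 - t\<^sup>2)\<^sup>2" using le by (simp only: mult_1_right)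
  finally show ?thesis .
qed (simp add: bump_mono_def)

text \<open>Inside (-1, 1) this is the product rule. At |t| = 1 the difference quotient is bounded
  by a constant times |h| * (2 * t + h)^2, by \<open>abs_bump_mono_le\<close>. The truncated
  exponent b - 1 is harmless because its coefficient is b.\<close>

lemma bump_mono_deriv:
  "(bump_mono a b has_real_derivative
     2 * real a * bump_mono (a + 1) (b + 1) t + real b * bump_mono a (b - 1) t - 2 * bump_mono (a + 2) (b + 1) t) (at t)"
proof -
  consider "\<bar>t\<bar> < 1" | "\<bar>t\<bar> > 1" | "\<bar>t\<bar> = 1" by linarith
  then show ?thesis
  proof cases
    case 1
    define s where "s = 1 / (1 - t\<^sup>2)"
    have t: "1 - t\<^sup>2 > 0" using 1 by (simp add: abs_square_less_1)
    have ds: "((\<lambda>t. 1 / (1 - t\<^sup>2)) has_real_derivative 2 * t * s\<^sup>2) (at t)"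
      using t by (auto intro!: derivative_eq_intros simp: s_def power2_eq_square)
    have "((\<lambda>t. (1 / (1 - t\<^sup>2)) ^ a * t ^ b * exp (- (1 / (1 - t\<^sup>2)))) has_real_derivative
       (real a * s ^ (a - 1) * (2 * t * s\<^sup>2) * t ^ b + real b * t ^ (b - 1) * s ^ a) * exp (- s)
        + exp (- s) * (- (2 * t * s\<^sup>2)) * (s ^ a * t ^ b)) (at t)"
      using DERIV_mult [OF DERIV_mult [OF DERIV_power [OF ds, of a] DERIV_pow [of b t]]
           DERIV_chain2 [OF DERIV_exp DERIV_minus [OF ds]]]
      by (simp add: s_def mult_ac)
    moreover have "(real a * s ^ (a - 1) * (2 * t * s\<^sup>2) * t ^ b + real b * t ^ (b - 1) * s ^ a) * exp (- s)
        + exp (- s) * (- (2 * t * s\<^sup>2)) * (s ^ a * t ^ b)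
      = 2 * real a * bump_mono (a + 1) (b + 1) t + real b * bump_mono a (b - 1) t - 2 * bump_mono (a + 2) (b + 1) t"
    proof -
      have "bump_mono a b t = s ^ a * t ^ b * exp (- s)" for a b
        using 1 by (simp add: bump_mono_def s_def)
      then show ?thesis by (cases a) (auto simp: algebra_simps power2_eq_square)
    qed
    ultimately have "((\<lambda>t. (1 / (1 - t\<^sup>2)) ^ a * t ^ b * exp (- (1 / (1 - t\<^sup>2)))) has_real_derivative
      2 * real a * bump_mono (a + 1) (b + 1) t + real b * bump_mono a (b - 1) t - 2 * bump_mono (a + 2) (b + 1) t) (at t)"
      by simp
    then show ?thesis
      by (rule has_field_derivative_transform_within_open [of _ _ _ "{-1<..<1}"])
        (use 1 in \<open>auto simp: bump_mono_def\<close>)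
  next
    case 2
    have "((\<lambda>_. 0) has_real_derivative 0) (at t)" by simp
    then have "(bump_mono a b has_real_derivative 0) (at t)"
    proof (rule has_field_derivative_transform_within_open [of _ _ _ "- {-1..1}"])
      show "open (- {- 1..1 :: real})" by (simp add: open_Compl)
    qed (use 2 in \<open>auto simp: bump_mono_def\<close>)
    then show ?thesis using 2 by (simp add: bump_mono_def)
  next
    case 3
    let ?K = "real (a + 2) ^ (a + 2)"
    have t2: "t\<^sup>2 = 1" using 3 by (simp add: abs_square_eq_1)
    have "((\<lambda>h. (bump_mono a b (t + h) - bump_mono a b t) / h) \<longlongrightarrow> 0) (at 0)"
    proof (rule Lim_null_comparison)
      show "\<forall>\<^sub>F h in at 0. norm ((bump_mono a b (t + h) - bump_mono a b t) / h) \<le> ?K * (\<bar>h\<bar> * (2 * t + h)\<^sup>2)"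
        unfolding eventually_at_filter
      proof (intro always_eventually allI impI)
        fix h :: real assume h: "h \<noteq> 0"
        have "1 - (t + h)\<^sup>2 = - h * (2 * t + h)"
          using t2 by (simp add: power2_eq_square algebra_simps)
        then have "(1 - (t + h)\<^sup>2)\<^sup>2 = \<bar>h\<bar> * (\<bar>h\<bar> * (2 * t + h)\<^sup>2)"
          by (simp add: power_mult_distrib power2_eq_square mult_ac)
        then have "\<bar>bump_mono a b (t + h)\<bar> \<le> ?K * (\<bar>h\<bar> * (2 * t + h)\<^sup>2) * \<bar>h\<bar>"
          using abs_bump_mono_le [of a b "t + h"] by (simp add: mult_ac)
        moreover have "bump_mono a b t = 0" using 3 by (simp add: bump_mono_def)
        ultimately show "norm ((bump_mono a b (t + h) - bump_mono a b t) / h) \<le> ?K * (\<bar>h\<bar> * (2 * t + h)\<^sup>2)"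
          using h by (simp add: abs_divide divide_le_eq)
      qed
      show "((\<lambda>h. ?K * (\<bar>h\<bar> * (2 * t + h)\<^sup>2)) \<longlongrightarrow> 0) (at 0)"
        by (auto intro!: tendsto_eq_intros)
    qed
    then have "(bump_mono a b has_real_derivative 0) (at t)" by (simp add: DERIV_def)
    then show ?thesis using 3 by (simp add: bump_mono_def)
  qed
qed

inductive_set bump_span :: "(real \<Rightarrow> real) set" where
  mono: "bump_mono a b \<in> bump_span"
| add: "f \<in> bump_span \<Longrightarrow> g \<in> bump_span \<Longrightarrow> (\<lambda>t. f t + g t) \<in> bump_span"
| scale: "f \<in> bump_span \<Longrightarrow> (\<lambda>t. c * f t) \<in> bump_span"

lemma smooth1_bump_mono: "smooth1 (bump_mono a b)"
proof (rule smooth1I [of bump_span])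
  fix g assume "g \<in> bump_span"
  then show "\<exists>g'\<in>bump_span. \<forall>t. (g has_real_derivative g' t) (at t)"
  proof induction
    case (mono a b)
    let ?g' = "\<lambda>t. (2 * real a * bump_mono (a + 1) (b + 1) t + real b * bump_mono a (b - 1) t)
        + (- 2) * bump_mono (a + 2) (b + 1) t"
    have "?g' \<in> bump_span" by (intro bump_span.intros)
    moreover have "(bump_mono a b has_real_derivative ?g' t) (at t)" for t
      using bump_mono_deriv [of a b t] by (rule DERIV_cong) simp
    ultimately show ?case by (intro bexI [of _ ?g'] allI)
  next
    case (add f g)
    then obtain f' g' where "f' \<in> bump_span" "\<forall>t. (f has_real_derivative f' t) (at t)"
      "g' \<in> bump_span" "\<forall>t. (g has_real_derivative g' t) (at t)" by blast
    then show ?case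
      by (intro bexI [of _ "\<lambda>t. f' t + g' t"]) (auto intro: bump_span.add DERIV_add)
  next
    case (scale f c)
    then obtain f' where "f' \<in> bump_span" "\<forall>t. (f has_real_derivative f' t) (at t)" by blast
    then show ?case
      by (intro bexI [of _ "\<lambda>t. c * f' t"]) (auto intro: bump_span.scale DERIV_cmult)
  qed
qed (rule bump_span.mono)

text \<open>The class of convolution kernels: a partial derivative differentiates one factor and
  stays in the class, so iterated partial derivatives reduce to calculus on the line.\<close>

definition smooth_prod :: "(real^'n::finite \<Rightarrow> real) \<Rightarrow> bool" where
  "smooth_prod K \<longleftrightarrow> (\<exists>c g. (\<forall>i. smooth1 (g i)) \<and> K = (\<lambda>x. c * (\<Prod>i\<in>UNIV. g i (x $ i))))"

lemma smooth1_continuous: "smooth1 g \<Longrightarrow> continuous_on S g"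
  by (metis smooth1_deriv DERIV_isCont continuous_at_imp_continuous_on)

lemma smooth_prod_continuous:
  assumes "smooth_prod (K :: real^'n::finite \<Rightarrow> real)" shows "continuous_on UNIV K"
proof -
  obtain c g where g: "\<And>i. smooth1 (g i)" and K: "K = (\<lambda>x. c * (\<Prod>i\<in>UNIV. g i (x $ i)))"
    using assms unfolding smooth_prod_def by blast
  show ?thesis
    unfolding K by (intro continuous_intros continuous_on_compose2 [OF smooth1_continuous [OF g, of UNIV]]) auto
qed

lemma smooth_prod_partial:
  fixes K :: "real^'n::finite \<Rightarrow> real"
  assumes "smooth_prod K"
  obtains K' where "smooth_prod K'"
    "\<And>x t. ((\<lambda>t. K (x + t *\<^sub>R axis j 1)) has_real_derivative K' (x + t *\<^sub>R axis j 1)) (at t)"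
proof -
  obtain c g where g: "\<And>i. smooth1 (g i)" and K: "K = (\<lambda>x. c * (\<Prod>i\<in>UNIV. g i (x $ i)))"
    using assms unfolding smooth_prod_def by blast
  obtain d where d: "smooth1 d" "\<And>t. (g j has_real_derivative d t) (at t)"
    using smooth1_deriv [OF g] by blast
  define K' where "K' x = c * (\<Prod>i\<in>UNIV. (if i = j then d else g i) (x $ i))" for x
  have split: "(\<Prod>i\<in>UNIV. h i ((x + t *\<^sub>R axis j 1) $ i)) = h j (x $ j + t) * (\<Prod>i\<in>UNIV - {j}. h i (x $ i))"
    for h :: "'n \<Rightarrow> real \<Rightarrow> real" and x :: "real^'n" and t
  proof -
    have "(\<Prod>i\<in>UNIV. h i ((x + t *\<^sub>R axis j 1) $ i))
      = h j ((x + t *\<^sub>R axis j 1) $ j) * (\<Prod>i\<in>UNIV - {j}. h i ((x + t *\<^sub>R axis j 1) $ i))"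
      by (rule prod.remove) auto
    also have "(\<Prod>i\<in>UNIV - {j}. h i ((x + t *\<^sub>R axis j 1) $ i)) = (\<Prod>i\<in>UNIV - {j}. h i (x $ i))"
      by (rule prod.cong) (auto simp: axis_def)
    finally show ?thesis by simp
  qed
  show ?thesis
  proof (rule that)
    show "smooth_prod K'"
      unfolding smooth_prod_def
      by (rule exI [of _ c], rule exI [of _ "\<lambda>i. if i = j then d else g i"]) (auto simp: K'_def g d)
    fix x :: "real^'n" and t
    let ?P = "\<Prod>i\<in>UNIV - {j}. g i (x $ i)"
    have "((\<lambda>t. x $ j + t) has_real_derivative 1) (at t)" by (auto intro!: derivative_eq_intros)
    from DERIV_chain2 [where g = "\<lambda>t. x $ j + t", OF d(2) this]
    have "((\<lambda>t. g j (x $ j + t)) has_real_derivative d (x $ j + t)) (at t)" by simp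
    then have "((\<lambda>t. c * (g j (x $ j + t) * ?P)) has_real_derivative c * (d (x $ j + t) * ?P)) (at t)"
      by (intro DERIV_cmult DERIV_cmult_right)
    moreover have "(\<Prod>i\<in>UNIV - {j}. (if i = j then d else g i) (x $ i)) = ?P"
      by (rule prod.cong) auto
    ultimately show "((\<lambda>t. K (x + t *\<^sub>R axis j 1)) has_real_derivative K' (x + t *\<^sub>R axis j 1)) (at t)"
      unfolding K K'_def split [of g] split [of "\<lambda>i. if i = j then d else g i"] by simp
  qed
qed

section \<open>Smoothness of convolutions\<close>

text \<open>Convolution of f with K when the support of f lies in the box; integrating over a
  compact box permits differentiation under the integral for merely continuous f.\<close>

definition conv_box :: "real^'n::finite \<Rightarrow> real^'n \<Rightarrow> (real^'n \<Rightarrow> real) \<Rightarrow> (real^'n \<Rightarrow> real) \<Rightarrow> real^'n \<Rightarrow> real" where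
  "conv_box a b f K x = integral (cbox a b) (\<lambda>y. f y * K (x - y))"

lemma conv_box_continuous:
  assumes f: "continuous_on (cbox a b) f" and K: "smooth_prod K"
  shows "continuous_on UNIV (conv_box a b f K)"
  unfolding conv_box_def
proof (rule integral_continuous_on_param)
  show "continuous_on (UNIV \<times> cbox a b) (\<lambda>(x, y). f y * K (x - y))"
    unfolding split_beta
    by (intro continuous_intros continuous_on_compose2 [OF f] continuous_on_compose2 [OF smooth_prod_continuous [OF K]]) auto
qed

lemma conv_box_partial:
  assumes f: "continuous_on (cbox a b) f" and K: "smooth_prod K"
    and K': "smooth_prod K'"
    and d: "\<And>x t. ((\<lambda>t. K (x + t *\<^sub>R axis j 1)) has_real_derivative K' (x + t *\<^sub>R axis j 1)) (at t)"
  shows "((\<lambda>t. conv_box a b f K (x + t *\<^sub>R axis j 1)) has_real_derivative conv_box a b f K' x) (at 0)"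
proof -
  have "((\<lambda>t. integral (cbox a b) (\<lambda>y. f y * K (x + t *\<^sub>R axis j 1 - y))) has_field_derivative
     integral (cbox a b) (\<lambda>y. f y * K' (x + 0 *\<^sub>R axis j 1 - y))) (at 0 within UNIV)"
  proof (rule leibniz_rule_field_derivative)
    fix t y
    have "((\<lambda>t. K ((x - y) + t *\<^sub>R axis j 1)) has_real_derivative K' ((x - y) + t *\<^sub>R axis j 1)) (at t)"
      by (rule d)
    then have "((\<lambda>t. K (x + t *\<^sub>R axis j 1 - y)) has_real_derivative K' (x + t *\<^sub>R axis j 1 - y)) (at t)"
      by (simp add: algebra_simps)
    then show "((\<lambda>t. f y * K (x + t *\<^sub>R axis j 1 - y)) has_real_derivative f y * K' (x + t *\<^sub>R axis j 1 - y)) (at t within UNIV)"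
      by (intro DERIV_cmult) simp
  next
    fix t
    show "(\<lambda>y. f y * K (x + t *\<^sub>R axis j 1 - y)) integrable_on cbox a b"
      by (intro integrable_continuous continuous_intros f continuous_on_compose2 [OF smooth_prod_continuous [OF K]]) auto
  next
    show "continuous_on (UNIV \<times> cbox a b) (\<lambda>(t, y). f y * K' (x + t *\<^sub>R axis j 1 - y))"
      unfolding split_beta
      by (intro continuous_intros continuous_on_compose2 [OF f] continuous_on_compose2 [OF smooth_prod_continuous [OF K']]) auto
  qed auto
  then show ?thesis by (simp add: conv_box_def)
qed

text \<open>Every partial derivative falls on the kernel, so each iterated derivative is again a
  convolution of f with a kernel of the class \<open>smooth_prod\<close>.\<close>

lemma smooth_conv_box:
  assumes f: "continuous_on (cbox a b) f" and K: "smooth_prod K"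
  shows "smooth (conv_box a b f K)"
proof -
  have ex: "\<exists>K'. smooth_prod K' \<and> iter_partial is (conv_box a b f K) = conv_box a b f K'" for "is"
  proof (induction "is")
    case Nil
    then show ?case using K by auto
  next
    case (Cons i "is")
    then obtain K1 where K1: "smooth_prod K1" "iter_partial is (conv_box a b f K) = conv_box a b f K1" by blast
    obtain K2 where K2: "smooth_prod K2"
      "\<And>x t. ((\<lambda>t. K1 (x + t *\<^sub>R axis i 1)) has_real_derivative K2 (x + t *\<^sub>R axis i 1)) (at t)"
      using smooth_prod_partial [OF K1(1)] by blast
    have "partial_d i (conv_box a b f K1) = conv_box a b f K2"
      unfolding partial_d_def using DERIV_imp_deriv [OF conv_box_partial [OF f K1(1) K2]] by (intro ext)
    then show ?case using K1 K2 by auto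
  qed
  show ?thesis
    unfolding smooth_def
  proof (intro allI conjI)
    fix "is"
    obtain K1 where K1: "smooth_prod K1" "iter_partial is (conv_box a b f K) = conv_box a b f K1"
      using ex by blast
    show "continuous_on UNIV (iter_partial is (conv_box a b f K))"
      unfolding K1(2) by (rule conv_box_continuous [OF f K1(1)])
    fix i x
    obtain K2 where K2: "smooth_prod K2"
      "\<And>x t. ((\<lambda>t. K1 (x + t *\<^sub>R axis i 1)) has_real_derivative K2 (x + t *\<^sub>R axis i 1)) (at t)"
      using smooth_prod_partial [OF K1(1)] by blast
    show "(\<lambda>t. iter_partial is (conv_box a b f K) (x + t *\<^sub>R axis i 1)) differentiable at 0"
      unfolding K1(2) using conv_box_partial [OF f K1(1) K2]
      by (auto simp: real_differentiable_def)
  qed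
qed

text \<open>The set where D is nonzero is open and nonempty, hence not negligible.\<close>

lemma integral_pos_continuous:
  fixes D :: "'a::euclidean_space \<Rightarrow> real"
  assumes D: "continuous_on UNIV D" "\<And>x. 0 \<le> D x" "integrable lborel D" and x0: "D x0 \<noteq> 0"
  shows "0 < (\<integral>x. D x \<partial>lborel)"
proof -
  have op: "open {x. D x \<noteq> 0}"
    using open_vimage [OF open_Compl [OF closed_singleton [of "0::real"]], of D] D(1)
    by (simp add: vimage_def)
  have "(\<integral>x. D x \<partial>lborel) \<noteq> 0"
  proof
    assume "(\<integral>x. D x \<partial>lborel) = 0"
    then have "AE x in lborel. D x = 0"
      using integral_nonneg_eq_0_iff_AE [OF D(3)] D(2) by simp
    then have "{x. D x \<noteq> 0} \<in> null_sets lborel"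
      using op by (subst AE_iff_null_sets) auto
    then have "negligible {x. D x \<noteq> 0}" by (simp add: negligible_iff_null_sets null_sets_completionI)
    then show False using open_not_negligible [OF op] x0 by blast
  qed
  moreover have "(\<integral>x. D x \<partial>lborel) \<ge> 0" using D(2) by simp
  ultimately show ?thesis by simp
qed

lemma ex_mollifier:
  assumes e: "e > 0"
  obtains \<eta> :: "real^'n::finite \<Rightarrow> real" where "smooth_prod \<eta>" "\<And>x. 0 \<le> \<eta> x"
    "\<And>x. \<eta> x \<noteq> 0 \<Longrightarrow> norm x \<le> e" "integrable lborel \<eta>" "(\<integral>x. \<eta> x \<partial>lborel) = 1"
proof -
  \<comment> \<open>With this scale the support lies in the cube where every coordinate is at most e
    divided by the dimension, so even the sum of the absolute coordinates is at most e.\<close>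
  define c where "c = real CARD('n) / e"
  have c: "c > 0" using e by (simp add: c_def)
  define \<beta> where "\<beta> x = (\<Prod>i\<in>UNIV. bump_mono 0 0 (c * x $ i))" for x :: "real^'n"
  have b0: "bump_mono 0 0 t \<ge> 0" for t by (simp add: bump_mono_def)
  have b_nonneg: "0 \<le> \<beta> x" for x unfolding \<beta>_def by (intro prod_nonneg b0 ballI)
  have sb: "smooth_prod (\<lambda>x. k * \<beta> x)" for k
    unfolding smooth_prod_def \<beta>_def
    by (intro exI [of _ k] exI [of _ "\<lambda>i t. bump_mono 0 0 (c * t)"] conjI allI
        smooth1_scale [OF smooth1_bump_mono] refl)
  have supp: "norm x \<le> e" if "\<beta> x \<noteq> 0" for x
  proof -
    have "\<bar>c * x $ i\<bar> < 1" for i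
    proof (rule ccontr)
      assume "\<not> \<bar>c * x $ i\<bar> < 1"
      then have "bump_mono 0 0 (c * x $ i) = 0" by (simp add: bump_mono_def)
      then have "\<beta> x = 0" unfolding \<beta>_def by (intro prod_zero) auto
      with that show False by simp
    qed
    then have "\<bar>x $ i\<bar> \<le> e / real CARD('n)" for i
      using e by (simp add: c_def abs_mult field_simps less_imp_le)
    then have "(\<Sum>i\<in>UNIV. \<bar>x $ i\<bar>) \<le> (\<Sum>i\<in>(UNIV::'n set). e / real CARD('n))"
      by (intro sum_mono)
    then show ?thesis using norm_le_l1_cart [of x] by simp
  qed
  have cont: "continuous_on UNIV \<beta>"
    using smooth_prod_continuous [OF sb [of 1]] by simp
  have "(\<lambda>x. indicator (cball 0 e) x *\<^sub>R \<beta> x) = \<beta>"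
    using supp by (auto simp: fun_eq_iff indicator_def)
  moreover have "integrable lborel (\<lambda>x. indicator (cball 0 e) x *\<^sub>R \<beta> x)"
    by (intro borel_integrable_compact continuous_on_subset [OF cont]) auto
  ultimately have int: "integrable lborel \<beta>" by simp
  define I where "I = (\<integral>x. \<beta> x \<partial>lborel)"
  have "\<beta> 0 > 0" unfolding \<beta>_def by (intro prod_pos) (simp add: bump_mono_def)
  then have "I > 0"
    unfolding I_def by (intro integral_pos_continuous [OF cont b_nonneg int, of 0]) simp
  show ?thesis
  proof (rule that)
    show "smooth_prod (\<lambda>x. (1 / I) * \<beta> x)" by (rule sb)
    show "0 \<le> (1 / I) * \<beta> x" for x using b_nonneg \<open>I > 0\<close> by simp
    show "(1 / I) * \<beta> x \<noteq> 0 \<Longrightarrow> norm x \<le> e" for x using supp by simp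
    show "integrable lborel (\<lambda>x. (1 / I) * \<beta> x)" using int by simp
    show "(\<integral>x. (1 / I) * \<beta> x \<partial>lborel) = 1" using \<open>I > 0\<close> by (simp add: I_def [symmetric])
  qed
qed

lemma lborel_reflect: "distr lborel borel (\<lambda>y. x - y) = (lborel :: 'a::euclidean_space measure)"
  by (subst lborel_affine [of "- 1" x]) (auto simp: density_1)

lemma
  fixes f :: "'a::euclidean_space \<Rightarrow> 'b::{banach, second_countable_topology}"
  assumes f: "f \<in> borel_measurable borel"
  shows integral_lborel_reflect: "(\<integral>y. f (x - y) \<partial>lborel) = (\<integral>y. f y \<partial>lborel)"
    and integrable_lborel_reflect: "integrable lborel (\<lambda>y. f (x - y)) \<longleftrightarrow> integrable lborel f"
proof -
  have "(\<integral>y. f y \<partial>distr lborel borel (\<lambda>y. x - y)) = (\<integral>y. f (x - y) \<partial>lborel)"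
    by (rule integral_distr) (use f in auto)
  then show "(\<integral>y. f (x - y) \<partial>lborel) = (\<integral>y. f y \<partial>lborel)" by (simp add: lborel_reflect)
  have "integrable (distr lborel borel (\<lambda>y. x - y)) f \<longleftrightarrow> integrable lborel (\<lambda>y. f (x - y))"
    by (rule integrable_distr_eq) (use f in auto)
  then show "integrable lborel (\<lambda>y. f (x - y)) \<longleftrightarrow> integrable lborel f" by (simp add: lborel_reflect)
qed

lemma nn_integral_lborel_diff:
  fixes f :: "'a::euclidean_space \<Rightarrow> ennreal"
  assumes f: "f \<in> borel_measurable borel"
  shows "(\<integral>\<^sup>+x. f (x - y) \<partial>lborel) = (\<integral>\<^sup>+x. f x \<partial>lborel)"
proof -
  have "(\<integral>\<^sup>+x. f x \<partial>distr lborel borel ((+) (- y))) = (\<integral>\<^sup>+x. f ((+) (- y) x) \<partial>lborel)"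
    by (rule nn_integral_distr) (use f in auto)
  then show ?thesis by (simp add: lborel_distr_plus)
qed

lemma AE_lborel_reflect:
  fixes x :: "'a::euclidean_space"
  assumes "AE y in lborel. P y" shows "AE y in lborel. P (x - y)"
proof (rule AE_distrD [where f = "\<lambda>y. x - y" and M' = borel])
  show "(\<lambda>y. x - y) \<in> lborel \<rightarrow>\<^sub>M borel" by simp
  show "AE y in distr lborel borel (\<lambda>y. x - y). P y" unfolding lborel_reflect by (rule assms)
qed

section \<open>Mollifying Lipschitz functions without raising the energy\<close>

definition moll :: "(real^'n::finite \<Rightarrow> real) \<Rightarrow> (real^'n \<Rightarrow> real) \<Rightarrow> real^'n \<Rightarrow> real" where
  "moll f \<eta> x = (\<integral>y. f (x - y) * \<eta> y \<partial>lborel)"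

definition grad :: "(real^'n::finite \<Rightarrow> real) \<Rightarrow> real^'n \<Rightarrow> real^'n" where
  "grad f x = (\<chi> i. partial_d i f x)"

text \<open>The working class of competitors: Lipschitz functions of bounded support with an
  explicit Borel gradient, bounded by the same constant and valid almost everywhere. It contains the
  radial pieces, their minima and their truncations.\<close>

definition lipgrad :: "(real^'n::finite \<Rightarrow> real) \<Rightarrow> (real^'n \<Rightarrow> real^'n) \<Rightarrow> bool" where
  "lipgrad f G \<longleftrightarrow> (\<exists>L. L-lipschitz_on UNIV f \<and> (\<forall>x. norm (G x) \<le> L)) \<and>
     (\<exists>B. \<forall>x. f x \<noteq> 0 \<or> G x \<noteq> 0 \<longrightarrow> norm x \<le> B) \<and> G \<in> borel_measurable borel \<and>
     (AE x in lborel. (f has_derivative (\<lambda>h. G x \<bullet> h)) (at x))"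

lemma integrable_bounded_support:
  fixes f :: "'a::euclidean_space \<Rightarrow> real"
  assumes f: "f \<in> borel_measurable borel" and M: "\<And>x. \<bar>f x\<bar> \<le> M" and B: "\<And>x. f x \<noteq> 0 \<Longrightarrow> norm x \<le> B"
  shows "integrable lborel f"
proof (rule Bochner_Integration.integrable_bound)
  show "integrable lborel (\<lambda>x. M * indicator (cball 0 B) x)"
    by (intro integrable_mult_right integrable_real_indicator emeasure_bounded_finite) auto
  show "f \<in> borel_measurable lborel" using f by simp
  have "M \<ge> 0" using M [of 0] by linarith
  then show "AE x in lborel. norm (f x) \<le> norm (M * indicator (cball 0 B) x)"
    using M B by (intro AE_I2) (auto simp: indicator_def)
qed

lemma lipschitz_borel: "L-lipschitz_on UNIV (f :: 'a::euclidean_space \<Rightarrow> real) \<Longrightarrow> f \<in> borel_measurable borel"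
  by (intro borel_measurable_continuous_onI) (rule lipschitz_on_continuous_on)

lemma lipschitz_support_bounded:
  fixes f :: "'a::euclidean_space \<Rightarrow> real"
  assumes "L-lipschitz_on UNIV f" "\<And>x. f x \<noteq> 0 \<Longrightarrow> norm x \<le> B"
  obtains M where "\<And>x. \<bar>f x\<bar> \<le> M"
proof -
  have "compact (f ` cball 0 B)"
    by (intro compact_continuous_image continuous_on_subset [OF lipschitz_on_continuous_on [OF assms(1)]]) auto
  then obtain M where M: "\<forall>x\<in>cball 0 B. \<bar>f x\<bar> \<le> M"
    by (auto simp: bounded_iff dest!: compact_imp_bounded)
  have "\<bar>f x\<bar> \<le> max M 0" for x
  proof (cases "f x = 0")
    case False
    then show ?thesis using M assms(2) [of x] by force
  qed simp
  then show ?thesis by (rule that)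
qed

lemma smooth_grad_borel: "smooth (F :: real^'n::finite \<Rightarrow> real) \<Longrightarrow> grad F \<in> borel_measurable borel"
proof -
  assume F: "smooth F"
  have "continuous_on UNIV (partial_d i F)" for i
    using F unfolding smooth_def by (metis iter_partial.simps)
  then have "continuous_on UNIV (grad F)"
    unfolding grad_def by (intro continuous_on_vec_lambda) (simp add: eta_contract_eq)
  then show ?thesis by (rule borel_measurable_continuous_onI)
qed

context
  fixes f :: "real^'n::finite \<Rightarrow> real" and L B e :: real and \<eta> :: "real^'n \<Rightarrow> real"
  assumes lip: "L-lipschitz_on UNIV f" and fB: "\<And>x. f x \<noteq> 0 \<Longrightarrow> norm x \<le> B"
    and sp: "smooth_prod \<eta>" and eta0: "\<And>x. 0 \<le> \<eta> x" and supp: "\<And>x. \<eta> x \<noteq> 0 \<Longrightarrow> norm x \<le> e"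
    and ieta: "integrable lborel \<eta>" and eta1: "(\<integral>x. \<eta> x \<partial>lborel) = 1"
begin

lemma moll_meas: "\<eta> \<in> borel_measurable borel" "f \<in> borel_measurable borel"
  by (intro borel_measurable_continuous_onI smooth_prod_continuous sp) (rule lipschitz_borel [OF lip])

lemma integrable_mult_eta:
  assumes "g \<in> borel_measurable borel" "\<And>x. \<bar>g x\<bar> \<le> M"
  shows "integrable lborel (\<lambda>y. g (x - y) * \<eta> y)"
proof (rule Bochner_Integration.integrable_bound)
  show "integrable lborel (\<lambda>y. M * \<eta> y)" using ieta by simp
  have [measurable]: "g \<in> borel_measurable borel" "\<eta> \<in> borel_measurable borel" using assms moll_meas by auto
  show "(\<lambda>y. g (x - y) * \<eta> y) \<in> borel_measurable lborel" by measurable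
  have "0 \<le> M" using assms(2) [of 0] by linarith
  then show "AE y in lborel. norm (g (x - y) * \<eta> y) \<le> norm (M * \<eta> y)"
    using assms(2) eta0 by (intro AE_I2) (auto simp: abs_mult intro!: mult_right_mono)
qed

lemma moll_integrable: "integrable lborel (\<lambda>y. f (x - y) * \<eta> y)"
proof -
  obtain M where "\<And>x. \<bar>f x\<bar> \<le> M" using lipschitz_support_bounded [OF lip fB] by blast
  then show ?thesis by (intro integrable_mult_eta moll_meas)
qed

text \<open>Reflecting the integration variable moves x from f to the kernel; then the integral is a
  \<open>conv_box\<close> over a box around the support of f.\<close>

lemma smooth_moll: "smooth (moll f \<eta>)"
proof -
  have "bounded {x. f x \<noteq> 0}" using fB by (auto simp: bounded_iff)
  then obtain a where a: "{x. f x \<noteq> 0} \<subseteq> cbox (- a) a"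
    using bounded_subset_cbox_symmetric by blast
  have fc: "continuous_on (cbox (- a) a) f"
    using lipschitz_on_continuous_on [OF lip] continuous_on_subset by blast
  have "moll f \<eta> = conv_box (- a) a f \<eta>"
  proof
    fix x
    have [measurable]: "f \<in> borel_measurable borel" "\<eta> \<in> borel_measurable borel" using moll_meas by auto
    have m: "(\<lambda>y. f y * \<eta> (x - y)) \<in> borel_measurable borel" by measurable
    have i: "integrable lborel (\<lambda>y. f y * \<eta> (x - y))"
      using integrable_lborel_reflect [OF m, of x] moll_integrable [of x] by simp
    have "moll f \<eta> x = (\<integral>y. f y * \<eta> (x - y) \<partial>lborel)"
      using integral_lborel_reflect [OF m, of x] by (simp add: moll_def)
    also have "\<dots> = integral UNIV (\<lambda>y. f y * \<eta> (x - y))"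
      using integral_lborel [OF i] by simp
    also have "(\<lambda>y. f y * \<eta> (x - y)) = (\<lambda>y. if y \<in> cbox (- a) a then f y * \<eta> (x - y) else 0)"
      using a by (auto simp: fun_eq_iff)
    also have "integral UNIV \<dots> = conv_box (- a) a f \<eta> x"
      unfolding conv_box_def by (rule integral_restrict_UNIV)
    finally show "moll f \<eta> x = conv_box (- a) a f \<eta> x" .
  qed
  then show ?thesis using smooth_conv_box [OF fc sp] by simp
qed

lemma moll_close: "\<bar>moll f \<eta> x - f x\<bar> \<le> L * e"
proof -
  have L0: "L \<ge> 0" by (rule lipschitz_on_nonneg [OF lip])
  have i1: "integrable lborel (\<lambda>y. f x * \<eta> y)" using ieta by simp
  have "moll f \<eta> x - f x = (\<integral>y. f (x - y) * \<eta> y \<partial>lborel) - (\<integral>y. f x * \<eta> y \<partial>lborel)"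
    using ieta eta1 by (simp add: moll_def)
  also have "\<dots> = (\<integral>y. f (x - y) * \<eta> y - f x * \<eta> y \<partial>lborel)"
    by (rule Bochner_Integration.integral_diff [symmetric, OF moll_integrable i1])
  finally have eq: "moll f \<eta> x - f x = (\<integral>y. f (x - y) * \<eta> y - f x * \<eta> y \<partial>lborel)" .
  have "norm (\<integral>y. f (x - y) * \<eta> y - f x * \<eta> y \<partial>lborel) \<le> (\<integral>y. L * e * \<eta> y \<partial>lborel)"
  proof (rule Bochner_Integration.integral_norm_bound_integral)
    show "integrable lborel (\<lambda>y. f (x - y) * \<eta> y - f x * \<eta> y)"
      by (intro Bochner_Integration.integrable_diff moll_integrable i1)
    show "integrable lborel (\<lambda>y. L * e * \<eta> y)" using ieta by simp
    fix y
    show "norm (f (x - y) * \<eta> y - f x * \<eta> y) \<le> L * e * \<eta> y"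
    proof (cases "\<eta> y = 0")
      case False
      have "norm (f (x - y) * \<eta> y - f x * \<eta> y) = \<bar>f (x - y) - f x\<bar> * \<eta> y"
        using eta0 [of y] by (simp add: abs_mult flip: left_diff_distrib)
      also have "\<bar>f (x - y) - f x\<bar> \<le> L * norm y"
        using lipschitz_onD [OF lip, of "x - y" x] by (simp add: dist_norm)
      also have "L * norm y \<le> L * e" using supp [OF False] L0 by (intro mult_left_mono) auto
      finally show ?thesis using eta0 [of y] by (simp add: mult_right_mono)
    qed simp
  qed
  then show ?thesis using eq ieta eta1 by simp
qed

lemma moll_supp:
  assumes "moll f \<eta> x \<noteq> 0" shows "\<exists>y. dist x y \<le> e \<and> f y \<noteq> 0"
proof (rule ccontr)
  assume *: "\<not> ?thesis"
  have "(\<lambda>y. f (x - y) * \<eta> y) = (\<lambda>_. 0)"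
    using * supp by (fastforce simp: dist_norm fun_eq_iff)
  then show False using assms by (simp add: moll_def)
qed

context
  fixes G :: "real^'n \<Rightarrow> real^'n"
  assumes GL: "\<And>x. norm (G x) \<le> L" and Gm: "G \<in> borel_measurable borel"
    and diff: "AE x in lborel. (f has_derivative (\<lambda>h. G x \<bullet> h)) (at x)"
begin

text \<open>The derivative can also be put on f: difference quotients of f are bounded by L and
  converge at almost every x - y. As \<open>smooth_moll\<close> already guarantees the partial
  derivative, its value may be computed along a single sequence of steps.\<close>

lemma moll_partial:
  "integrable lborel (\<lambda>y. G (x - y) $ j * \<eta> y)"
  "partial_d j (moll f \<eta>) x = (\<integral>y. G (x - y) $ j * \<eta> y \<partial>lborel)"
proof -
  have L0: "L \<ge> 0" by (rule lipschitz_on_nonneg [OF lip])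
  have [measurable]: "f \<in> borel_measurable borel" "\<eta> \<in> borel_measurable borel" "G \<in> borel_measurable borel"
    using moll_meas Gm by auto
  have "(\<lambda>x. G x \<bullet> axis j 1) \<in> borel_measurable borel" by measurable
  then have Gj [measurable]: "(\<lambda>x. G x $ j) \<in> borel_measurable borel" by (simp add: inner_axis)
  have "\<bar>G x $ j\<bar> \<le> L" for x using component_le_norm_cart [of "G x" j] GL [of x] by linarith
  then show "integrable lborel (\<lambda>y. G (x - y) $ j * \<eta> y)"
    by (rule integrable_mult_eta [OF Gj])
  have "(\<lambda>t. moll f \<eta> (x + t *\<^sub>R axis j 1)) differentiable at 0"
    using smooth_moll unfolding smooth_def by (metis iter_partial.simps(1))
  then obtain D where D: "((\<lambda>t. moll f \<eta> (x + t *\<^sub>R axis j 1)) has_real_derivative D) (at 0)"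
    by (auto simp: real_differentiable_def)
  then have pD: "partial_d j (moll f \<eta>) x = D"
    unfolding partial_d_def by (rule DERIV_imp_deriv)
  define t where "t n = inverse (real (Suc n))" for n
  have tpos: "t n > 0" for n by (simp add: t_def)
  have t0: "t \<longlonglongrightarrow> 0" unfolding t_def using LIMSEQ_inverse_real_of_nat by simp
  then have ft: "filterlim t (at 0) sequentially"
    using tpos by (auto simp: filterlim_at intro!: always_eventually) (metis less_irrefl)
  have lim1: "(\<lambda>n. (moll f \<eta> (x + t n *\<^sub>R axis j 1) - moll f \<eta> x) / t n) \<longlonglongrightarrow> D"
    using filterlim_compose [OF D [unfolded DERIV_def] ft] by simp
  have eq: "(moll f \<eta> (x + t n *\<^sub>R axis j 1) - moll f \<eta> x) / t n
     = (\<integral>y. (f (x - y + t n *\<^sub>R axis j 1) - f (x - y)) / t n * \<eta> y \<partial>lborel)" for n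
  proof -
    have "moll f \<eta> (x + t n *\<^sub>R axis j 1) - moll f \<eta> x
       = (\<integral>y. f (x + t n *\<^sub>R axis j 1 - y) * \<eta> y - f (x - y) * \<eta> y \<partial>lborel)"
      unfolding moll_def by (rule Bochner_Integration.integral_diff [symmetric, OF moll_integrable moll_integrable])
    then have "(moll f \<eta> (x + t n *\<^sub>R axis j 1) - moll f \<eta> x) / t n
       = (\<integral>y. (f (x + t n *\<^sub>R axis j 1 - y) * \<eta> y - f (x - y) * \<eta> y) / t n \<partial>lborel)"
      by simp
    also have "\<dots> = (\<integral>y. (f (x - y + t n *\<^sub>R axis j 1) - f (x - y)) / t n * \<eta> y \<partial>lborel)"
      by (rule Bochner_Integration.integral_cong) (auto simp: algebra_simps diff_divide_distrib)
    finally show ?thesis .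
  qed
  have "(\<lambda>n. \<integral>y. (f (x - y + t n *\<^sub>R axis j 1) - f (x - y)) / t n * \<eta> y \<partial>lborel)
      \<longlonglongrightarrow> (\<integral>y. G (x - y) $ j * \<eta> y \<partial>lborel)"
  proof (rule integral_dominated_convergence)
    show "(\<lambda>y. G (x - y) $ j * \<eta> y) \<in> borel_measurable lborel" by measurable
    show "(\<lambda>y. (f (x - y + t n *\<^sub>R axis j 1) - f (x - y)) / t n * \<eta> y) \<in> borel_measurable lborel" for n
      by measurable
    show "integrable lborel (\<lambda>y. L * \<eta> y)" using ieta by simp
    show "AE y in lborel. norm ((f (x - y + t n *\<^sub>R axis j 1) - f (x - y)) / t n * \<eta> y) \<le> L * \<eta> y" for n
    proof (rule AE_I2)
      fix y
      have "\<bar>f (x - y + t n *\<^sub>R axis j 1) - f (x - y)\<bar> \<le> L * t n"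
        using lipschitz_onD [OF lip, of "x - y + t n *\<^sub>R axis j 1" "x - y"] tpos [of n]
        by (simp add: dist_norm norm_axis_1)
      then have "\<bar>(f (x - y + t n *\<^sub>R axis j 1) - f (x - y)) / t n\<bar> \<le> L"
        using tpos [of n] by (simp add: abs_divide divide_le_eq)
      then show "norm ((f (x - y + t n *\<^sub>R axis j 1) - f (x - y)) / t n * \<eta> y) \<le> L * \<eta> y"
        using eta0 [of y] by (simp only: real_norm_def abs_mult abs_of_nonneg mult_right_mono)
    qed
    show "AE y in lborel. (\<lambda>n. (f (x - y + t n *\<^sub>R axis j 1) - f (x - y)) / t n * \<eta> y) \<longlonglongrightarrow> G (x - y) $ j * \<eta> y"
      using AE_lborel_reflect [OF diff, of x]
    proof (rule AE_mp, intro AE_I2 impI)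
      fix y assume d: "(f has_derivative (\<lambda>h. G (x - y) \<bullet> h)) (at (x - y))"
      have "((\<lambda>s. x - y + s *\<^sub>R axis j 1) has_derivative (\<lambda>s. s *\<^sub>R axis j 1)) (at 0)"
        by (auto intro!: derivative_eq_intros)
      moreover have "(f has_derivative (\<lambda>h. G (x - y) \<bullet> h)) (at (x - y + 0 *\<^sub>R axis j 1))"
        using d by simp
      ultimately have "((\<lambda>s. f (x - y + s *\<^sub>R axis j 1)) has_derivative (\<lambda>s. G (x - y) \<bullet> (s *\<^sub>R axis j 1))) (at 0)"
        by (rule has_derivative_compose [where f = "\<lambda>s. x - y + s *\<^sub>R axis j 1"])
      then have "((\<lambda>s. f (x - y + s *\<^sub>R axis j 1)) has_real_derivative G (x - y) $ j) (at 0)"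
        by (simp add: has_field_derivative_def inner_axis mult_commute_abs)
      then have "(\<lambda>n. (f (x - y + t n *\<^sub>R axis j 1) - f (x - y)) / t n) \<longlonglongrightarrow> G (x - y) $ j"
        using filterlim_compose [OF _ ft] by (force simp: DERIV_def)
      then show "(\<lambda>n. (f (x - y + t n *\<^sub>R axis j 1) - f (x - y)) / t n * \<eta> y) \<longlonglongrightarrow> G (x - y) $ j * \<eta> y"
        by (intro tendsto_mult tendsto_const)
    qed
  qed
  then have "(\<lambda>n. (moll f \<eta> (x + t n *\<^sub>R axis j 1) - moll f \<eta> x) / t n) \<longlonglongrightarrow> (\<integral>y. G (x - y) $ j * \<eta> y \<partial>lborel)"
    by (simp only: eq)
  with lim1 show "partial_d j (moll f \<eta>) x = (\<integral>y. G (x - y) $ j * \<eta> y \<partial>lborel)"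
    unfolding pD by (rule LIMSEQ_unique)
qed

text \<open>Jensen's inequality, via the tangent line of \<open>s \<mapsto> s powr p\<close>.\<close>

lemma moll_grad_powr_le:
  assumes p: "p > 1"
  shows "integrable lborel (\<lambda>y. norm (G (x - y)) powr p * \<eta> y)"
    "norm (grad (moll f \<eta>) x) powr p \<le> (\<integral>y. norm (G (x - y)) powr p * \<eta> y \<partial>lborel)"
proof -
  have [measurable]: "G \<in> borel_measurable borel" using Gm by simp
  have L0: "L \<ge> 0" by (rule lipschitz_on_nonneg [OF lip])
  show ip: "integrable lborel (\<lambda>y. norm (G (x - y)) powr p * \<eta> y)"
    by (rule integrable_mult_eta [of "\<lambda>z. norm (G z) powr p" "L powr p"]) (use GL p in \<open>auto intro!: powr_mono2\<close>)
  have i1: "integrable lborel (\<lambda>y. norm (G (x - y)) * \<eta> y)"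
    by (rule integrable_mult_eta [of "\<lambda>z. norm (G z)" L]) (use GL in auto)
  let ?g = "grad (moll f \<eta>) x"
  define s where "s = norm ?g"
  have s0: "s \<ge> 0" by (simp add: s_def)
  \<comment> \<open>Pairing the averaged gradient with itself reduces the vector-valued integral to
    a scalar one and bounds its length by the average of \<open>norm (G (x - y))\<close>.\<close>
  have "s * s = ?g \<bullet> ?g" by (simp add: s_def flip: power2_eq_square power2_norm_eq_inner)
  also have "\<dots> = (\<Sum>j\<in>UNIV. ?g $ j * (\<integral>y. G (x - y) $ j * \<eta> y \<partial>lborel))"
    by (simp add: inner_vec_def grad_def moll_partial(2))
  also have "\<dots> = (\<Sum>j\<in>UNIV. (\<integral>y. ?g $ j * (G (x - y) $ j * \<eta> y) \<partial>lborel))"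
    by simp
  also have "\<dots> = (\<integral>y. (\<Sum>j\<in>UNIV. ?g $ j * (G (x - y) $ j * \<eta> y)) \<partial>lborel)"
    by (rule Bochner_Integration.integral_sum [symmetric]) (intro integrable_mult_right moll_partial(1))
  also have "\<dots> = (\<integral>y. (?g \<bullet> G (x - y)) * \<eta> y \<partial>lborel)"
    by (rule Bochner_Integration.integral_cong) (auto simp: inner_vec_def sum_distrib_left mult_ac)
  also have "\<dots> \<le> (\<integral>y. s * (norm (G (x - y)) * \<eta> y) \<partial>lborel)"
  proof (rule integral_mono)
    show "integrable lborel (\<lambda>y. (?g \<bullet> G (x - y)) * \<eta> y)"
    proof (rule integrable_mult_eta [of "\<lambda>z. ?g \<bullet> G z" "s * L"])
      show "\<bar>?g \<bullet> G z\<bar> \<le> s * L" for z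
        using Cauchy_Schwarz_ineq2 [of ?g "G z"] mult_left_mono [OF GL [of z] s0] by (simp add: s_def)
    qed measurable
    show "integrable lborel (\<lambda>y. s * (norm (G (x - y)) * \<eta> y))" using i1 by simp
    fix y
    have "?g \<bullet> G (x - y) \<le> s * norm (G (x - y))" unfolding s_def by (rule norm_cauchy_schwarz)
    then show "(?g \<bullet> G (x - y)) * \<eta> y \<le> s * (norm (G (x - y)) * \<eta> y)"
      using eta0 [of y] by (simp add: mult_right_mono flip: mult.assoc)
  qed
  also have "\<dots> = s * (\<integral>y. norm (G (x - y)) * \<eta> y \<partial>lborel)" by simp
  finally have ss: "s * s \<le> s * (\<integral>y. norm (G (x - y)) * \<eta> y \<partial>lborel)" .
  have sle: "s \<le> (\<integral>y. norm (G (x - y)) * \<eta> y \<partial>lborel)"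
  proof (cases "s = 0")
    case True
    then show ?thesis using eta0 by (auto intro!: integral_nonneg_AE)
  qed (use ss s0 in simp)
  let ?k = "p * s powr (p - 1)"
  have "s powr p + ?k * ((\<integral>y. norm (G (x - y)) * \<eta> y \<partial>lborel) - s)
     = (\<integral>y. s powr p * \<eta> y + ?k * (norm (G (x - y)) * \<eta> y - s * \<eta> y) \<partial>lborel)"
    using ieta i1 eta1 by simp
  also have "\<dots> \<le> (\<integral>y. norm (G (x - y)) powr p * \<eta> y \<partial>lborel)"
  proof (rule integral_mono [OF _ ip])
    show "integrable lborel (\<lambda>y. s powr p * \<eta> y + ?k * (norm (G (x - y)) * \<eta> y - s * \<eta> y))"
      using ieta i1 by simp
    fix y
    have "(s powr p + ?k * (norm (G (x - y)) - s)) * \<eta> y \<le> norm (G (x - y)) powr p * \<eta> y"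
      using powr_tangent_le [OF p, of "norm (G (x - y))" s] s0 eta0 [of y] by (intro mult_right_mono) auto
    then show "s powr p * \<eta> y + ?k * (norm (G (x - y)) * \<eta> y - s * \<eta> y) \<le> norm (G (x - y)) powr p * \<eta> y"
      by (simp add: algebra_simps)
  qed
  finally show "norm ?g powr p \<le> (\<integral>y. norm (G (x - y)) powr p * \<eta> y \<partial>lborel)"
  proof -
    assume "s powr p + ?k * ((\<integral>y. norm (G (x - y)) * \<eta> y \<partial>lborel) - s) \<le> (\<integral>y. norm (G (x - y)) powr p * \<eta> y \<partial>lborel)"
    moreover have "0 \<le> ?k * ((\<integral>y. norm (G (x - y)) * \<eta> y \<partial>lborel) - s)"
      using p sle by (intro mult_nonneg_nonneg) auto
    ultimately show ?thesis unfolding s_def by linarith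
  qed
qed

text \<open>Integrate the pointwise Jensen estimate over x and exchange the order of integration;
  the inner integral is translation invariant and the kernel has mass 1.\<close>

lemma moll_energy_le:
  assumes p: "p > 1" and iG: "integrable lborel (\<lambda>x. norm (G x) powr p)"
  shows "integrable lborel (\<lambda>x. norm (grad (moll f \<eta>) x) powr p)"
    "(\<integral>x. norm (grad (moll f \<eta>) x) powr p \<partial>lborel) \<le> (\<integral>x. norm (G x) powr p \<partial>lborel)"
proof -
  have [measurable]: "G \<in> borel_measurable borel" "\<eta> \<in> borel_measurable borel" "grad (moll f \<eta>) \<in> borel_measurable borel"
    using Gm moll_meas smooth_grad_borel [OF smooth_moll] by auto
  have "(\<integral>\<^sup>+x. ennreal (norm (grad (moll f \<eta>) x) powr p) \<partial>lborel)
      \<le> (\<integral>\<^sup>+x. \<integral>\<^sup>+y. ennreal (norm (G (x - y)) powr p) * ennreal (\<eta> y) \<partial>lborel \<partial>lborel)"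
  proof (rule nn_integral_mono)
    fix x
    have "ennreal (norm (grad (moll f \<eta>) x) powr p) \<le> ennreal (\<integral>y. norm (G (x - y)) powr p * \<eta> y \<partial>lborel)"
      by (intro ennreal_leI moll_grad_powr_le p)
    also have "\<dots> = (\<integral>\<^sup>+y. ennreal (norm (G (x - y)) powr p * \<eta> y) \<partial>lborel)"
      using eta0 by (intro nn_integral_eq_integral [symmetric] moll_grad_powr_le p) auto
    also have "\<dots> = (\<integral>\<^sup>+y. ennreal (norm (G (x - y)) powr p) * ennreal (\<eta> y) \<partial>lborel)"
      by (intro nn_integral_cong ennreal_mult) (auto simp: eta0)
    finally show "ennreal (norm (grad (moll f \<eta>) x) powr p)
      \<le> (\<integral>\<^sup>+y. ennreal (norm (G (x - y)) powr p) * ennreal (\<eta> y) \<partial>lborel)" .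
  qed
  also have "\<dots> = (\<integral>\<^sup>+y. \<integral>\<^sup>+x. ennreal (norm (G (x - y)) powr p) * ennreal (\<eta> y) \<partial>lborel \<partial>lborel)"
  proof -
    have m: "(\<lambda>z. ennreal (norm (G (fst z - snd z)) powr p) * ennreal (\<eta> (snd z))) \<in> borel_measurable (lborel \<Otimes>\<^sub>M lborel)"
      by measurable
    show ?thesis using lborel_pair.Fubini [OF m] by simp
  qed
  also have "\<dots> = (\<integral>\<^sup>+y. (\<integral>\<^sup>+x. ennreal (norm (G x) powr p) \<partial>lborel) * ennreal (\<eta> y) \<partial>lborel)"
  proof (rule nn_integral_cong)
    fix y
    have "(\<integral>\<^sup>+x. ennreal (norm (G (x - y)) powr p) * ennreal (\<eta> y) \<partial>lborel)
       = (\<integral>\<^sup>+x. ennreal (norm (G (x - y)) powr p) \<partial>lborel) * ennreal (\<eta> y)"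
      by (rule nn_integral_multc) measurable
    also have "(\<integral>\<^sup>+x. ennreal (norm (G (x - y)) powr p) \<partial>lborel) = (\<integral>\<^sup>+x. ennreal (norm (G x) powr p) \<partial>lborel)"
      by (rule nn_integral_lborel_diff [of "\<lambda>x. ennreal (norm (G x) powr p)"]) measurable
    finally show "(\<integral>\<^sup>+x. ennreal (norm (G (x - y)) powr p) * ennreal (\<eta> y) \<partial>lborel)
       = (\<integral>\<^sup>+x. ennreal (norm (G x) powr p) \<partial>lborel) * ennreal (\<eta> y)" .
  qed
  also have "\<dots> = (\<integral>\<^sup>+x. ennreal (norm (G x) powr p) \<partial>lborel) * (\<integral>\<^sup>+y. ennreal (\<eta> y) \<partial>lborel)"
    by (rule nn_integral_cmult) measurable
  also have "(\<integral>\<^sup>+y. ennreal (\<eta> y) \<partial>lborel) = 1"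
    using nn_integral_eq_integral [OF ieta] eta0 eta1 by simp
  also have "(\<integral>\<^sup>+x. ennreal (norm (G x) powr p) \<partial>lborel) = ennreal (\<integral>x. norm (G x) powr p \<partial>lborel)"
    by (rule nn_integral_eq_integral [OF iG]) simp
  finally have le: "(\<integral>\<^sup>+x. ennreal (norm (grad (moll f \<eta>) x) powr p) \<partial>lborel) \<le> ennreal (\<integral>x. norm (G x) powr p \<partial>lborel)"
    by simp
  show i: "integrable lborel (\<lambda>x. norm (grad (moll f \<eta>) x) powr p)"
  proof (rule integrableI_bounded)
    show "(\<lambda>x. norm (grad (moll f \<eta>) x) powr p) \<in> borel_measurable lborel" by measurable
    show "(\<integral>\<^sup>+x. ennreal (norm (norm (grad (moll f \<eta>) x) powr p)) \<partial>lborel) < \<infinity>"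
      using le_less_trans [OF le ennreal_less_top] by simp
  qed
  have "ennreal (\<integral>x. norm (grad (moll f \<eta>) x) powr p \<partial>lborel) \<le> ennreal (\<integral>x. norm (G x) powr p \<partial>lborel)"
    using le nn_integral_eq_integral [OF i] by simp
  then show "(\<integral>x. norm (grad (moll f \<eta>) x) powr p \<partial>lborel) \<le> (\<integral>x. norm (G x) powr p \<partial>lborel)"
    by (subst (asm) ennreal_le_iff) auto
qed

end

end

lemma lipgrad_integrable:
  assumes p: "p > 1" and fG: "lipgrad f G"
  shows "integrable lborel (\<lambda>x. norm (G x) powr p)" "integrable lborel (\<lambda>x. \<bar>f x\<bar> powr p)"
proof -
  obtain L B where L: "L-lipschitz_on UNIV f" "\<And>x. norm (G x) \<le> L"
    and B: "\<And>x. f x \<noteq> 0 \<or> G x \<noteq> 0 \<Longrightarrow> norm x \<le> B" and Gm: "G \<in> borel_measurable borel"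
    using fG unfolding lipgrad_def by blast
  obtain M where M: "\<And>x. \<bar>f x\<bar> \<le> M" using lipschitz_support_bounded [OF L(1)] B by blast
  have [measurable]: "G \<in> borel_measurable borel" "f \<in> borel_measurable borel"
    using Gm lipschitz_borel [OF L(1)] by auto
  show "integrable lborel (\<lambda>x. norm (G x) powr p)"
    by (rule integrable_bounded_support [where M = "L powr p" and B = B])
      (use L(2) B p in \<open>auto intro!: powr_mono2\<close>)
  show "integrable lborel (\<lambda>x. \<bar>f x\<bar> powr p)"
    by (rule integrable_bounded_support [where M = "M powr p" and B = B])
      (use M B p in \<open>auto intro!: powr_mono2\<close>)
qed

text \<open>No increase of energy together with convergence of the norm preserves a strict Rayleigh
  inequality along the tail of the sequence.\<close>

lemma mollify_sequence:
  fixes f :: "real^'n::finite \<Rightarrow> real"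
  assumes p: "p > 1" and fG: "lipgrad f G"
  obtains F where "\<And>n. smooth (F n)"
    "\<And>n x. F n x \<noteq> 0 \<Longrightarrow> \<exists>y. dist x y \<le> inverse (real (Suc n)) \<and> f y \<noteq> 0"
    "\<And>n. (\<integral>x. norm (grad (F n) x) powr p \<partial>lborel) \<le> (\<integral>x. norm (G x) powr p \<partial>lborel)"
    "(\<lambda>n. \<integral>x. \<bar>F n x\<bar> powr p \<partial>lborel) \<longlonglongrightarrow> (\<integral>x. \<bar>f x\<bar> powr p \<partial>lborel)"
proof -
  obtain L B where L: "L-lipschitz_on UNIV f" "\<And>x. norm (G x) \<le> L"
    and B: "\<And>x. f x \<noteq> 0 \<or> G x \<noteq> 0 \<Longrightarrow> norm x \<le> B" and Gm: "G \<in> borel_measurable borel"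
    and diff: "AE x in lborel. (f has_derivative (\<lambda>h. G x \<bullet> h)) (at x)"
    using fG unfolding lipgrad_def by blast
  have fB: "\<And>x. f x \<noteq> 0 \<Longrightarrow> norm x \<le> B" using B by blast
  have L0: "L \<ge> 0" by (rule lipschitz_on_nonneg [OF L(1)])
  define e where "e n = inverse (real (Suc n))" for n
  have e: "e n > 0" "e n \<le> 1" for n by (auto simp: e_def inverse_le_1_iff)
  have "\<exists>\<eta> :: real^'n \<Rightarrow> real. smooth_prod \<eta> \<and> (\<forall>x. 0 \<le> \<eta> x) \<and> (\<forall>x. \<eta> x \<noteq> 0 \<longrightarrow> norm x \<le> e n)
    \<and> integrable lborel \<eta> \<and> (\<integral>x. \<eta> x \<partial>lborel) = 1" for n
    using ex_mollifier [OF e(1) [of n]] by metis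
  then obtain \<eta> :: "nat \<Rightarrow> real^'n \<Rightarrow> real" where \<eta>: "\<And>n. smooth_prod (\<eta> n)" "\<And>n x. 0 \<le> \<eta> n x"
    "\<And>n x. \<eta> n x \<noteq> 0 \<Longrightarrow> norm x \<le> e n" "\<And>n. integrable lborel (\<eta> n)" "\<And>n. (\<integral>x. \<eta> n x \<partial>lborel) = 1"
    by metis
  define F where "F n = moll f (\<eta> n)" for n
  obtain M where M: "\<And>x. \<bar>f x\<bar> \<le> M" using lipschitz_support_bounded [OF L(1) fB] by blast
  have close: "\<bar>F n x - f x\<bar> \<le> L * e n" for n x
    unfolding F_def by (rule moll_close [OF L(1) fB \<eta>])
  have supp: "\<exists>y. dist x y \<le> e n \<and> f y \<noteq> 0" if "F n x \<noteq> 0" for n x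
  proof -
    have "moll f (\<eta> n) x \<noteq> 0" using that by (simp add: F_def)
    from moll_supp [OF L(1) fB \<eta> this] show ?thesis .
  qed
  have sm: "smooth (F n)" for n
    unfolding F_def by (rule smooth_moll [OF L(1) fB \<eta>])
  have Fm: "F n \<in> borel_measurable borel" for n
    using sm [of n] unfolding smooth_def
    by (intro borel_measurable_continuous_onI) (metis iter_partial.simps(1))
  have [measurable]: "F n \<in> borel_measurable borel" "f \<in> borel_measurable borel" for n
    using Fm lipschitz_borel [OF L(1)] by auto
  have lim: "(\<lambda>n. \<integral>x. \<bar>F n x\<bar> powr p \<partial>lborel) \<longlonglongrightarrow> (\<integral>x. \<bar>f x\<bar> powr p \<partial>lborel)"
  proof (rule integral_dominated_convergence)
    show "integrable lborel (\<lambda>x::real^'n. (M + L) powr p * indicator (cball 0 (B + 1)) x)"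
      by (intro integrable_mult_right integrable_real_indicator emeasure_bounded_finite) auto
    show "AE x in lborel. norm (\<bar>F n x\<bar> powr p) \<le> (M + L) powr p * indicator (cball 0 (B + 1)) x" for n
    proof (rule AE_I2)
      fix x
      show "norm (\<bar>F n x\<bar> powr p) \<le> (M + L) powr p * indicator (cball 0 (B + 1)) x"
      proof (cases "F n x = 0")
        case False
        then obtain y where y: "dist x y \<le> e n" "f y \<noteq> 0" using supp by blast
        have "norm x \<le> norm y + dist x y" using norm_triangle_sub [of x y] by (simp add: dist_norm)
        then have "x \<in> cball 0 (B + 1)" using y fB [OF y(2)] e(2) [of n] by simp
        moreover have "L * e n \<le> L * 1" using e L0 by (intro mult_left_mono)
        then have "\<bar>F n x\<bar> \<le> M + L" using close [of n x] M [of x] by linarith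
        ultimately show ?thesis using p by (simp add: powr_mono2)
      qed (use p in simp)
    qed
    show "AE x in lborel. (\<lambda>n. \<bar>F n x\<bar> powr p) \<longlonglongrightarrow> \<bar>f x\<bar> powr p"
    proof (rule AE_I2)
      fix x
      have "e \<longlonglongrightarrow> 0" unfolding e_def using LIMSEQ_inverse_real_of_nat by simp
      then have "(\<lambda>n. L * e n) \<longlonglongrightarrow> 0" by (rule tendsto_mult_right_zero)
      then have "(\<lambda>n. F n x - f x) \<longlonglongrightarrow> 0"
        by (rule Lim_null_comparison [rotated]) (use close in \<open>auto intro!: always_eventually\<close>)
      then have "(\<lambda>n. F n x) \<longlonglongrightarrow> f x" by (simp add: LIM_zero_iff)
      then show "(\<lambda>n. \<bar>F n x\<bar> powr p) \<longlonglongrightarrow> \<bar>f x\<bar> powr p"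
        using p by (intro tendsto_powr' tendsto_rabs tendsto_const) auto
    qed
  qed measurable
  show ?thesis
  proof (rule that [OF sm _ _ lim])
    show "\<exists>y. dist x y \<le> inverse (real (Suc n)) \<and> f y \<noteq> 0" if "F n x \<noteq> 0" for n x
      using supp [OF that] by (simp add: e_def)
    show "(\<integral>x. norm (grad (F n) x) powr p \<partial>lborel) \<le> (\<integral>x. norm (G x) powr p \<partial>lborel)" for n
      unfolding F_def by (rule moll_energy_le(2) [OF L(1) fB \<eta> L(2) Gm diff p lipgrad_integrable(1) [OF p fG]])
  qed
qed

section \<open>Weak gradients of test functions\<close>

text \<open>The definitions of the Sobolev objects integrate over \<open>lebesgue_on\<close> of the
  domain, the calculus above over \<open>lborel\<close>; for Borel functions vanishing outside the
  domain the two agree.\<close>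

lemma
  fixes F :: "'a::euclidean_space \<Rightarrow> real"
  assumes \<Omega>: "open \<Omega>" and F: "F \<in> borel_measurable borel" and 0: "\<And>x. x \<notin> \<Omega> \<Longrightarrow> F x = 0"
  shows integral_lebesgue_on_eq: "(\<integral>x. F x \<partial>lebesgue_on \<Omega>) = (\<integral>x. F x \<partial>lborel)"
    and integrable_lebesgue_on_iff: "integrable (lebesgue_on \<Omega>) F \<longleftrightarrow> integrable lborel F"
proof -
  have ind: "(\<lambda>x. indicator \<Omega> x * F x) = F" using 0 by (auto simp: indicator_def fun_eq_iff)
  have S: "\<Omega> \<inter> space lebesgue \<in> sets lebesgue" using \<Omega> by auto
  show "(\<integral>x. F x \<partial>lebesgue_on \<Omega>) = (\<integral>x. F x \<partial>lborel)"
    using integral_restrict_space [OF S, of F] integral_completion [of F lborel] F by (simp add: ind)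
  show "integrable (lebesgue_on \<Omega>) F \<longleftrightarrow> integrable lborel F"
    using integrable_restrict_space [OF S, of F] integrable_completion [of F lborel] F by (simp add: ind)
qed

lemma borel_measurable_lebesgue_onI:
  "F \<in> borel_measurable borel \<Longrightarrow> F \<in> borel_measurable (lebesgue_on \<Omega>)"
  by (intro measurable_restrict_space1 measurable_completion) simp

lemma smooth_continuous: "smooth f \<Longrightarrow> continuous_on UNIV f"
  unfolding smooth_def by (metis iter_partial.simps(1))

lemma smooth_partial_continuous: "smooth f \<Longrightarrow> continuous_on UNIV (partial_d i f)"
  unfolding smooth_def by (metis iter_partial.simps)

lemma smooth_borel: "smooth f \<Longrightarrow> f \<in> borel_measurable borel"
  by (intro borel_measurable_continuous_onI smooth_continuous)

lemma smooth_partial_borel: "smooth f \<Longrightarrow> partial_d i f \<in> borel_measurable borel"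
  by (intro borel_measurable_continuous_onI smooth_partial_continuous)

lemma differentiable_axis_partial:
  fixes f :: "real^'n::finite \<Rightarrow> real"
  assumes "\<And>x. (\<lambda>t. f (x + t *\<^sub>R axis i 1)) differentiable (at 0)"
  shows "((\<lambda>t. f (x + t *\<^sub>R axis i 1)) has_real_derivative partial_d i f (x + t *\<^sub>R axis i 1)) (at t)"
proof -
  have "((\<lambda>s. f (x + t *\<^sub>R axis i 1 + s *\<^sub>R axis i 1)) has_real_derivative partial_d i f (x + t *\<^sub>R axis i 1)) (at 0)"
    unfolding partial_d_def
    using assms [of "x + t *\<^sub>R axis i 1"] by (simp add: DERIV_deriv_iff_real_differentiable)
  then have "((\<lambda>s. f (x + (s + t) *\<^sub>R axis i 1)) has_real_derivative partial_d i f (x + t *\<^sub>R axis i 1)) (at 0)"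
    by (simp add: algebra_simps)
  then show ?thesis
    using DERIV_shift [of "\<lambda>s. f (x + s *\<^sub>R axis i 1)" _ 0 t] by simp
qed

lemma smooth_partial_deriv:
  "smooth f \<Longrightarrow> ((\<lambda>t. f (x + t *\<^sub>R axis i 1)) has_real_derivative partial_d i f (x + t *\<^sub>R axis i 1)) (at t)"
  by (rule differentiable_axis_partial) (metis iter_partial.simps(1) smooth_def)

lemma test_fun_smooth: "\<phi> \<in> test_fun \<Omega> \<Longrightarrow> smooth \<phi>"
  by (simp add: test_fun_def)

lemma partial_d_outside_support:
  fixes f :: "real^'n::finite \<Rightarrow> real"
  assumes "x \<notin> closure {x. f x \<noteq> 0}" shows "partial_d i f x = 0"
proof -
  let ?S = "(\<lambda>t. x + t *\<^sub>R axis i 1) -` (- closure {x. f x \<noteq> 0})"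
  have op: "open ?S"
    by (intro open_vimage open_Compl closed_closure continuous_intros)
  have "((\<lambda>t. f (x + t *\<^sub>R axis i 1)) has_real_derivative 0) (at 0)"
  proof (rule has_field_derivative_transform_within_open [OF DERIV_const [of 0] op])
    show "0 \<in> ?S" using assms by simp
    fix t assume "t \<in> ?S"
    then show "0 = f (x + t *\<^sub>R axis i 1)"
      using closure_subset [of "{x. f x \<noteq> 0}"] by auto
  qed
  then show ?thesis unfolding partial_d_def by (rule DERIV_imp_deriv)
qed

lemma grad_outside_support:
  "x \<notin> closure {x. f x \<noteq> 0} \<Longrightarrow> grad f x = 0"
  by (simp add: grad_def vec_eq_iff partial_d_outside_support)

lemma test_fun_bounds:
  fixes \<phi> :: "real^'n::finite \<Rightarrow> real"
  assumes "\<phi> \<in> test_fun \<Omega>"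
  obtains B M where "\<And>x. \<phi> x \<noteq> 0 \<Longrightarrow> norm x \<le> B" "\<And>x i. partial_d i \<phi> x \<noteq> 0 \<Longrightarrow> norm x \<le> B"
    "\<And>x. \<bar>\<phi> x\<bar> \<le> M" "\<And>x i. \<bar>partial_d i \<phi> x\<bar> \<le> M"
proof -
  let ?K = "closure {x. \<phi> x \<noteq> 0}"
  have K: "compact ?K" and sm: "smooth \<phi>" using assms by (auto simp: test_fun_def)
  obtain B where B: "\<forall>x\<in>?K. norm x \<le> B" using compact_imp_bounded [OF K] by (auto simp: bounded_iff)
  have bnd: "\<exists>M\<ge>0. \<forall>x. \<bar>g x\<bar> \<le> M" if g: "continuous_on UNIV g" "\<And>x. x \<notin> ?K \<Longrightarrow> g x = 0" for g :: "real^'n \<Rightarrow> real"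
  proof -
    have "compact (g ` ?K)"
      by (intro compact_continuous_image continuous_on_subset [OF g(1)] K) auto
    then obtain M where M: "\<forall>x\<in>?K. \<bar>g x\<bar> \<le> M" by (auto simp: bounded_iff dest!: compact_imp_bounded)
    have "\<bar>g x\<bar> \<le> max M 0" for x using M g(2) [of x] by (cases "x \<in> ?K") force+
    then show ?thesis by (intro exI [of _ "max M 0"]) auto
  qed
  have z: "\<phi> x = 0" if "x \<notin> ?K" for x using that closure_subset [of "{x. \<phi> x \<noteq> 0}"] by auto
  obtain M0 where M0: "M0 \<ge> 0" "\<forall>x. \<bar>\<phi> x\<bar> \<le> M0" using bnd [OF smooth_continuous [OF sm] z] by blast
  have "\<forall>i. \<exists>M\<ge>0. \<forall>x. \<bar>partial_d i \<phi> x\<bar> \<le> M"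
    by (intro allI bnd smooth_partial_continuous sm partial_d_outside_support)
  then obtain M1 where M1: "\<And>i. M1 i \<ge> 0" "\<And>i x. \<bar>partial_d i \<phi> x\<bar> \<le> M1 i" by metis
  have le: "M1 i \<le> (\<Sum>i\<in>UNIV. M1 i)" for i
    by (rule member_le_sum) (use M1(1) in auto)
  show ?thesis
  proof (rule that [of B "M0 + (\<Sum>i\<in>UNIV. M1 i)"])
    show "\<phi> x \<noteq> 0 \<Longrightarrow> norm x \<le> B" for x using z B by blast
    show "partial_d i \<phi> x \<noteq> 0 \<Longrightarrow> norm x \<le> B" for x i using partial_d_outside_support B by blast
    have "0 \<le> (\<Sum>i\<in>UNIV. M1 i)" by (intro sum_nonneg M1)
    then show "\<bar>\<phi> x\<bar> \<le> M0 + (\<Sum>i\<in>UNIV. M1 i)" for x using M0(2) [rule_format, of x] by linarith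
    show "\<bar>partial_d i \<phi> x\<bar> \<le> M0 + (\<Sum>i\<in>UNIV. M1 i)" for x i
      using M1(2) [of i x] le [of i] M0(1) by linarith
  qed
qed

lemma test_fun_outside: "\<phi> \<in> test_fun \<Omega> \<Longrightarrow> x \<notin> \<Omega> \<Longrightarrow> \<phi> x = 0 \<and> partial_d i \<phi> x = 0 \<and> grad \<phi> x = 0"
  using closure_subset [of "{x. \<phi> x \<noteq> 0}"] partial_d_outside_support [of x \<phi> i] grad_outside_support [of x \<phi>]
  by (auto simp: test_fun_def)

text \<open>Difference quotients of a compactly supported function integrate to \<open>0\<close> by translation invariance.\<close>

lemma integral_partial_eq_0:
  fixes f g :: "real^'n::finite \<Rightarrow> real"
  assumes fc: "f \<in> borel_measurable borel" and gm: "g \<in> borel_measurable borel"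
    and d: "\<And>x t. ((\<lambda>t. f (x + t *\<^sub>R axis i 1)) has_real_derivative g (x + t *\<^sub>R axis i 1)) (at t)"
    and fB: "\<And>x. f x \<noteq> 0 \<Longrightarrow> norm x \<le> B" and fM: "\<And>x. \<bar>f x\<bar> \<le> M'" and gM: "\<And>x. \<bar>g x\<bar> \<le> M"
  shows "(\<integral>x. g x \<partial>lborel) = 0"
proof -
  have [measurable]: "f \<in> borel_measurable borel" "g \<in> borel_measurable borel" by (fact fc gm)+
  define t where "t n = inverse (real (Suc n))" for n
  have tpos: "t n > 0" "t n \<le> 1" for n by (auto simp: t_def inverse_le_1_iff)
  have t0: "t \<longlonglongrightarrow> 0" unfolding t_def using LIMSEQ_inverse_real_of_nat by simp
  then have ft: "filterlim t (at 0) sequentially"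
    using tpos(1) by (auto simp: filterlim_at intro!: always_eventually) (metis less_irrefl)
  have fi: "integrable lborel f" by (rule integrable_bounded_support [OF fc fM fB])
  have M0: "M \<ge> 0" using gM [of 0] by linarith
  have tr: "integrable lborel (\<lambda>x. f (x + c)) \<and> (\<integral>x. f (x + c) \<partial>lborel) = (\<integral>x. f x \<partial>lborel)" for c
  proof -
    have "(\<integral>x. f x \<partial>distr lborel borel ((+) c)) = (\<integral>x. f (c + x) \<partial>lborel)"
      by (rule integral_distr) auto
    moreover have "integrable (distr lborel borel ((+) c)) f \<longleftrightarrow> integrable lborel (\<lambda>x. f (c + x))"
      by (rule integrable_distr_eq) auto
    ultimately show ?thesis using fi by (simp add: lborel_distr_plus add.commute)
  qed
  have "(\<lambda>n. \<integral>x. (f (x + t n *\<^sub>R axis i 1) - f x) / t n \<partial>lborel) \<longlonglongrightarrow> (\<integral>x. g x \<partial>lborel)"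
  proof (rule integral_dominated_convergence)
    show "g \<in> borel_measurable lborel" by simp
    show "(\<lambda>x. (f (x + t n *\<^sub>R axis i 1) - f x) / t n) \<in> borel_measurable lborel" for n by measurable
    \<comment> \<open>Steps are at most 1, so all difference quotients vanish outside the ball of
      radius B + 1, where the mean value theorem bounds them by M.\<close>
    show "integrable lborel (\<lambda>x::real^'n. M * indicator (cball 0 (B + 1)) x)"
      by (intro integrable_mult_right integrable_real_indicator emeasure_bounded_finite) auto
    show "AE x in lborel. (\<lambda>n. (f (x + t n *\<^sub>R axis i 1) - f x) / t n) \<longlonglongrightarrow> g x"
    proof (rule AE_I2)
      fix x
      have "((\<lambda>t. f (x + t *\<^sub>R axis i 1)) has_real_derivative g x) (at 0)"
        using d [of x 0] by simp
      then have "((\<lambda>h. (f (x + h *\<^sub>R axis i 1) - f x) / h) \<longlongrightarrow> g x) (at 0)"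
        by (simp add: DERIV_def)
      from filterlim_compose [OF this ft]
      show "(\<lambda>n. (f (x + t n *\<^sub>R axis i 1) - f x) / t n) \<longlonglongrightarrow> g x" .
    qed
    show "AE x in lborel. norm ((f (x + t n *\<^sub>R axis i 1) - f x) / t n) \<le> M * indicator (cball 0 (B + 1)) x" for n
    proof (rule AE_I2)
      fix x
      show "norm ((f (x + t n *\<^sub>R axis i 1) - f x) / t n) \<le> M * indicator (cball 0 (B + 1)) x"
      proof (cases "norm x \<le> B + 1")
        case True
        have "\<exists>z. 0 < z \<and> z < t n \<and> f (x + t n *\<^sub>R axis i 1) - f (x + 0 *\<^sub>R axis i 1) = (t n - 0) * g (x + z *\<^sub>R axis i 1)"
          using MVT2 [of 0 "t n" "\<lambda>t. f (x + t *\<^sub>R axis i 1)" "\<lambda>t. g (x + t *\<^sub>R axis i 1)"] tpos(1) d by blast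
        then obtain z where "f (x + t n *\<^sub>R axis i 1) - f x = t n * g (x + z *\<^sub>R axis i 1)" by auto
        then show ?thesis using tpos(1) [of n] gM True by (simp add: abs_mult)
      next
        case False
        have "norm x \<le> norm (x + t n *\<^sub>R axis i 1) + norm (t n *\<^sub>R axis i (1::real))"
          using norm_triangle_ineq4 [of "x + t n *\<^sub>R axis i 1" "t n *\<^sub>R axis i 1"] by simp
        then have "f (x + t n *\<^sub>R axis i 1) = 0" "f x = 0"
          using False tpos [of n] fB [of x] fB [of "x + t n *\<^sub>R axis i 1"] by auto
        then show ?thesis using M0 by simp
      qed
    qed
  qed
  moreover have "(\<integral>x. (f (x + t n *\<^sub>R axis i 1) - f x) / t n \<partial>lborel) = 0" for n
    using tr [of "t n *\<^sub>R axis i 1"] fi by simp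
  ultimately have "(\<lambda>n. 0) \<longlonglongrightarrow> (\<integral>x. g x \<partial>lborel)" by (simp only:)
  then show ?thesis by (simp add: LIMSEQ_const_iff)
qed

text \<open>Integration by parts: the partial derivative of the product of the two test functions
  has integral 0.\<close>

lemma test_fun_weak_grad:
  fixes \<phi> :: "real^'n::finite \<Rightarrow> real"
  assumes \<Omega>: "open \<Omega>" and phi: "\<phi> \<in> test_fun \<Omega>"
  shows "weak_grad \<Omega> \<phi> (grad \<phi>)"
  unfolding weak_grad_def
proof (intro ballI allI)
  fix \<psi> i assume psi: "\<psi> \<in> test_fun \<Omega>"
  note s1 = test_fun_smooth [OF phi] and s2 = test_fun_smooth [OF psi]
  have [measurable]: "\<phi> \<in> borel_measurable borel" "\<psi> \<in> borel_measurable borel"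
    "partial_d i \<phi> \<in> borel_measurable borel" "partial_d i \<psi> \<in> borel_measurable borel"
    using smooth_borel smooth_partial_borel s1 s2 by auto
  obtain B M where b1: "\<And>x. \<phi> x \<noteq> 0 \<Longrightarrow> norm x \<le> B" "\<And>x i. partial_d i \<phi> x \<noteq> 0 \<Longrightarrow> norm x \<le> B"
    "\<And>x. \<bar>\<phi> x\<bar> \<le> M" "\<And>x i. \<bar>partial_d i \<phi> x\<bar> \<le> M"
    by (rule test_fun_bounds [OF phi]) (rule that)
  obtain B' M' where b2: "\<And>x. \<psi> x \<noteq> 0 \<Longrightarrow> norm x \<le> B'" "\<And>x i. partial_d i \<psi> x \<noteq> 0 \<Longrightarrow> norm x \<le> B'"
    "\<And>x. \<bar>\<psi> x\<bar> \<le> M'" "\<And>x i. \<bar>partial_d i \<psi> x\<bar> \<le> M'"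
    by (rule test_fun_bounds [OF psi]) (rule that)
  have M: "M \<ge> 0" using b1(3) [of 0] by linarith
  have i1: "integrable lborel (\<lambda>x. \<phi> x * partial_d i \<psi> x)"
    by (rule integrable_bounded_support [where M = "M * M'" and B = B])
      (use b1 b2 M in \<open>auto simp: abs_mult intro!: mult_mono\<close>)
  have i2: "integrable lborel (\<lambda>x. partial_d i \<phi> x * \<psi> x)"
    by (rule integrable_bounded_support [where M = "M * M'" and B = B])
      (use b1 b2 M in \<open>auto simp: abs_mult intro!: mult_mono\<close>)
  have "(\<integral>x. \<phi> x * partial_d i \<psi> x + partial_d i \<phi> x * \<psi> x \<partial>lborel) = 0"
  proof (rule integral_partial_eq_0 [where f = "\<lambda>x. \<phi> x * \<psi> x" and i = i and B = B and M = "M * M' + M * M'" and M' = "M * M'"])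
    show "((\<lambda>t. \<phi> (x + t *\<^sub>R axis i 1) * \<psi> (x + t *\<^sub>R axis i 1)) has_real_derivative
        \<phi> (x + t *\<^sub>R axis i 1) * partial_d i \<psi> (x + t *\<^sub>R axis i 1) + partial_d i \<phi> (x + t *\<^sub>R axis i 1) * \<psi> (x + t *\<^sub>R axis i 1)) (at t)"
      for x t
      using DERIV_mult [OF smooth_partial_deriv [OF s1, of x i t] smooth_partial_deriv [OF s2, of x i t]]
      by (simp add: algebra_simps)
    show "\<bar>\<phi> x * \<psi> x\<bar> \<le> M * M'" for x
      unfolding abs_mult using b1 b2 M by (intro mult_mono) auto
    have "\<bar>\<phi> x * partial_d i \<psi> x\<bar> \<le> M * M'" "\<bar>partial_d i \<phi> x * \<psi> x\<bar> \<le> M * M'" for x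
      unfolding abs_mult using b1 b2 M by (intro mult_mono; auto)+
    then show "\<bar>\<phi> x * partial_d i \<psi> x + partial_d i \<phi> x * \<psi> x\<bar> \<le> M * M' + M * M'" for x
      by (intro order_trans [OF abs_triangle_ineq] add_mono)
  qed (use b1 in auto)
  then have "(\<integral>x. \<phi> x * partial_d i \<psi> x \<partial>lborel) = - (\<integral>x. partial_d i \<phi> x * \<psi> x \<partial>lborel)"
    using i1 i2 by simp
  moreover have "(\<integral>x. \<phi> x * partial_d i \<psi> x \<partial>lebesgue_on \<Omega>) = (\<integral>x. \<phi> x * partial_d i \<psi> x \<partial>lborel)"
    by (rule integral_lebesgue_on_eq [OF \<Omega>]) (use test_fun_outside [OF phi] in auto)
  moreover have "(\<integral>x. grad \<phi> x $ i * \<psi> x \<partial>lebesgue_on \<Omega>) = (\<integral>x. partial_d i \<phi> x * \<psi> x \<partial>lborel)"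
    unfolding grad_def vec_lambda_beta
    by (rule integral_lebesgue_on_eq [OF \<Omega>]) (use test_fun_outside [OF psi] in auto)
  ultimately show "(LINT x|lebesgue_on \<Omega>. \<phi> x * partial_d i \<psi> x) = - (LINT x|lebesgue_on \<Omega>. grad \<phi> x $ i * \<psi> x)"
    by simp
qed

lemma test_fun_Lp:
  fixes \<phi> :: "real^'n::finite \<Rightarrow> real"
  assumes \<Omega>: "open \<Omega>" and phi: "\<phi> \<in> test_fun \<Omega>" and p: "p > 1"
  shows "Lp_fun \<Omega> p \<phi>" "Lp_vec \<Omega> p (grad \<phi>)"
    "integrable lborel (\<lambda>x. \<bar>\<phi> x\<bar> powr p)" "integrable lborel (\<lambda>x. norm (grad \<phi> x) powr p)"
proof -
  note s = test_fun_smooth [OF phi]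
  have [measurable]: "\<phi> \<in> borel_measurable borel" "grad \<phi> \<in> borel_measurable borel"
    using smooth_borel smooth_grad_borel s by auto
  obtain B M where b1: "\<And>x. \<phi> x \<noteq> 0 \<Longrightarrow> norm x \<le> B" "\<And>x i. partial_d i \<phi> x \<noteq> 0 \<Longrightarrow> norm x \<le> B"
    "\<And>x. \<bar>\<phi> x\<bar> \<le> M" "\<And>x i. \<bar>partial_d i \<phi> x\<bar> \<le> M"
    by (rule test_fun_bounds [OF phi]) (rule that)
  have gB: "norm x \<le> B" if "grad \<phi> x \<noteq> 0" for x
    using that b1(2) by (auto simp: grad_def vec_eq_iff)
  have gM: "norm (grad \<phi> x) \<le> real CARD('n) * M" for x
  proof -
    have "norm (grad \<phi> x) \<le> (\<Sum>i\<in>UNIV. \<bar>grad \<phi> x $ i\<bar>)" by (rule norm_le_l1_cart)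
    also have "\<dots> \<le> (\<Sum>i\<in>(UNIV::'n set). M)" by (intro sum_mono) (simp add: grad_def b1)
    finally show ?thesis by simp
  qed
  show i1: "integrable lborel (\<lambda>x. \<bar>\<phi> x\<bar> powr p)"
    by (rule integrable_bounded_support [where M = "M powr p" and B = B])
      (use b1 p in \<open>auto intro!: powr_mono2\<close>)
  show i2: "integrable lborel (\<lambda>x. norm (grad \<phi> x) powr p)"
    by (rule integrable_bounded_support [where M = "(real CARD('n) * M) powr p" and B = B])
      (use gB gM p in \<open>auto intro!: powr_mono2\<close>)
  have "integrable (lebesgue_on \<Omega>) (\<lambda>x. \<bar>\<phi> x\<bar> powr p)"
    by (subst integrable_lebesgue_on_iff [OF \<Omega>]) (use i1 test_fun_outside [OF phi] in auto)
  then show "Lp_fun \<Omega> p \<phi>"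
    by (simp add: Lp_fun_def borel_measurable_lebesgue_onI)
  have "integrable (lebesgue_on \<Omega>) (\<lambda>x. norm (grad \<phi> x) powr p)"
    by (subst integrable_lebesgue_on_iff [OF \<Omega>]) (use i2 test_fun_outside [OF phi] in auto)
  then show "Lp_vec \<Omega> p (grad \<phi>)"
    by (simp add: Lp_vec_def borel_measurable_lebesgue_onI)
qed

section \<open>Almost everywhere uniqueness of weak gradients\<close>

text \<open>Mollified cut-offs approximate the indicator of \<open>C\<close> boundedly and pointwise.\<close>

lemma ex_test_fun_approx_indicator:
  fixes C :: "(real^'n::finite) set"
  assumes \<Omega>: "open \<Omega>" and C: "compact C" "C \<subseteq> \<Omega>" "C \<noteq> {}"
  obtains \<psi> K where "compact K" "K \<subseteq> \<Omega>" "\<And>n. \<psi> n \<in> test_fun \<Omega>" "\<And>n x. x \<notin> K \<Longrightarrow> \<psi> n x = 0"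
    "\<And>n x. \<bar>\<psi> n x\<bar> \<le> 2" "\<And>x. (\<lambda>n. \<psi> n x) \<longlonglongrightarrow> indicator C x"
proof -
  obtain \<delta> where d: "\<delta> > 0" "{x. infdist x C \<le> \<delta>} \<subseteq> \<Omega>"
    using compact_in_open_separated [OF C(3,1) \<Omega> C(2)] by metis
  define K where "K = {x. infdist x C \<le> \<delta>}"
  have Kc: "compact K" unfolding K_def by (rule compact_infdist_le [OF C(3,1) d(1)])
  obtain B where B: "\<forall>x\<in>K. norm x \<le> B" using compact_imp_bounded [OF Kc] by (auto simp: bounded_iff)
  \<comment> \<open>Starting the index at n0 ensures 2 / m n \<le> \<delta> for all n, so every
    cut-off, mollification included, stays inside the compact set K.\<close>
  obtain n0 :: nat where n0: "2 / \<delta> < real n0" using reals_Archimedean2 by blast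
  define m where "m n = real (n + n0 + 1)" for n
  have m: "m n > 0" "m n \<ge> 1" "2 / m n \<le> \<delta>" for n
  proof -
    show "m n > 0" "m n \<ge> 1" by (auto simp: m_def)
    have "2 < real n0 * \<delta>" using n0 d(1) by (simp add: divide_less_eq)
    also have "\<dots> \<le> m n * \<delta>" using d(1) by (intro mult_right_mono) (auto simp: m_def)
    finally show "2 / m n \<le> \<delta>" using \<open>m n > 0\<close> by (simp add: divide_le_eq mult.commute)
  qed
  define f where "f n x = max 0 (1 - m n * infdist x C)" for n x
  have f01: "0 \<le> f n x" "f n x \<le> 1" for n x
    using m(1) [of n] infdist_nonneg [of x C] by (auto simp: f_def)
  have flip: "(m n)-lipschitz_on UNIV (f n)" for n
  proof (rule lipschitz_onI)
    fix x y
    have "\<bar>infdist x C - infdist y C\<bar> \<le> dist x y"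
      using infdist_triangle_abs [of x C y] by simp
    then have "m n * \<bar>infdist x C - infdist y C\<bar> \<le> m n * dist x y"
      using m(1) [of n] by simp
    moreover have "\<bar>f n x - f n y\<bar> \<le> \<bar>m n * infdist x C - m n * infdist y C\<bar>"
      unfolding f_def by (simp add: max_def abs_if)
    moreover have "\<bar>m n * infdist x C - m n * infdist y C\<bar> = m n * \<bar>infdist x C - infdist y C\<bar>"
      using m(1) [of n] by (simp add: abs_mult flip: right_diff_distrib)
    ultimately show "dist (f n x) (f n y) \<le> m n * dist x y" by (simp add: dist_real_def)
  qed (use m(1) [of n] in simp)
  have fsupp: "infdist x C \<le> 1 / m n" if "f n x \<noteq> 0" for n x
    using that m(1) [of n] by (auto simp: f_def max_def field_simps split: if_splits)
  have invm: "1 / m n \<le> \<delta>" for n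
    using m(3) [of n] m(1) [of n] by (simp add: field_simps)
  have fB: "norm x \<le> B" if "f n x \<noteq> 0" for n x
    using fsupp [OF that] invm [of n] B by (auto simp: K_def)
  \<comment> \<open>The cut-off has Lipschitz constant m n, so mollifying at radius 1 / (m n)^2
    changes it by at most 1 / m n, which tends to 0 and never exceeds 1; hence the bound 2.\<close>
  define e where "e n = 1 / (m n * m n)" for n
  have e: "e n > 0" "e n \<le> 1 / m n" "m n * e n = 1 / m n" for n
    using m(1,2) [of n] by (auto simp: e_def field_simps)
  have "\<exists>\<eta> :: real^'n \<Rightarrow> real. smooth_prod \<eta> \<and> (\<forall>x. 0 \<le> \<eta> x) \<and> (\<forall>x. \<eta> x \<noteq> 0 \<longrightarrow> norm x \<le> e n)
    \<and> integrable lborel \<eta> \<and> (\<integral>x. \<eta> x \<partial>lborel) = 1" for n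
    using ex_mollifier [OF e(1) [of n]] by metis
  then obtain \<eta> :: "nat \<Rightarrow> real^'n \<Rightarrow> real" where \<eta>: "\<And>n. smooth_prod (\<eta> n)" "\<And>n x. 0 \<le> \<eta> n x"
    "\<And>n x. \<eta> n x \<noteq> 0 \<Longrightarrow> norm x \<le> e n" "\<And>n. integrable lborel (\<eta> n)" "\<And>n. (\<integral>x. \<eta> n x \<partial>lborel) = 1"
    by metis
  define \<psi> where "\<psi> n = moll (f n) (\<eta> n)" for n
  have close: "\<bar>\<psi> n x - f n x\<bar> \<le> 1 / m n" for n x
    unfolding \<psi>_def e(3) [symmetric] by (rule moll_close [OF flip fB \<eta>])
  have supp: "x \<in> K" if "\<psi> n x \<noteq> 0" for n x
  proof -
    have "moll (f n) (\<eta> n) x \<noteq> 0" using that by (simp add: \<psi>_def)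
    from moll_supp [OF flip fB [of n] \<eta>(1,2) \<eta>(3) [of n] \<eta>(4,5) this]
    obtain y where y: "dist x y \<le> e n" "f n y \<noteq> 0" by blast
    have "infdist x C \<le> infdist y C + dist x y" by (rule infdist_triangle)
    also have "\<dots> \<le> 1 / m n + 1 / m n" using fsupp [OF y(2)] y(1) e(2) [of n] by linarith
    also have "\<dots> \<le> \<delta>" using m(3) [of n] by simp
    finally show ?thesis by (simp add: K_def)
  qed
  show ?thesis
  proof (rule that [OF Kc])
    show "K \<subseteq> \<Omega>" using d(2) by (simp add: K_def)
    show "\<psi> n \<in> test_fun \<Omega>" for n
    proof -
      have "{x. \<psi> n x \<noteq> 0} \<subseteq> K" using supp by blast
      then have cl: "closure {x. \<psi> n x \<noteq> 0} \<subseteq> K"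
        by (rule closure_minimal) (use Kc compact_imp_closed in blast)
      have "compact (closure {x. \<psi> n x \<noteq> 0})"
        using cl Kc by (metis closed_closure compact_Int_closed inf.absorb_iff2)
      moreover have "smooth (\<psi> n)"
        unfolding \<psi>_def by (rule smooth_moll [OF flip fB \<eta>])
      ultimately show ?thesis using cl d(2) by (auto simp: test_fun_def K_def)
    qed
    show "\<psi> n x = 0" if "x \<notin> K" for n x using supp that by blast
    show "\<bar>\<psi> n x\<bar> \<le> 2" for n x
    proof -
      have "1 / m n \<le> 1" using m(1,2) [of n] by simp
      then show ?thesis using close [of n x] f01 [of n x] by linarith
    qed
    show "(\<lambda>n. \<psi> n x) \<longlonglongrightarrow> indicator C x" for x
    proof -
      have minf: "filterlim m at_top sequentially"
        unfolding m_def by (intro filterlim_compose [OF filterlim_real_sequentially] filterlim_subseq) (auto simp: strict_mono_def)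
      have m1: "(\<lambda>n. 1 / m n) \<longlonglongrightarrow> 0"
        using tendsto_inverse_0_at_top [OF minf] by (simp add: inverse_eq_divide)
      have "(\<lambda>n. \<psi> n x - f n x) \<longlonglongrightarrow> 0"
        by (rule Lim_null_comparison [OF _ m1]) (use close in \<open>auto intro!: always_eventually\<close>)
      moreover have "(\<lambda>n. f n x) \<longlonglongrightarrow> indicator C x"
      proof (cases "x \<in> C")
        case True
        then show ?thesis by (simp add: f_def)
      next
        case False
        then have pos: "infdist x C > 0"
          using in_closed_iff_infdist_zero [OF compact_imp_closed [OF C(1)] C(3), of x] infdist_nonneg [of x C] by auto
        have "eventually (\<lambda>n. 1 / infdist x C \<le> m n) sequentially"
          using minf by (simp add: filterlim_at_top)
        then have "eventually (\<lambda>n. f n x = 0) sequentially"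
          by eventually_elim (use pos in \<open>simp add: f_def field_simps max_def\<close>)
        then show ?thesis using False by (simp add: tendsto_eventually)
      qed
      ultimately show ?thesis using tendsto_add by fastforce
    qed
  qed
qed

text \<open>On a compact subset of the set S where d is positive, the integral of d is 0, so that
  subset is null. Closed subsets of S are countable unions of such sets, and inner regularity
  carries nullity to S.\<close>

lemma positive_on_null_if_compact_null:
  fixes d :: "real^'n::finite \<Rightarrow> real"
  assumes \<Omega>: "open \<Omega>" and d: "d \<in> borel_measurable (lebesgue_on \<Omega>)"
    and int: "\<And>C. compact C \<Longrightarrow> C \<subseteq> \<Omega> \<Longrightarrow> integrable (lebesgue_on \<Omega>) (\<lambda>x. indicator C x * d x)"
    and 0: "\<And>C. compact C \<Longrightarrow> C \<subseteq> \<Omega> \<Longrightarrow> (\<integral>x. indicator C x * d x \<partial>lebesgue_on \<Omega>) = 0"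
  shows "AE x in lebesgue_on \<Omega>. d x \<le> 0"
proof -
  define S where "S = {x\<in>\<Omega>. d x > 0}"
  have \<Omega>s: "\<Omega> \<in> sets lebesgue" using \<Omega> by auto
  have "{x \<in> space (lebesgue_on \<Omega>). 0 < d x} \<in> sets (lebesgue_on \<Omega>)"
    using d by measurable
  then have Ss: "S \<in> sets lebesgue"
    using \<Omega>s by (simp add: S_def sets_restrict_space_iff)
  have cnull: "C \<in> null_sets lebesgue" if C: "compact C" "C \<subseteq> S" for C
  proof -
    have C\<Omega>: "C \<subseteq> \<Omega>" using C by (auto simp: S_def)
    have "AE x in lebesgue_on \<Omega>. indicator C x * d x = 0"
    proof (subst integral_nonneg_eq_0_iff_AE [symmetric, OF int [OF C(1) C\<Omega>]])
      show "AE x in lebesgue_on \<Omega>. 0 \<le> indicator C x * d x"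
        using C(2) by (intro AE_I2) (auto simp: indicator_def S_def intro: less_imp_le)
    qed (rule 0 [OF C(1) C\<Omega>])
    then have "AE x in lebesgue. x \<in> \<Omega> \<longrightarrow> indicator C x * d x = 0"
      using \<Omega>s by (simp add: AE_restrict_space_iff)
    then have "AE x in lebesgue. x \<notin> C"
      by eventually_elim (use C(2) in \<open>auto simp: S_def\<close>)
    then show ?thesis
      using compact_imp_closed [OF C(1)] by (subst AE_iff_null_sets) auto
  qed
  have clnull: "T \<in> null_sets lebesgue" if T: "closed T" "T \<subseteq> S" for T
  proof -
    have "(\<Union>n::nat. T \<inter> cball 0 (real n)) \<in> null_sets lebesgue"
      by (intro null_sets_UN cnull closed_Int_compact) (use T in auto)
    moreover have "(\<Union>n::nat. T \<inter> cball 0 (real n)) = T"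
      using real_arch_simple by auto
    ultimately show ?thesis by simp
  qed
  have "emeasure lebesgue S = 0"
  proof (rule ccontr)
    assume ne: "emeasure lebesgue S \<noteq> 0"
    \<comment> \<open>S may have infinite measure, so a positive real below its measure is chosen.
      Removing a null closed set cannot bring the measure of S below it.\<close>
    then obtain e where e: "0 < e" "ennreal e < emeasure lebesgue S"
    proof -
      obtain y where y: "0 < y" "y < emeasure lebesgue S"
        using dense [of 0 "emeasure lebesgue S"] ne by (auto simp: zero_less_iff_neq_zero)
      then have "y \<noteq> top" by auto
      then obtain e where "y = ennreal e" "0 \<le> e" by (cases y) auto
      then show ?thesis using that [of e] y by (simp add: ennreal_less_zero_iff)
    qed
    obtain T where T: "closed T" "T \<subseteq> S" "S - T \<in> lmeasurable" "emeasure lebesgue (S - T) < ennreal e"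
      using sets_lebesgue_inner_closed [OF Ss e(1)] by metis
    have "emeasure lebesgue S = emeasure lebesgue (S - T)"
      by (rule emeasure_Diff_null_set [symmetric, OF clnull [OF T(1,2)] Ss])
    then show False using T(4) e(2) by simp
  qed
  then have "S \<in> null_sets lebesgue" using Ss by auto
  then have "AE x in lebesgue. x \<notin> S" using Ss by (simp add: AE_iff_null_sets)
  then have "AE x in lebesgue. x \<in> \<Omega> \<longrightarrow> d x \<le> 0"
    by eventually_elim (auto simp: S_def not_less)
  then show ?thesis using \<Omega>s by (simp add: AE_restrict_space_iff)
qed

text \<open>Bounded approximation of indicators by test functions gives integral 0 over every
  compact set; the preceding lemma is then applied to d and to -d.\<close>

lemma fundamental_lemma_variations:
  fixes d :: "real^'n::finite \<Rightarrow> real"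
  assumes \<Omega>: "open \<Omega>" and d: "d \<in> borel_measurable (lebesgue_on \<Omega>)"
    and int: "\<And>C. compact C \<Longrightarrow> C \<subseteq> \<Omega> \<Longrightarrow> integrable (lebesgue_on \<Omega>) (\<lambda>x. indicator C x * d x)"
    and 0: "\<And>\<phi>. \<phi> \<in> test_fun \<Omega> \<Longrightarrow> (\<integral>x. d x * \<phi> x \<partial>lebesgue_on \<Omega>) = 0"
  shows "AE x in lebesgue_on \<Omega>. d x = 0"
proof -
  have null: "(\<integral>x. indicator C x * d x \<partial>lebesgue_on \<Omega>) = 0" if C: "compact C" "C \<subseteq> \<Omega>" for C
  proof (cases "C = {}")
    case False
    obtain \<psi> K where K: "compact K" "K \<subseteq> \<Omega>" and psi: "\<And>n. \<psi> n \<in> test_fun \<Omega>"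
      and out: "\<And>n x. x \<notin> K \<Longrightarrow> \<psi> n x = 0" and bd: "\<And>n x. \<bar>\<psi> n x\<bar> \<le> 2"
      and lim: "\<And>x. (\<lambda>n. \<psi> n x) \<longlonglongrightarrow> indicator C x"
      by (rule ex_test_fun_approx_indicator [OF \<Omega> C False]) (rule that)
    have pm: "\<psi> n \<in> borel_measurable (lebesgue_on \<Omega>)" for n
      by (intro borel_measurable_lebesgue_onI smooth_borel test_fun_smooth [OF psi])
    have "(\<lambda>n. \<integral>x. d x * \<psi> n x \<partial>lebesgue_on \<Omega>) \<longlonglongrightarrow> (\<integral>x. d x * indicator C x \<partial>lebesgue_on \<Omega>)"
    proof (rule integral_dominated_convergence)
      show "(\<lambda>x. d x * \<psi> n x) \<in> borel_measurable (lebesgue_on \<Omega>)" for n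
        by (intro borel_measurable_times d pm)
      show "(\<lambda>x. d x * indicator C x) \<in> borel_measurable (lebesgue_on \<Omega>)"
        using borel_measurable_integrable [OF int [OF C]] by (simp add: mult.commute)
      show "integrable (lebesgue_on \<Omega>) (\<lambda>x. 2 * \<bar>indicator K x * d x\<bar>)"
        by (intro integrable_mult_right integrable_abs int K)
      show "AE x in lebesgue_on \<Omega>. (\<lambda>n. d x * \<psi> n x) \<longlonglongrightarrow> d x * indicator C x"
        by (intro AE_I2 tendsto_mult tendsto_const lim)
      show "AE x in lebesgue_on \<Omega>. norm (d x * \<psi> n x) \<le> 2 * \<bar>indicator K x * d x\<bar>" for n
      proof (rule AE_I2)
        fix x
        show "norm (d x * \<psi> n x) \<le> 2 * \<bar>indicator K x * d x\<bar>"
          using bd [of n x] out [of x n] mult_left_mono [OF bd [of n x] abs_ge_zero [of "d x"]]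
          by (cases "x \<in> K") (auto simp: abs_mult mult.commute)
      qed
    qed
    then have "(\<integral>x. d x * indicator C x \<partial>lebesgue_on \<Omega>) = 0"
      using 0 [OF psi] by (simp add: LIMSEQ_const_iff)
    then show ?thesis by (simp add: mult.commute)
  qed simp
  have 1: "AE x in lebesgue_on \<Omega>. d x \<le> 0"
    by (rule positive_on_null_if_compact_null [OF \<Omega> d int null])
  have "AE x in lebesgue_on \<Omega>. - d x \<le> 0"
  proof (rule positive_on_null_if_compact_null [OF \<Omega>])
    show "(\<lambda>x. - d x) \<in> borel_measurable (lebesgue_on \<Omega>)" using d by measurable
    show "integrable (lebesgue_on \<Omega>) (\<lambda>x. indicator C x * - d x)" if "compact C" "C \<subseteq> \<Omega>" for C
      using int [OF that] by simp
    show "(\<integral>x. indicator C x * - d x \<partial>lebesgue_on \<Omega>) = 0" if "compact C" "C \<subseteq> \<Omega>" for C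
      using null [OF that] by simp
  qed
  with 1 show ?thesis by eventually_elim simp
qed

lemma powr_ge_linear: "p > 1 \<Longrightarrow> 0 \<le> (s::real) \<Longrightarrow> s \<le> 1 + s powr p"
proof (cases "s \<le> 1")
  case False
  assume "p > 1"
  then have "s powr 1 \<le> s powr p" using False by (intro powr_mono) auto
  then show ?thesis using False by simp
qed (simp add: add_increasing2)

text \<open>From s \<le> 1 + s^p, p-integrability implies integrability on sets of finite measure,
  here on the part of K inside the domain.\<close>

lemma Lp_vec_component_integrable:
  fixes g :: "real^'n::finite \<Rightarrow> real^'n"
  assumes \<Omega>: "open \<Omega>" and p: "p > 1" and g: "Lp_vec \<Omega> p g" and h: "h \<in> borel_measurable (lebesgue_on \<Omega>)"
    and K: "compact K" and hK: "\<And>x. x \<notin> K \<Longrightarrow> h x = 0" and hM: "\<And>x. \<bar>h x\<bar> \<le> M"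
  shows "integrable (lebesgue_on \<Omega>) (\<lambda>x. g x $ i * h x)"
proof (rule Bochner_Integration.integrable_bound)
  have gm: "g \<in> borel_measurable (lebesgue_on \<Omega>)" and ig: "integrable (lebesgue_on \<Omega>) (\<lambda>x. norm (g x) powr p)"
    using g by (auto simp: Lp_vec_def)
  have "emeasure (lebesgue_on \<Omega>) (K \<inter> \<Omega>) \<le> emeasure lborel K"
  proof -
    have "emeasure (lebesgue_on \<Omega>) (K \<inter> \<Omega>) = emeasure lebesgue (K \<inter> \<Omega>)"
      using \<Omega> by (intro emeasure_restrict_space) auto
    also have "\<dots> \<le> emeasure lebesgue K"
      using compact_imp_closed [OF K] by (intro emeasure_mono) auto
    also have "\<dots> = emeasure lborel K"
    proof -
      have "K \<in> sets lborel" using compact_imp_closed [OF K] by simp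
      then show ?thesis by simp
    qed
    finally show ?thesis .
  qed
  also have "\<dots> < \<infinity>" by (rule emeasure_bounded_finite [OF compact_imp_bounded [OF K]])
  finally have fin: "emeasure (lebesgue_on \<Omega>) (K \<inter> \<Omega>) < \<infinity>" .
  have KS: "K \<inter> \<Omega> \<in> sets (lebesgue_on \<Omega>)"
    using compact_imp_closed [OF K] \<Omega> by (subst sets_restrict_space_iff) auto
  show "integrable (lebesgue_on \<Omega>) (\<lambda>x. M * (indicator (K \<inter> \<Omega>) x + norm (g x) powr p))"
    by (intro integrable_mult_right Bochner_Integration.integrable_add integrable_real_indicator KS fin ig)
  show "(\<lambda>x. g x $ i * h x) \<in> borel_measurable (lebesgue_on \<Omega>)"
    by (intro borel_measurable_times measurable_compose [OF gm borel_measurable_nth] h)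
  have M: "M \<ge> 0" using hM [of 0] by linarith
  show "AE x in lebesgue_on \<Omega>. norm (g x $ i * h x) \<le> norm (M * (indicator (K \<inter> \<Omega>) x + norm (g x) powr p))"
  proof (rule AE_I2)
    fix x assume "x \<in> space (lebesgue_on \<Omega>)"
    then have x: "x \<in> \<Omega>" by simp
    show "norm (g x $ i * h x) \<le> norm (M * (indicator (K \<inter> \<Omega>) x + norm (g x) powr p))"
    proof (cases "x \<in> K")
      case True
      have "\<bar>g x $ i\<bar> \<le> 1 + norm (g x) powr p"
        using component_le_norm_cart [of "g x" i] powr_ge_linear [OF p norm_ge_zero [of "g x"]] by linarith
      then have "\<bar>g x $ i\<bar> * \<bar>h x\<bar> \<le> (1 + norm (g x) powr p) * M"
        using hM by (intro mult_mono) auto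
      moreover have "norm (M * (indicator (K \<inter> \<Omega>) x + norm (g x) powr p)) = M * (1 + norm (g x) powr p)"
        using True x M by (simp add: abs_mult)
      ultimately show ?thesis by (simp add: abs_mult mult.commute)
    qed (simp add: hK)
  qed
qed

text \<open>\<open>wgrad\<close> is a choice among all weak gradients; this shows that the energy
  does not depend on the choice.\<close>

lemma weak_grad_unique:
  fixes g g' :: "real^'n::finite \<Rightarrow> real^'n"
  assumes \<Omega>: "open \<Omega>" and p: "p > 1" and g: "Lp_vec \<Omega> p g" "weak_grad \<Omega> u g"
    and g': "Lp_vec \<Omega> p g'" "weak_grad \<Omega> u g'"
  shows "AE x in lebesgue_on \<Omega>. g x = g' x"
proof -
  have [measurable]: "g \<in> borel_measurable (lebesgue_on \<Omega>)" "g' \<in> borel_measurable (lebesgue_on \<Omega>)"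
    using g(1) g'(1) by (auto simp: Lp_vec_def)
  have "AE x in lebesgue_on \<Omega>. g x $ i - g' x $ i = 0" for i
  proof (rule fundamental_lemma_variations [OF \<Omega>])
    show "(\<lambda>x. g x $ i - g' x $ i) \<in> borel_measurable (lebesgue_on \<Omega>)"
      by (intro borel_measurable_diff measurable_compose [OF _ borel_measurable_nth]) measurable
    show "integrable (lebesgue_on \<Omega>) (\<lambda>x. indicator C x * (g x $ i - g' x $ i))" if C: "compact C" "C \<subseteq> \<Omega>" for C
    proof -
      have m: "indicator C \<in> borel_measurable (lebesgue_on \<Omega>)"
        using compact_imp_closed [OF C(1)] by (intro borel_measurable_lebesgue_onI borel_measurable_indicator) auto
      have "integrable (lebesgue_on \<Omega>) (\<lambda>x. g x $ i * indicator C x)" "integrable (lebesgue_on \<Omega>) (\<lambda>x. g' x $ i * indicator C x)"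
        by (rule Lp_vec_component_integrable [OF \<Omega> p _ m C(1), where M = 1]; use g g' in \<open>auto simp: indicator_def\<close>)+
      from Bochner_Integration.integrable_diff [OF this] show ?thesis
        by (simp add: algebra_simps)
    qed
    fix \<phi> assume phi: "\<phi> \<in> test_fun \<Omega>"
    have m: "\<phi> \<in> borel_measurable (lebesgue_on \<Omega>)"
      by (intro borel_measurable_lebesgue_onI smooth_borel test_fun_smooth [OF phi])
    have K: "compact (closure {x. \<phi> x \<noteq> 0})" using phi by (simp add: test_fun_def)
    have out: "\<phi> x = 0" if "x \<notin> closure {x. \<phi> x \<noteq> 0}" for x
      using that closure_subset [of "{x. \<phi> x \<noteq> 0}"] by auto
    obtain B M where b1: "\<And>x. \<phi> x \<noteq> 0 \<Longrightarrow> norm x \<le> B" "\<And>x i. partial_d i \<phi> x \<noteq> 0 \<Longrightarrow> norm x \<le> B"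
      "\<And>x. \<bar>\<phi> x\<bar> \<le> M" "\<And>x i. \<bar>partial_d i \<phi> x\<bar> \<le> M"
      by (rule test_fun_bounds [OF phi]) (rule that)
    have "(\<integral>x. g x $ i * \<phi> x \<partial>lebesgue_on \<Omega>) = (\<integral>x. g' x $ i * \<phi> x \<partial>lebesgue_on \<Omega>)"
      using g(2) g'(2) phi unfolding weak_grad_def by fastforce
    moreover have "(\<integral>x. g x $ i * \<phi> x - g' x $ i * \<phi> x \<partial>lebesgue_on \<Omega>)
        = (\<integral>x. g x $ i * \<phi> x \<partial>lebesgue_on \<Omega>) - (\<integral>x. g' x $ i * \<phi> x \<partial>lebesgue_on \<Omega>)"
      by (rule Bochner_Integration.integral_diff [OF Lp_vec_component_integrable [OF \<Omega> p g(1) m K out b1(3)]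
          Lp_vec_component_integrable [OF \<Omega> p g'(1) m K out b1(3)]])
    ultimately show "(\<integral>x. (g x $ i - g' x $ i) * \<phi> x \<partial>lebesgue_on \<Omega>) = 0"
      by (simp add: left_diff_distrib)
  qed
  then have "AE x in lebesgue_on \<Omega>. \<forall>i\<in>UNIV. g x $ i - g' x $ i = 0"
    by (intro AE_finite_allI) auto
  then show ?thesis by eventually_elim (simp add: vec_eq_iff)
qed

lemma wgrad_test_fun:
  fixes \<phi> :: "real^'n::finite \<Rightarrow> real"
  assumes \<Omega>: "open \<Omega>" and p: "p > 1" and phi: "\<phi> \<in> test_fun \<Omega>"
  shows "(\<integral>x. norm (wgrad \<Omega> p \<phi> x) powr p \<partial>lebesgue_on \<Omega>) = (\<integral>x. norm (grad \<phi> x) powr p \<partial>lborel)"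
proof -
  have ex: "\<exists>g. Lp_vec \<Omega> p g \<and> weak_grad \<Omega> \<phi> g"
    using test_fun_Lp [OF \<Omega> phi p] test_fun_weak_grad [OF \<Omega> phi] by blast
  have w: "Lp_vec \<Omega> p (wgrad \<Omega> p \<phi>)" "weak_grad \<Omega> \<phi> (wgrad \<Omega> p \<phi>)"
    using someI_ex [OF ex] by (auto simp: wgrad_def)
  have [measurable]: "wgrad \<Omega> p \<phi> \<in> borel_measurable (lebesgue_on \<Omega>)" "grad \<phi> \<in> borel_measurable (lebesgue_on \<Omega>)"
    using w test_fun_Lp [OF \<Omega> phi p] by (auto simp: Lp_vec_def)
  have [measurable]: "grad \<phi> \<in> borel_measurable borel"
    by (rule smooth_grad_borel [OF test_fun_smooth [OF phi]])
  have "AE x in lebesgue_on \<Omega>. wgrad \<Omega> p \<phi> x = grad \<phi> x"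
    by (rule weak_grad_unique [OF \<Omega> p w test_fun_Lp(2) [OF \<Omega> phi p] test_fun_weak_grad [OF \<Omega> phi]])
  then have "(\<integral>x. norm (wgrad \<Omega> p \<phi> x) powr p \<partial>lebesgue_on \<Omega>) = (\<integral>x. norm (grad \<phi> x) powr p \<partial>lebesgue_on \<Omega>)"
    by (intro integral_cong_AE) auto
  also have "\<dots> = (\<integral>x. norm (grad \<phi> x) powr p \<partial>lborel)"
    by (rule integral_lebesgue_on_eq [OF \<Omega>]) (use test_fun_outside [OF phi] in auto)
  finally show ?thesis .
qed

lemma energy_test_fun:
  "open \<Omega> \<Longrightarrow> p > 1 \<Longrightarrow> \<phi> \<in> test_fun \<Omega> \<Longrightarrow> energy \<Omega> p \<phi> = (\<integral>x. norm (grad \<phi> x) powr p \<partial>lborel)"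
  unfolding energy_def by (rule wgrad_test_fun)

lemma norm_test_fun:
  fixes \<phi> :: "real^'n::finite \<Rightarrow> real"
  assumes \<Omega>: "open \<Omega>" and phi: "\<phi> \<in> test_fun \<Omega>"
  shows "(\<integral>x. \<bar>\<phi> x\<bar> powr p \<partial>lebesgue_on \<Omega>) = (\<integral>x. \<bar>\<phi> x\<bar> powr p \<partial>lborel)"
proof -
  have [measurable]: "\<phi> \<in> borel_measurable borel" by (rule smooth_borel [OF test_fun_smooth [OF phi]])
  show ?thesis by (rule integral_lebesgue_on_eq [OF \<Omega>]) (use test_fun_outside [OF phi] in auto)
qed

lemma wdist_test_fun:
  fixes \<phi> \<psi> :: "real^'n::finite \<Rightarrow> real"
  assumes \<Omega>: "open \<Omega>" and p: "p > 1" and d: "(\<lambda>x. \<phi> x - \<psi> x) \<in> test_fun \<Omega>"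
  shows "wdist \<Omega> p \<phi> \<psi> = (\<integral>x. \<bar>\<phi> x - \<psi> x\<bar> powr p \<partial>lborel) + (\<integral>x. norm (grad (\<lambda>x. \<phi> x - \<psi> x) x) powr p \<partial>lborel)"
  unfolding wdist_def using norm_test_fun [OF \<Omega> d] wgrad_test_fun [OF \<Omega> p d] by simp

section \<open>Upper bounds for the variational eigenvalues\<close>

definition lincomb :: "nat \<Rightarrow> (nat \<Rightarrow> real^'n::finite \<Rightarrow> real) \<Rightarrow> (nat \<Rightarrow> real) \<Rightarrow> real^'n \<Rightarrow> real" where
  "lincomb k \<phi> c x = (\<Sum>i<k. c i * \<phi> i x)"

lemma iter_partial_lincomb:
  assumes s: "\<And>i. i < k \<Longrightarrow> smooth (\<phi> i)"
  shows "iter_partial is (lincomb k \<phi> c) = lincomb k (\<lambda>i. iter_partial is (\<phi> i)) c"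
    and "((\<lambda>t. lincomb k (\<lambda>i. iter_partial is (\<phi> i)) c (x + t *\<^sub>R axis j 1)) has_real_derivative
      lincomb k (\<lambda>i. iter_partial (j # is) (\<phi> i)) c x) (at 0)"
proof -
  have d: "((\<lambda>t. lincomb k (\<lambda>i. iter_partial is (\<phi> i)) c (x + t *\<^sub>R axis j 1)) has_real_derivative
      lincomb k (\<lambda>i. iter_partial (j # is) (\<phi> i)) c x) (at 0)" for j x "is"
    unfolding lincomb_def
  proof (rule DERIV_sum)
    fix i assume "i \<in> {..<k}"
    then have "smooth (\<phi> i)" using s by simp
    then have "(\<lambda>t. iter_partial is (\<phi> i) (x + t *\<^sub>R axis j 1)) differentiable (at 0)" by (simp add: smooth_def)
    then have "((\<lambda>t. iter_partial is (\<phi> i) (x + t *\<^sub>R axis j 1)) has_real_derivative iter_partial (j # is) (\<phi> i) x) (at 0)"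
      by (simp add: partial_d_def DERIV_deriv_iff_real_differentiable)
    then show "((\<lambda>t. c i * iter_partial is (\<phi> i) (x + t *\<^sub>R axis j 1)) has_real_derivative c i * iter_partial (j # is) (\<phi> i) x) (at 0)"
      by (rule DERIV_cmult)
  qed
  show "((\<lambda>t. lincomb k (\<lambda>i. iter_partial is (\<phi> i)) c (x + t *\<^sub>R axis j 1)) has_real_derivative
      lincomb k (\<lambda>i. iter_partial (j # is) (\<phi> i)) c x) (at 0)" by (rule d)
  show "iter_partial is (lincomb k \<phi> c) = lincomb k (\<lambda>i. iter_partial is (\<phi> i)) c"
  proof (induction "is")
    case (Cons j "is")
    have "iter_partial (j # is) (lincomb k \<phi> c) = partial_d j (lincomb k (\<lambda>i. iter_partial is (\<phi> i)) c)"
      by (simp add: Cons)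
    also have "\<dots> = lincomb k (\<lambda>i. iter_partial (j # is) (\<phi> i)) c"
      unfolding partial_d_def by (rule ext) (rule DERIV_imp_deriv [OF d])
    finally show ?case .
  qed simp
qed

lemma smooth_lincomb:
  assumes s: "\<And>i. i < k \<Longrightarrow> smooth (\<phi> i)"
  shows "smooth (lincomb k \<phi> c)"
  unfolding smooth_def
proof (intro allI conjI)
  fix "is"
  have eq: "iter_partial is (lincomb k \<phi> c) = lincomb k (\<lambda>i. iter_partial is (\<phi> i)) c"
    by (rule iter_partial_lincomb(1) [OF s])
  have "continuous_on UNIV (\<lambda>x. \<Sum>i<k. c i * iter_partial is (\<phi> i) x)"
    using s by (intro continuous_intros) (auto simp: smooth_def)
  then show "continuous_on UNIV (iter_partial is (lincomb k \<phi> c))"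
    unfolding eq by (simp add: lincomb_def [abs_def])
  show "(\<lambda>t. iter_partial is (lincomb k \<phi> c) (x + t *\<^sub>R axis i 1)) differentiable at 0" for i x
    unfolding eq real_differentiable_def by (rule exI) (rule iter_partial_lincomb(2) [OF s])
qed

lemma grad_lincomb:
  assumes s: "\<And>i. i < k \<Longrightarrow> smooth (\<phi> i)"
  shows "grad (lincomb k \<phi> c) x = (\<Sum>i<k. c i *\<^sub>R grad (\<phi> i) x)"
proof -
  have "partial_d j (lincomb k \<phi> c) x = (\<Sum>i<k. c i * partial_d j (\<phi> i) x)" for j
  proof -
    have "iter_partial [j] (lincomb k \<phi> c) = lincomb k (\<lambda>i. iter_partial [j] (\<phi> i)) c"
      by (rule iter_partial_lincomb(1) [OF s])
    then show ?thesis by (simp add: lincomb_def)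
  qed
  then show ?thesis by (simp add: grad_def vec_eq_iff)
qed

lemma test_fun_lincomb:
  assumes t: "\<And>i. i < k \<Longrightarrow> \<phi> i \<in> test_fun \<Omega>"
  shows "lincomb k \<phi> c \<in> test_fun \<Omega>"
proof -
  let ?K = "\<Union>i<k. closure {x. \<phi> i x \<noteq> 0}"
  have K: "compact ?K" "?K \<subseteq> \<Omega>" using t by (auto simp: test_fun_def intro!: compact_UN)
  have "{x. lincomb k \<phi> c x \<noteq> 0} \<subseteq> ?K"
  proof
    fix x assume "x \<in> {x. lincomb k \<phi> c x \<noteq> 0}"
    then obtain i where "i < k" "\<phi> i x \<noteq> 0"
      unfolding lincomb_def using sum.neutral [of "{..<k}" "\<lambda>i. c i * \<phi> i x"] by fastforce
    then show "x \<in> ?K" using closure_subset [of "{x. \<phi> i x \<noteq> 0}"] by blast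
  qed
  then have cl: "closure {x. lincomb k \<phi> c x \<noteq> 0} \<subseteq> ?K"
    by (rule closure_minimal [OF _ compact_imp_closed [OF K(1)]])
  have "compact (closure {x. lincomb k \<phi> c x \<noteq> 0})"
    using compact_Int_closed [OF K(1) closed_closure, of "{x. lincomb k \<phi> c x \<noteq> 0}"] cl by (simp add: Int_absorb1)
  then show ?thesis
    using cl K(2) smooth_lincomb [of k \<phi> c] t by (auto simp: test_fun_def)
qed

lemma norm_powr_sum_disjoint:
  fixes v :: "'i \<Rightarrow> 'b::real_normed_vector"
  assumes p: "p > 0" and fin: "finite I"
    and disj: "\<And>i j. i \<in> I \<Longrightarrow> j \<in> I \<Longrightarrow> v i \<noteq> 0 \<Longrightarrow> v j \<noteq> 0 \<Longrightarrow> i = j"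
  shows "norm (\<Sum>i\<in>I. c i *\<^sub>R v i) powr p = (\<Sum>i\<in>I. \<bar>c i\<bar> powr p * norm (v i) powr p)"
proof (cases "\<exists>i\<in>I. v i \<noteq> 0")
  case True
  then obtain i where i: "i \<in> I" "v i \<noteq> 0" by blast
  have z: "v j = 0" if "j \<in> I - {i}" for j using disj [of i j] i that by auto
  have "(\<Sum>i\<in>I. c i *\<^sub>R v i) = c i *\<^sub>R v i"
    using sum.remove [OF fin i(1), of "\<lambda>i. c i *\<^sub>R v i"] z by simp
  moreover have "(\<Sum>i\<in>I. \<bar>c i\<bar> powr p * norm (v i) powr p) = \<bar>c i\<bar> powr p * norm (v i) powr p"
    using sum.remove [OF fin i(1), of "\<lambda>i. \<bar>c i\<bar> powr p * norm (v i) powr p"] z p by simp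
  ultimately show ?thesis by (simp add: powr_mult)
qed (use p in auto)

text \<open>At each point at most one summand is nonzero. The closures of the supports are required
  to be disjoint because a gradient is known to vanish only outside the closure.\<close>

lemma
  fixes \<phi> :: "nat \<Rightarrow> real^'n::finite \<Rightarrow> real"
  assumes \<Omega>: "open \<Omega>" and p: "p > 1" and t: "\<And>i. i < k \<Longrightarrow> \<phi> i \<in> test_fun \<Omega>"
    and disj: "\<And>i j. i < k \<Longrightarrow> j < k \<Longrightarrow> i \<noteq> j \<Longrightarrow> closure {x. \<phi> i x \<noteq> 0} \<inter> closure {x. \<phi> j x \<noteq> 0} = {}"
  shows integral_lincomb: "(\<integral>x. \<bar>lincomb k \<phi> c x\<bar> powr p \<partial>lborel) = (\<Sum>i<k. \<bar>c i\<bar> powr p * (\<integral>x. \<bar>\<phi> i x\<bar> powr p \<partial>lborel))"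
    and integral_grad_lincomb: "(\<integral>x. norm (grad (lincomb k \<phi> c) x) powr p \<partial>lborel)
      = (\<Sum>i<k. \<bar>c i\<bar> powr p * (\<integral>x. norm (grad (\<phi> i) x) powr p \<partial>lborel))"
proof -
  have p0: "p > 0" using p by simp
  have sm: "smooth (\<phi> i)" if "i < k" for i by (rule test_fun_smooth [OF t [OF that]])
  have "\<bar>lincomb k \<phi> c x\<bar> powr p = (\<Sum>i<k. \<bar>c i\<bar> powr p * \<bar>\<phi> i x\<bar> powr p)" for x
  proof -
    have "norm (\<Sum>i<k. c i *\<^sub>R \<phi> i x) powr p = (\<Sum>i<k. \<bar>c i\<bar> powr p * norm (\<phi> i x) powr p)"
    proof (rule norm_powr_sum_disjoint [OF p0])
      fix i j assume ij: "i \<in> {..<k}" "j \<in> {..<k}" "\<phi> i x \<noteq> 0" "\<phi> j x \<noteq> 0"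
      have "x \<in> closure {x. \<phi> i x \<noteq> 0} \<inter> closure {x. \<phi> j x \<noteq> 0}"
        using ij by (intro IntI closure_subset [THEN subsetD]) simp_all
      then show "i = j" using disj [of i j] ij by auto
    qed simp
    then show ?thesis by (simp add: lincomb_def)
  qed
  then show "(\<integral>x. \<bar>lincomb k \<phi> c x\<bar> powr p \<partial>lborel) = (\<Sum>i<k. \<bar>c i\<bar> powr p * (\<integral>x. \<bar>\<phi> i x\<bar> powr p \<partial>lborel))"
    using test_fun_Lp(3) [OF \<Omega> t p] by (simp add: Bochner_Integration.integral_sum)
  have "norm (grad (lincomb k \<phi> c) x) powr p = (\<Sum>i<k. \<bar>c i\<bar> powr p * norm (grad (\<phi> i) x) powr p)" for x
  proof -
    have "grad (lincomb k \<phi> c) x = (\<Sum>i<k. c i *\<^sub>R grad (\<phi> i) x)"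
      by (rule grad_lincomb) (erule sm)
    moreover have "norm (\<Sum>i<k. c i *\<^sub>R grad (\<phi> i) x) powr p = (\<Sum>i<k. \<bar>c i\<bar> powr p * norm (grad (\<phi> i) x) powr p)"
    proof (rule norm_powr_sum_disjoint [OF p0])
      fix i j assume ij: "i \<in> {..<k}" "j \<in> {..<k}" "grad (\<phi> i) x \<noteq> 0" "grad (\<phi> j) x \<noteq> 0"
      have "x \<in> closure {x. \<phi> i x \<noteq> 0} \<inter> closure {x. \<phi> j x \<noteq> 0}"
        using contrapos_np [OF ij(3) grad_outside_support] contrapos_np [OF ij(4) grad_outside_support] by (rule IntI)
      then show "i = j" using disj [of i j] ij by auto
    qed simp
    ultimately show ?thesis by (simp only:)
  qed
  then show "(\<integral>x. norm (grad (lincomb k \<phi> c) x) powr p \<partial>lborel)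
      = (\<Sum>i<k. \<bar>c i\<bar> powr p * (\<integral>x. norm (grad (\<phi> i) x) powr p \<partial>lborel))"
    using test_fun_Lp(4) [OF \<Omega> t p] by (simp add: Bochner_Integration.integral_sum)
qed

text \<open>The constant sequence approximates. Its distance to the limit is the norm of the zero
  function, obtained here as an empty linear combination in order to know that it is a test
  function.\<close>

lemma W01p_test_fun:
  fixes \<phi> :: "real^'n::finite \<Rightarrow> real"
  assumes \<Omega>: "open \<Omega>" and p: "p > 1" and phi: "\<phi> \<in> test_fun \<Omega>"
  shows "W01p \<Omega> p \<phi>"
proof -
  have "lincomb 0 (\<lambda>_. \<phi>) (\<lambda>_. 0) \<in> test_fun \<Omega>" by (rule test_fun_lincomb) simp
  then have z: "(\<lambda>x. \<phi> x - \<phi> x) \<in> test_fun \<Omega>" by (simp add: lincomb_def [abs_def])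
  have "grad (lincomb 0 (\<lambda>_. \<phi>) (\<lambda>_. 0)) x = 0" for x
    by (subst grad_lincomb) auto
  then have "wdist \<Omega> p \<phi> \<phi> = 0"
    using wdist_test_fun [OF \<Omega> p z] p by (simp add: lincomb_def [abs_def])
  then have "(\<lambda>j::nat. wdist \<Omega> p \<phi> \<phi>) \<longlonglongrightarrow> 0" by simp
  moreover have "W1p \<Omega> p \<phi>"
    using test_fun_Lp [OF \<Omega> phi p] test_fun_weak_grad [OF \<Omega> phi] by (auto simp: W1p_def)
  ultimately show ?thesis
    unfolding W01p_def using phi by (intro conjI exI [of _ "\<lambda>_. \<phi>"]) auto
qed

lemma energy_nonneg: "energy \<Omega> p u \<ge> 0"
  unfolding energy_def by simp

text \<open>On a set that is not bounded above, \<open>Sup\<close> is one fixed unspecified real number.\<close>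

lemma Sup_energy_ge:
  assumes "A \<noteq> {}"
  shows "min 0 (Sup (UNIV :: real set)) \<le> Sup (energy \<Omega> p ` A)"
proof (cases "bdd_above (energy \<Omega> p ` A)")
  case True
  obtain u where u: "u \<in> A" using assms by blast
  have "0 \<le> energy \<Omega> p u" by (rule energy_nonneg)
  also have "\<dots> \<le> Sup (energy \<Omega> p ` A)" using True u by (intro cSup_upper) auto
  finally show ?thesis by simp
next
  case False
  then have "\<not> (\<forall>x\<in>energy \<Omega> p ` A. x \<le> z)" for z unfolding bdd_above_def by blast
  moreover have "\<not> (\<forall>x\<in>(UNIV :: real set). x \<le> z)" for z using gt_ex [of z] by (auto simp: not_le)
  ultimately have "(\<forall>x\<in>energy \<Omega> p ` A. x \<le> z) = (\<forall>x\<in>(UNIV :: real set). x \<le> z)" for z by blast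
  then have "(\<lambda>z. \<forall>x\<in>energy \<Omega> p ` A. x \<le> z) = (\<lambda>z. \<forall>x\<in>UNIV. x \<le> z)" by (rule ext)
  then have "Sup (energy \<Omega> p ` A) = Sup UNIV" by (simp only: Sup_real_def)
  then show ?thesis by simp
qed

text \<open>\<open>Inf\<close> over reals is only meaningful for sets bounded below. The uniform
  bound of \<open>Sup_energy_ge\<close> provides this although single suprema may be of unbounded
  sets.\<close>

lemma lambda_var_le:
  assumes k: "k \<ge> 1" and A: "A \<in> Fk \<Omega> p k" and le: "\<And>u. u \<in> A \<Longrightarrow> energy \<Omega> p u \<le> m"
  shows "lambda_var \<Omega> p k \<le> m"
proof -
  have "(\<lambda>i. if i = 0 then 1 else 0) \<in> sphk k"
    using k by (auto simp: sphk_def if_distrib [of "\<lambda>x. x\<^sup>2"] cong: if_cong)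
  then have ne: "B \<noteq> {}" if "B \<in> Fk \<Omega> p k" for B using that by (auto simp: Fk_def)
  have "lambda_var \<Omega> p k \<le> Sup (energy \<Omega> p ` A)"
    unfolding lambda_var_def
  proof (rule cInf_lower)
    show "bdd_below ((\<lambda>A. Sup (energy \<Omega> p ` A)) ` Fk \<Omega> p k)"
      by (rule bdd_belowI2 [of _ "min 0 (Sup (UNIV :: real set))"]) (rule Sup_energy_ge [OF ne])
  qed (use A in simp)
  also have "\<dots> \<le> m" using ne [OF A] le by (intro cSup_least) auto
  finally show ?thesis .
qed

text \<open>The coefficients are chosen so that their p-th powers are y_i^2 divided by the norm
  integral of the i-th function. Then points of the sphere have norm 1, and their energy is a convex
  combination of the k Rayleigh quotients, hence at most the largest.\<close>

lemma lambda_var_less: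
  fixes \<phi> :: "nat \<Rightarrow> real^'n::finite \<Rightarrow> real"
  assumes \<Omega>: "open \<Omega>" and p: "p > 1" and k: "k \<ge> 1" and t: "\<And>i. i < k \<Longrightarrow> \<phi> i \<in> test_fun \<Omega>"
    and disj: "\<And>i j. i < k \<Longrightarrow> j < k \<Longrightarrow> i \<noteq> j \<Longrightarrow> closure {x. \<phi> i x \<noteq> 0} \<inter> closure {x. \<phi> j x \<noteq> 0} = {}"
    and less: "\<And>i. i < k \<Longrightarrow> (\<integral>x. norm (grad (\<phi> i) x) powr p \<partial>lborel) < \<mu> * (\<integral>x. \<bar>\<phi> i x\<bar> powr p \<partial>lborel)"
  shows "lambda_var \<Omega> p k < \<mu>"
proof -
  define a where "a i = (\<integral>x. \<bar>\<phi> i x\<bar> powr p \<partial>lborel)" for i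
  define E where "E i = (\<integral>x. norm (grad (\<phi> i) x) powr p \<partial>lborel)" for i
  have E0: "E i \<ge> 0" for i unfolding E_def by simp
  have a0: "a i \<ge> 0" for i unfolding a_def by simp
  have a: "a i > 0" if "i < k" for i
  proof -
    have "E i < \<mu> * a i" unfolding a_def E_def by (rule less [OF that])
    then have "a i \<noteq> 0" using E0 [of i] by auto
    then show ?thesis using a0 [of i] by simp
  qed
  define m where "m = Max ((\<lambda>i. E i / a i) ` {..<k})"
  have m: "E i / a i \<le> m" if "i < k" for i unfolding m_def using that by (intro Max_ge) auto
  have "m \<in> (\<lambda>i. E i / a i) ` {..<k}" unfolding m_def by (rule Max_in) (use k in \<open>auto simp: lessThan_empty_iff\<close>)
  then have m_less: "m < \<mu>" using less a by (auto simp: a_def E_def divide_less_eq)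
  \<comment> \<open>The exponent 1 + 2 / p makes the signed power sgn s * |s|^(2/p), which is odd
    and continuous and has p-th absolute power s^2.\<close>
  define \<kappa> where "\<kappa> i s = phi_p (1 + 2 / p) s * a i powr (- 1 / p)" for i s
  have kp: "\<bar>\<kappa> i s\<bar> powr p = s\<^sup>2 / a i" if "i < k" for i s
  proof -
    have "\<bar>\<kappa> i s\<bar> = \<bar>s\<bar> powr (2 / p) * a i powr (- 1 / p)" by (simp add: \<kappa>_def abs_mult abs_phi_p)
    then have "\<bar>\<kappa> i s\<bar> powr p = \<bar>s\<bar> powr 2 * a i powr (- 1)"
      using p by (simp add: powr_mult powr_powr)
    moreover have "\<bar>s\<bar> powr 2 = s\<^sup>2" by (cases "s = 0") (auto simp: powr_numeral)
    ultimately show ?thesis using a [OF that] by (simp add: powr_minus divide_inverse)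
  qed
  define h where "h y = lincomb k \<phi> (\<lambda>i. \<kappa> i (y i))" for y
  have ht: "h y \<in> test_fun \<Omega>" for y unfolding h_def by (rule test_fun_lincomb [OF t])
  have hS: "h y \<in> Ssph \<Omega> p" if y: "y \<in> sphk k" for y
  proof -
    have "(\<integral>x. \<bar>h y x\<bar> powr p \<partial>lborel) = (\<Sum>i<k. \<bar>\<kappa> i (y i)\<bar> powr p * a i)"
      unfolding h_def a_def by (rule integral_lincomb [OF \<Omega> p t disj])
    also have "\<dots> = (\<Sum>i<k. (y i)\<^sup>2)"
    proof (rule sum.cong)
      fix i assume "i \<in> {..<k}"
      then show "\<bar>\<kappa> i (y i)\<bar> powr p * a i = (y i)\<^sup>2" using kp [of i "y i"] a [of i] by simp
    qed simp
    also have "\<dots> = 1" using y by (simp add: sphk_def)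
    finally show ?thesis
      by (simp add: Ssph_def W01p_test_fun [OF \<Omega> p ht] norm_test_fun [OF \<Omega> ht])
  qed
  have hodd: "h (- y) = (\<lambda>x. - h y x)" for y
    by (simp add: h_def lincomb_def [abs_def] \<kappa>_def phi_p_minus sum_negf)
  have hdist: "wdist \<Omega> p (h z) (h y) = (\<Sum>i<k. \<bar>\<kappa> i (z i) - \<kappa> i (y i)\<bar> powr p * (a i + E i))" for z y
  proof -
    let ?c = "\<lambda>i. \<kappa> i (z i) - \<kappa> i (y i)"
    have eq: "(\<lambda>x. h z x - h y x) = lincomb k \<phi> ?c"
      by (simp add: h_def lincomb_def fun_eq_iff left_diff_distrib sum_subtractf)
    have "(\<lambda>x. h z x - h y x) \<in> test_fun \<Omega>" unfolding eq by (rule test_fun_lincomb [OF t])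
    from wdist_test_fun [OF \<Omega> p this]
    have "wdist \<Omega> p (h z) (h y) = (\<integral>x. \<bar>lincomb k \<phi> ?c x\<bar> powr p \<partial>lborel)
        + (\<integral>x. norm (grad (lincomb k \<phi> ?c) x) powr p \<partial>lborel)"
      unfolding eq [symmetric] .
    also have "\<dots> = (\<Sum>i<k. \<bar>?c i\<bar> powr p * a i) + (\<Sum>i<k. \<bar>?c i\<bar> powr p * E i)"
      unfolding a_def E_def using integral_lincomb [OF \<Omega> p t disj] integral_grad_lincomb [OF \<Omega> p t disj] by simp
    finally show ?thesis by (simp add: sum.distrib distrib_left)
  qed
  have hcont: "\<exists>d>0. \<forall>z\<in>sphk k. distk k z y < d \<longrightarrow> wdist \<Omega> p (h z) (h y) < e" if e: "e > 0" for y e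
  proof -
    \<comment> \<open>The distance of two image points splits over the coordinates by disjointness
      of supports, so continuity is checked in each coordinate with the share e / k.\<close>
    have "\<exists>d>0. \<forall>s. \<bar>s - y i\<bar> < d \<longrightarrow> \<bar>\<kappa> i s - \<kappa> i (y i)\<bar> powr p * (a i + E i) < e / real k" for i
    proof -
      have "((\<lambda>s. \<bar>\<kappa> i s - \<kappa> i (y i)\<bar> powr p * (a i + E i)) \<longlongrightarrow> \<bar>\<kappa> i (y i) - \<kappa> i (y i)\<bar> powr p * (a i + E i)) (at (y i))"
        unfolding \<kappa>_def using p
        by (intro tendsto_mult tendsto_const tendsto_powr' tendsto_rabs tendsto_diff tendsto_phi_p tendsto_ident_at) auto
      then have "((\<lambda>s. \<bar>\<kappa> i s - \<kappa> i (y i)\<bar> powr p * (a i + E i)) \<longlongrightarrow> 0) (at (y i))" using p by simp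
      then have "eventually (\<lambda>s. \<bar>\<kappa> i s - \<kappa> i (y i)\<bar> powr p * (a i + E i) < e / real k) (at (y i))"
        by (rule order_tendstoD) (use e k in simp)
      then obtain d where d: "d > 0" "\<And>s. s \<noteq> y i \<Longrightarrow> dist s (y i) < d \<Longrightarrow> \<bar>\<kappa> i s - \<kappa> i (y i)\<bar> powr p * (a i + E i) < e / real k"
        unfolding eventually_at by auto
      have "\<bar>\<kappa> i s - \<kappa> i (y i)\<bar> powr p * (a i + E i) < e / real k" if "\<bar>s - y i\<bar> < d" for s
        using d(2) [of s] that e k p by (cases "s = y i") (auto simp: dist_real_def)
      then show ?thesis using d(1) by blast
    qed
    then obtain d where d: "\<And>i. d i > 0" "\<And>i s. \<bar>s - y i\<bar> < d i \<Longrightarrow> \<bar>\<kappa> i s - \<kappa> i (y i)\<bar> powr p * (a i + E i) < e / real k"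
      by metis
    let ?d = "Min (d ` {..<k})"
    show ?thesis
    proof (intro exI conjI ballI impI)
      show "?d > 0" using d(1) k by (subst Min_gr_iff) (auto simp: lessThan_empty_iff)
      fix z assume z: "distk k z y < ?d"
      have "\<bar>z i - y i\<bar> < d i" if i: "i < k" for i
      proof -
        have "\<bar>z i - y i\<bar> \<le> distk k z y"
          unfolding distk_def
          using member_le_sum [of i "{..<k}" "\<lambda>i. (z i - y i)\<^sup>2"] i by (intro real_le_rsqrt) auto
        also have "\<dots> < ?d" by (rule z)
        also have "\<dots> \<le> d i" using i by (intro Min_le) auto
        finally show ?thesis .
      qed
      then have "wdist \<Omega> p (h z) (h y) < (\<Sum>i<k. e / real k)"
        unfolding hdist using k by (intro sum_strict_mono d(2)) (auto simp: lessThan_empty_iff)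
      then show "wdist \<Omega> p (h z) (h y) < e" using k by simp
    qed
  qed
  have "lambda_var \<Omega> p k \<le> m"
  proof (rule lambda_var_le [OF k])
    show "h ` sphk k \<in> Fk \<Omega> p k"
      unfolding Fk_def using hS hodd hcont by blast
    fix u assume "u \<in> h ` sphk k"
    then obtain y where y: "y \<in> sphk k" and u: "u = h y" by blast
    have "energy \<Omega> p u = (\<Sum>i<k. \<bar>\<kappa> i (y i)\<bar> powr p * E i)"
      unfolding u energy_test_fun [OF \<Omega> p ht] unfolding h_def E_def
      by (rule integral_grad_lincomb [OF \<Omega> p t disj])
    also have "\<dots> \<le> (\<Sum>i<k. (y i)\<^sup>2 * m)"
    proof (rule sum_mono)
      fix i assume "i \<in> {..<k}"
      then have i: "i < k" by simp
      have "\<bar>\<kappa> i (y i)\<bar> powr p * E i = (y i)\<^sup>2 * (E i / a i)" by (simp add: kp [OF i])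
      also have "\<dots> \<le> (y i)\<^sup>2 * m" by (intro mult_left_mono m i) simp
      finally show "\<bar>\<kappa> i (y i)\<bar> powr p * E i \<le> (y i)\<^sup>2 * m" .
    qed
    also have "\<dots> = m" using y by (simp add: sphk_def flip: sum_distrib_right)
    finally show "energy \<Omega> p u \<le> m" .
  qed
  then show ?thesis using m_less by simp
qed

section \<open>Truncation and smoothing of the competitors\<close>

text \<open>A \<open>C\<^sup>1\<close> substitute for \<open>max 0 (s - \<delta>)\<close>: composing with it preserves differentiability at every point.\<close>

definition trunc :: "real \<Rightarrow> real \<Rightarrow> real" where
  "trunc \<delta> s = (if s \<le> \<delta> then 0 else (s - \<delta>)\<^sup>2 / s)"

definition trunc' :: "real \<Rightarrow> real \<Rightarrow> real" where
  "trunc' \<delta> s = (if s \<le> \<delta> then 0 else 1 - \<delta>\<^sup>2 / s\<^sup>2)"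

lemma trunc_deriv:
  assumes d: "\<delta> > 0" shows "(trunc \<delta> has_real_derivative trunc' \<delta> s) (at s)"
proof -
  consider "s < \<delta>" | "s > \<delta>" | "s = \<delta>" by linarith
  then show ?thesis
  proof cases
    case 1
    have "(trunc \<delta> has_real_derivative 0) (at s)"
      by (rule has_field_derivative_transform_within_open [OF DERIV_const [of 0], of "{..<\<delta>}"])
        (use 1 in \<open>auto simp: trunc_def\<close>)
    then show ?thesis using 1 by (simp add: trunc'_def)
  next
    case 2
    have "((\<lambda>s. (s - \<delta>)\<^sup>2 / s) has_real_derivative (2 * (s - \<delta>) * s - (s - \<delta>)\<^sup>2) / (s * s)) (at s)"
      using 2 d by (auto intro!: derivative_eq_intros)
    moreover have "(2 * (s - \<delta>) * s - (s - \<delta>)\<^sup>2) / (s * s) = trunc' \<delta> s"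
      using 2 d by (simp add: trunc'_def power2_eq_square field_simps)
    ultimately have "((\<lambda>s. (s - \<delta>)\<^sup>2 / s) has_real_derivative trunc' \<delta> s) (at s)" by simp
    then show ?thesis
      by (rule has_field_derivative_transform_within_open [of _ _ _ "{\<delta><..}"])
        (use 2 in \<open>auto simp: trunc_def\<close>)
  next
    case 3
    have "((\<lambda>h. (trunc \<delta> (s + h) - trunc \<delta> s) / h) \<longlongrightarrow> 0) (at 0)"
    proof (rule Lim_null_comparison)
      show "\<forall>\<^sub>F h in at 0. norm ((trunc \<delta> (s + h) - trunc \<delta> s) / h) \<le> \<bar>h\<bar> / \<delta>"
        unfolding eventually_at_filter
      proof (intro always_eventually allI impI)
        fix h :: real assume "h \<noteq> 0"
        show "norm ((trunc \<delta> (s + h) - trunc \<delta> s) / h) \<le> \<bar>h\<bar> / \<delta>"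
        proof (cases "h \<le> 0")
          case False
          have "h / (\<delta> + h) \<le> h / \<delta>" using False d by (intro divide_left_mono) auto
          then show ?thesis using False d 3 by (simp add: trunc_def power2_eq_square)
        qed (use 3 d in \<open>simp add: trunc_def divide_nonpos_pos\<close>)
      qed
      show "((\<lambda>h. \<bar>h\<bar> / \<delta>) \<longlongrightarrow> 0) (at 0)"
        using d by (auto intro!: tendsto_eq_intros)
    qed
    then show ?thesis using 3 by (simp add: DERIV_def trunc'_def)
  qed
qed

lemma trunc'_bounds: "\<delta> > 0 \<Longrightarrow> 0 \<le> trunc' \<delta> s \<and> trunc' \<delta> s \<le> 1"
  by (auto simp: trunc'_def divide_le_eq intro!: power_mono)

lemma trunc_lipschitz:
  assumes "\<delta> > 0" shows "\<bar>trunc \<delta> s - trunc \<delta> t\<bar> \<le> \<bar>s - t\<bar>"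
proof -
  have "norm (trunc \<delta> s - trunc \<delta> t) \<le> 1 * norm (s - t)"
  proof (rule field_differentiable_bound [of UNIV "trunc \<delta>" "trunc' \<delta>"])
    show "\<And>z. (trunc \<delta> has_field_derivative trunc' \<delta> z) (at z within UNIV)"
      using trunc_deriv [OF assms] by simp
    show "\<And>z. norm (trunc' \<delta> z) \<le> 1" using trunc'_bounds [OF assms] by (simp add: abs_le_iff)
  qed auto
  then show ?thesis by simp
qed

lemma trunc_close: "\<delta> > 0 \<Longrightarrow> 0 \<le> s \<Longrightarrow> \<bar>trunc \<delta> s - s\<bar> \<le> 2 * \<delta>"
  by (auto simp: trunc_def power2_eq_square field_simps abs_le_iff)

lemma trunc_nonneg: "\<delta> > 0 \<Longrightarrow> 0 \<le> trunc \<delta> s"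
  by (auto simp: trunc_def)

lemma trunc_le: "\<delta> > 0 \<Longrightarrow> 0 \<le> s \<Longrightarrow> trunc \<delta> s \<le> s"
  using trunc_lipschitz [of \<delta> s 0] trunc_nonneg [of \<delta> s] by (simp add: trunc_def split: if_splits)

lemma lipgrad_trunc:
  assumes d: "\<delta> > 0" and fG: "lipgrad f G"
  shows "lipgrad (\<lambda>x. trunc \<delta> (f x)) (\<lambda>x. trunc' \<delta> (f x) *\<^sub>R G x)"
proof -
  obtain L B where L: "L-lipschitz_on UNIV f" "\<And>x. norm (G x) \<le> L"
    and B: "\<And>x. f x \<noteq> 0 \<or> G x \<noteq> 0 \<Longrightarrow> norm x \<le> B" and Gm: "G \<in> borel_measurable borel"
    and diff: "AE x in lborel. (f has_derivative (\<lambda>h. G x \<bullet> h)) (at x)"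
    using fG unfolding lipgrad_def by blast
  have [measurable]: "f \<in> borel_measurable borel" "G \<in> borel_measurable borel"
    using lipschitz_borel [OF L(1)] Gm by auto
  have "L-lipschitz_on UNIV (\<lambda>x. trunc \<delta> (f x))"
  proof (rule lipschitz_onI)
    fix x y
    show "dist (trunc \<delta> (f x)) (trunc \<delta> (f y)) \<le> L * dist x y"
      using trunc_lipschitz [OF d, of "f x" "f y"] lipschitz_onD [OF L(1), of x y]
      by (simp add: dist_real_def)
  qed (rule lipschitz_on_nonneg [OF L(1)])
  moreover have "norm (trunc' \<delta> (f x) *\<^sub>R G x) \<le> L" for x
  proof -
    have "norm (trunc' \<delta> (f x) *\<^sub>R G x) \<le> 1 * norm (G x)"
      unfolding norm_scaleR using trunc'_bounds [OF d, of "f x"] by (intro mult_right_mono) auto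
    then show ?thesis using L(2) [of x] by simp
  qed
  moreover have "norm x \<le> B" if "trunc \<delta> (f x) \<noteq> 0 \<or> trunc' \<delta> (f x) *\<^sub>R G x \<noteq> 0" for x
    using that B [of x] d by (auto simp: trunc_def split: if_splits)
  moreover have "(\<lambda>x. trunc' \<delta> (f x) *\<^sub>R G x) \<in> borel_measurable borel"
    unfolding trunc'_def by measurable
  moreover have "AE x in lborel. ((\<lambda>x. trunc \<delta> (f x)) has_derivative (\<lambda>h. (trunc' \<delta> (f x) *\<^sub>R G x) \<bullet> h)) (at x)"
    using diff
  proof eventually_elim
    case (elim x)
    have "(trunc \<delta> has_derivative (\<lambda>h. trunc' \<delta> (f x) * h)) (at (f x))"
      using trunc_deriv [OF d, of "f x"] by (simp add: has_field_derivative_def)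
    from has_derivative_compose [OF elim this] show ?case by simp
  qed
  ultimately show ?thesis unfolding lipgrad_def by blast
qed

text \<open>Truncation does not raise the energy, as its slope is at most 1, and the norm converges
  as the height tends to 0. A small height thus keeps the strict inequality, and the support moves
  into a compact superlevel set.\<close>

lemma ex_trunc_rayleigh:
  fixes f :: "real^'n::finite \<Rightarrow> real"
  assumes p: "p > 1" and fG: "lipgrad f G" and f0: "\<And>x. f x \<ge> 0"
    and less: "(\<integral>x. norm (G x) powr p \<partial>lborel) < \<mu> * (\<integral>x. \<bar>f x\<bar> powr p \<partial>lborel)"
  obtains \<delta> g G' where "\<delta> > 0" "lipgrad g G'" "\<And>x. 0 \<le> g x" "\<And>x. g x \<noteq> 0 \<Longrightarrow> \<delta> \<le> f x"
    "(\<integral>x. norm (G' x) powr p \<partial>lborel) < \<mu> * (\<integral>x. \<bar>g x\<bar> powr p \<partial>lborel)"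
proof -
  define d where "d n = inverse (real (Suc n))" for n
  have d: "d n > 0" for n by (simp add: d_def)
  have d0: "d \<longlonglongrightarrow> 0" unfolding d_def using LIMSEQ_inverse_real_of_nat by simp
  obtain L where L: "L-lipschitz_on UNIV f" using fG unfolding lipgrad_def by blast
  have [measurable]: "f \<in> borel_measurable borel" by (rule lipschitz_borel [OF L])
  have "(\<lambda>n. \<integral>x. \<bar>trunc (d n) (f x)\<bar> powr p \<partial>lborel) \<longlonglongrightarrow> (\<integral>x. \<bar>f x\<bar> powr p \<partial>lborel)"
  proof (rule integral_dominated_convergence)
    show "integrable lborel (\<lambda>x. \<bar>f x\<bar> powr p)" by (rule lipgrad_integrable(2) [OF p fG])
    show "(\<lambda>x. \<bar>trunc (d n) (f x)\<bar> powr p) \<in> borel_measurable lborel" for n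
      unfolding trunc_def by measurable
    show "AE x in lborel. norm (\<bar>trunc (d n) (f x)\<bar> powr p) \<le> \<bar>f x\<bar> powr p" for n
      using trunc_le [OF d f0] trunc_nonneg [OF d] f0 p by (intro AE_I2) (auto intro!: powr_mono2)
    show "AE x in lborel. (\<lambda>n. \<bar>trunc (d n) (f x)\<bar> powr p) \<longlonglongrightarrow> \<bar>f x\<bar> powr p"
    proof (rule AE_I2)
      fix x
      have "(\<lambda>n. trunc (d n) (f x) - f x) \<longlonglongrightarrow> 0"
      proof (rule Lim_null_comparison)
        show "\<forall>\<^sub>F n in sequentially. norm (trunc (d n) (f x) - f x) \<le> 2 * d n"
          using trunc_close [OF d f0] by (auto intro!: always_eventually)
        show "(\<lambda>n. 2 * d n) \<longlonglongrightarrow> 0" by (rule tendsto_mult_right_zero [OF d0])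
      qed
      then have "(\<lambda>n. trunc (d n) (f x)) \<longlonglongrightarrow> f x" by (simp add: LIM_zero_iff)
      then show "(\<lambda>n. \<bar>trunc (d n) (f x)\<bar> powr p) \<longlonglongrightarrow> \<bar>f x\<bar> powr p"
        using p by (intro tendsto_powr' tendsto_rabs tendsto_const) auto
    qed
  qed measurable
  then have "(\<lambda>n. \<mu> * (\<integral>x. \<bar>trunc (d n) (f x)\<bar> powr p \<partial>lborel)) \<longlonglongrightarrow> \<mu> * (\<integral>x. \<bar>f x\<bar> powr p \<partial>lborel)"
    by (intro tendsto_mult tendsto_const)
  from order_tendstoD(1) [OF this less]
  obtain n where n: "(\<integral>x. norm (G x) powr p \<partial>lborel) < \<mu> * (\<integral>x. \<bar>trunc (d n) (f x)\<bar> powr p \<partial>lborel)"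
    by (auto simp: eventually_sequentially)
  let ?G' = "\<lambda>x. trunc' (d n) (f x) *\<^sub>R G x"
  have lg: "lipgrad (\<lambda>x. trunc (d n) (f x)) ?G'" by (rule lipgrad_trunc [OF d fG])
  have "(\<integral>x. norm (?G' x) powr p \<partial>lborel) \<le> (\<integral>x. norm (G x) powr p \<partial>lborel)"
  proof (rule integral_mono [OF lipgrad_integrable(1) [OF p lg] lipgrad_integrable(1) [OF p fG]])
    fix x
    have "norm (?G' x) \<le> 1 * norm (G x)"
      unfolding norm_scaleR using trunc'_bounds [OF d, of n "f x"] by (intro mult_right_mono) auto
    then show "norm (?G' x) powr p \<le> norm (G x) powr p" using p by (intro powr_mono2) auto
  qed
  with n have "(\<integral>x. norm (?G' x) powr p \<partial>lborel) < \<mu> * (\<integral>x. \<bar>trunc (d n) (f x)\<bar> powr p \<partial>lborel)" by linarith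
  moreover have "d n \<le> f x" if "trunc (d n) (f x) \<noteq> 0" for x
    using that by (auto simp: trunc_def split: if_splits)
  ultimately show ?thesis
    by (rule that [OF d lg trunc_nonneg [OF d], rotated])
qed

lemma lipschitz_superlevel_compact:
  fixes f :: "'a::euclidean_space \<Rightarrow> real"
  assumes "L-lipschitz_on UNIV f" "\<And>x. f x \<noteq> 0 \<Longrightarrow> norm x \<le> B" "\<delta> > 0"
  shows "compact {x. \<delta> \<le> f x}"
proof -
  have "bounded {x. \<delta> \<le> f x}" using assms(2,3) by (force simp: bounded_iff)
  moreover have "closed {x. \<delta> \<le> f x}"
    by (intro closed_Collect_le continuous_on_const lipschitz_on_continuous_on [OF assms(1)])
  ultimately show ?thesis by (simp add: compact_eq_bounded_closed)
qed

text \<open>The sets where the functions are positive are disjoint but may touch each other and the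
  boundary. After truncation the supports lie in compact superlevel sets at positive distance, and
  mollification at a smaller radius keeps them apart.\<close>

lemma lambda_var_less_lipgrad:
  fixes f :: "nat \<Rightarrow> real^'n::finite \<Rightarrow> real"
  assumes \<Omega>: "open \<Omega>" and p: "p > 1" and k: "k \<ge> 1"
    and fG: "\<And>i. i < k \<Longrightarrow> lipgrad (f i) (G i)" and f0: "\<And>i x. i < k \<Longrightarrow> 0 \<le> f i x"
    and sup: "\<And>i x. i < k \<Longrightarrow> 0 < f i x \<Longrightarrow> x \<in> \<Omega>"
    and disj: "\<And>i j x. i < k \<Longrightarrow> j < k \<Longrightarrow> i \<noteq> j \<Longrightarrow> 0 < f i x \<Longrightarrow> f j x = 0"
    and less: "\<And>i. i < k \<Longrightarrow> (\<integral>x. norm (G i x) powr p \<partial>lborel) < \<mu> * (\<integral>x. \<bar>f i x\<bar> powr p \<partial>lborel)"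
  shows "lambda_var \<Omega> p k < \<mu>"
proof -
  have "\<exists>\<delta> g G'. \<delta> > 0 \<and> lipgrad g G' \<and> (\<forall>x. g x \<noteq> 0 \<longrightarrow> \<delta> \<le> f i x) \<and>
    (\<integral>x. norm (G' x) powr p \<partial>lborel) < \<mu> * (\<integral>x. \<bar>g x\<bar> powr p \<partial>lborel)" if i: "i < k" for i
    by (rule ex_trunc_rayleigh [OF p fG [OF i] f0 [OF i] less [OF i]]) blast
  then obtain \<delta> g G' where \<delta>: "\<And>i. i < k \<Longrightarrow> \<delta> i > 0" and g: "\<And>i. i < k \<Longrightarrow> lipgrad (g i) (G' i)"
    and gf: "\<And>i x. i < k \<Longrightarrow> g i x \<noteq> 0 \<Longrightarrow> \<delta> i \<le> f i x"
    and gless: "\<And>i. i < k \<Longrightarrow> (\<integral>x. norm (G' i x) powr p \<partial>lborel) < \<mu> * (\<integral>x. \<bar>g i x\<bar> powr p \<partial>lborel)"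
    by metis
  define C where "C i = {x. \<delta> i \<le> f i x}" for i
  have C: "compact (C i)" if i: "i < k" for i
  proof -
    obtain L B where L: "L-lipschitz_on UNIV (f i)" "\<And>x. f i x \<noteq> 0 \<Longrightarrow> norm x \<le> B"
      using fG [OF i] unfolding lipgrad_def by blast
    show ?thesis unfolding C_def by (rule lipschitz_superlevel_compact [OF L \<delta> [OF i]])
  qed
  \<comment> \<open>All properties of a mollifying sequence in one predicate, so that sequences can
    be chosen for all i at once.\<close>
  define P where "P i F \<longleftrightarrow> (\<forall>n. smooth (F n)) \<and>
    (\<forall>n x. F n x \<noteq> 0 \<longrightarrow> (\<exists>y. dist x y \<le> inverse (real (Suc n)) \<and> g i y \<noteq> 0)) \<and>
    (\<forall>n. (\<integral>x. norm (grad (F n) x) powr p \<partial>lborel) \<le> (\<integral>x. norm (G' i x) powr p \<partial>lborel)) \<and>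
    (\<lambda>n. \<integral>x. \<bar>F n x\<bar> powr p \<partial>lborel) \<longlonglongrightarrow> (\<integral>x. \<bar>g i x\<bar> powr p \<partial>lborel)"
    for i and F :: "nat \<Rightarrow> real^'n \<Rightarrow> real"
  have "\<exists>F. P i F" if i: "i < k" for i
  proof (rule mollify_sequence [OF p g [OF i]])
    fix F :: "nat \<Rightarrow> real^'n \<Rightarrow> real" assume *: "\<And>n. smooth (F n)"
      "\<And>n x. F n x \<noteq> 0 \<Longrightarrow> \<exists>y. dist x y \<le> inverse (real (Suc n)) \<and> g i y \<noteq> 0"
      "\<And>n. (\<integral>x. norm (grad (F n) x) powr p \<partial>lborel) \<le> (\<integral>x. norm (G' i x) powr p \<partial>lborel)"
      "(\<lambda>n. \<integral>x. \<bar>F n x\<bar> powr p \<partial>lborel) \<longlonglongrightarrow> (\<integral>x. \<bar>g i x\<bar> powr p \<partial>lborel)"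
    have "P i F" unfolding P_def by (intro conjI allI impI *)
    then show "\<exists>F. P i F" by (intro exI [of _ F])
  qed
  then obtain F where PF: "\<And>i. i < k \<Longrightarrow> P i (F i)" by metis
  have F: "smooth (F i n)"
    and Fs: "F i n x \<noteq> 0 \<Longrightarrow> \<exists>y. dist x y \<le> inverse (real (Suc n)) \<and> g i y \<noteq> 0"
    and FE: "(\<integral>x. norm (grad (F i n) x) powr p \<partial>lborel) \<le> (\<integral>x. norm (G' i x) powr p \<partial>lborel)"
    and Fl: "(\<lambda>n. \<integral>x. \<bar>F i n x\<bar> powr p \<partial>lborel) \<longlonglongrightarrow> (\<integral>x. \<bar>g i x\<bar> powr p \<partial>lborel)"
    if "i < k" for i n x
    using PF [OF that] unfolding P_def by blast+
  define e where "e n = inverse (real (Suc n))" for n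
  have e0: "e \<longlonglongrightarrow> 0" unfolding e_def using LIMSEQ_inverse_real_of_nat by simp
  \<comment> \<open>The closed neighbourhood of radius \<open>e n\<close> around the superlevel set,
    which contains the support of the n-th mollification.\<close>
  define K where "K i n = {x + y |x y. x \<in> C i \<and> y \<in> cball 0 (e n)}" for i n
  have Kc: "compact (K i n)" if "i < k" for i n
    unfolding K_def by (rule compact_sums [OF C [OF that] compact_cball])
  have FK: "closure {x. F i n x \<noteq> 0} \<subseteq> K i n" if i: "i < k" for i n
  proof (rule closure_minimal [OF _ compact_imp_closed [OF Kc [OF i]]], rule subsetI)
    fix x assume "x \<in> {x. F i n x \<noteq> 0}"
    then obtain y where y: "dist x y \<le> e n" "g i y \<noteq> 0" using Fs [OF i, of n x] by (auto simp: e_def)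
    have "y \<in> C i" using gf [OF i y(2)] by (simp add: C_def)
    moreover have "x - y \<in> cball 0 (e n)" unfolding mem_cball_0 using y(1) by (simp add: dist_norm)
    moreover have "x = y + (x - y)" by simp
    ultimately show "x \<in> K i n" unfolding K_def by blast
  qed
  have ev1: "\<forall>\<^sub>F n in sequentially. K i n \<subseteq> \<Omega>" if i: "i < k" for i
  proof -
    have "C i \<inter> - \<Omega> = {}" using sup [OF i] \<delta> [OF i] by (force simp: C_def)
    then obtain d where d: "d > 0" "\<forall>x\<in>C i. \<forall>y\<in>-\<Omega>. d \<le> dist x y"
      using separate_compact_closed [OF C [OF i], of "- \<Omega>"] \<Omega> by auto
    have "\<forall>\<^sub>F n in sequentially. e n < d" by (rule order_tendstoD(2) [OF e0 d(1)])
    then show ?thesis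
    proof eventually_elim
      case (elim n)
      show ?case
      proof
        fix z assume "z \<in> K i n"
        then obtain x y where "x \<in> C i" "norm y \<le> e n" "z = x + y" by (auto simp: K_def)
        then show "z \<in> \<Omega>" using d(2) elim by (force simp: dist_norm)
      qed
    qed
  qed
  have ev2: "\<forall>\<^sub>F n in sequentially. i \<noteq> j \<longrightarrow> K i n \<inter> K j n = {}" if i: "i < k" and j: "j < k" for i j
  proof (cases "i = j")
    case False
    have "C i \<inter> C j = {}" using disj [OF i j False] \<delta> [OF i] \<delta> [OF j] by (force simp: C_def)
    then obtain d where d: "d > 0" "\<forall>x\<in>C i. \<forall>y\<in>C j. d \<le> dist x y"
      using separate_compact_closed [OF C [OF i] compact_imp_closed [OF C [OF j]]] by auto
    have "\<forall>\<^sub>F n in sequentially. e n < d / 2" by (rule order_tendstoD(2) [OF e0]) (use d(1) in simp)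
    then show ?thesis
    proof eventually_elim
      case (elim n)
      have False if "z \<in> K i n" "z \<in> K j n" for z
      proof -
        obtain x y x' y' where xy: "x \<in> C i" "norm y \<le> e n" "z = x + y" "x' \<in> C j" "norm y' \<le> e n" "z = x' + y'"
          using \<open>z \<in> K i n\<close> \<open>z \<in> K j n\<close> by (auto simp: K_def)
        then have "x - x' = y' - y" by (metis add_diff_cancel_left' add_diff_eq diff_add_eq diff_diff_eq2 eq_diff_eq)
        then have "dist x x' \<le> norm y' + norm y" using norm_triangle_ineq4 [of y' y] by (simp add: dist_norm)
        moreover have "d \<le> dist x x'" using d(2) xy by blast
        ultimately show False using xy elim by linarith
      qed
      then show ?case by blast
    qed
  qed simp
  have ev3: "\<forall>\<^sub>F n in sequentially. (\<integral>x. norm (grad (F i n) x) powr p \<partial>lborel) < \<mu> * (\<integral>x. \<bar>F i n x\<bar> powr p \<partial>lborel)"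
    if i: "i < k" for i
  proof -
    have "(\<lambda>n. \<mu> * (\<integral>x. \<bar>F i n x\<bar> powr p \<partial>lborel)) \<longlonglongrightarrow> \<mu> * (\<integral>x. \<bar>g i x\<bar> powr p \<partial>lborel)"
      by (intro tendsto_mult tendsto_const Fl i)
    from order_tendstoD(1) [OF this gless [OF i]] show ?thesis
    proof eventually_elim
      case (elim n)
      then show ?case using FE [OF i, of n] by linarith
    qed
  qed
  have "\<forall>\<^sub>F n in sequentially. \<forall>i\<in>{..<k}. K i n \<subseteq> \<Omega> \<and>
     (\<integral>x. norm (grad (F i n) x) powr p \<partial>lborel) < \<mu> * (\<integral>x. \<bar>F i n x\<bar> powr p \<partial>lborel) \<and>
     (\<forall>j\<in>{..<k}. i \<noteq> j \<longrightarrow> K i n \<inter> K j n = {})"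
    by (intro eventually_ball_finite ballI eventually_conj ev1 ev2 ev3) auto
  then obtain n where n: "\<forall>i\<in>{..<k}. K i n \<subseteq> \<Omega> \<and>
     (\<integral>x. norm (grad (F i n) x) powr p \<partial>lborel) < \<mu> * (\<integral>x. \<bar>F i n x\<bar> powr p \<partial>lborel) \<and>
     (\<forall>j\<in>{..<k}. i \<noteq> j \<longrightarrow> K i n \<inter> K j n = {})"
    unfolding eventually_sequentially by blast
  show ?thesis
  proof (rule lambda_var_less [OF \<Omega> p k, of "\<lambda>i. F i n"])
    fix i assume i: "i < k"
    have "compact (closure {x. F i n x \<noteq> 0})"
      using compact_Int_closed [OF Kc [OF i] closed_closure, of n "{x. F i n x \<noteq> 0}"] FK [OF i, of n]
      by (simp add: Int_absorb1)
    moreover have "closure {x. F i n x \<noteq> 0} \<subseteq> \<Omega>"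
      using FK [OF i, of n] n i by (meson lessThan_iff subset_trans)
    ultimately show "F i n \<in> test_fun \<Omega>"
      using F [OF i] unfolding test_fun_def by blast
    show "(\<integral>x. norm (grad (F i n) x) powr p \<partial>lborel) < \<mu> * (\<integral>x. \<bar>F i n x\<bar> powr p \<partial>lborel)"
      using n i by simp
    fix j assume j: "j < k" "i \<noteq> j"
    have "K i n \<inter> K j n = {}" using n i j by simp
    then show "closure {x. F i n x \<noteq> 0} \<inter> closure {x. F j n x \<noteq> 0} = {}"
      using FK [OF i, of n] FK [OF j(1), of n] by blast
  qed
qed

section \<open>Radial competitors\<close>

lemma
  fixes f :: "'a::euclidean_space \<Rightarrow> real"
  assumes f: "f \<in> borel_measurable borel"
  shows integral_lborel_diff: "(\<integral>x. f (x - c) \<partial>lborel) = (\<integral>x. f x \<partial>lborel)"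
    and integrable_lborel_diff: "integrable lborel (\<lambda>x. f (x - c)) \<longleftrightarrow> integrable lborel f"
proof -
  have "(\<integral>x. f x \<partial>distr lborel borel ((+) (- c))) = (\<integral>x. f ((+) (- c) x) \<partial>lborel)"
    by (rule integral_distr) (use f in auto)
  then show "(\<integral>x. f (x - c) \<partial>lborel) = (\<integral>x. f x \<partial>lborel)" by (simp add: lborel_distr_plus)
  have "integrable (distr lborel borel ((+) (- c))) f \<longleftrightarrow> integrable lborel (\<lambda>x. f ((+) (- c) x))"
    by (rule integrable_distr_eq) (use f in auto)
  then show "integrable lborel (\<lambda>x. f (x - c)) \<longleftrightarrow> integrable lborel f" by (simp add: lborel_distr_plus)
qed

lemma AE_not_in_closed_negligible:
  fixes S :: "'a::euclidean_space set"
  assumes "closed S" "negligible S" shows "AE x in lborel. x \<notin> S"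
proof -
  have "S \<in> sets lborel" using assms(1) by simp
  then have "S \<in> null_sets lborel"
    using assms(2) by (simp add: negligible_iff_null_sets null_sets_completion_iff)
  then show ?thesis by (rule AE_not_in)
qed

lemma AE_norm_diff_ne:
  fixes c :: "real^'n::finite"
  shows "AE x in lborel. norm (x - c) \<noteq> s"
proof -
  have "AE x in lborel. x \<notin> sphere c s"
    by (rule AE_not_in_closed_negligible) (auto simp: negligible_sphere)
  then show ?thesis by eventually_elim (simp add: dist_norm norm_minus_commute)
qed

text \<open>Polar coordinates. The image of the Lebesgue measure under \<open>- norm\<close> (rather than \<open>norm\<close>) gives
  finite mass to the rays \<open>{t<..}\<close>.\<close>

lemma distr_minus_norm:
  "distr lborel borel (\<lambda>x::real^'n::finite. - norm x)
   = density lborel (\<lambda>t. ennreal (real CARD('n) * unit_ball_vol (real CARD('n)) * (- t) ^ (CARD('n) - 1) * indicator {..0} t))"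
  (is "?M = density lborel ?d")
proof (rule measure_eqI_lessThan)
  let ?N = "CARD('n)" and ?w = "unit_ball_vol (real CARD('n))"
  have N: "?N > 0" by simp
  have w: "?w \<ge> 0" by simp
  \<comment> \<open>The ray pulls back to the ball of radius -t, which is empty for t \<ge>
    0.\<close>
  have lhs: "emeasure ?M {t<..} = ennreal (?w * (max 0 (- t)) ^ ?N)" for t
  proof -
    have "emeasure ?M {t<..} = emeasure lborel ((\<lambda>x::real^'n. - norm x) -` {t<..})"
      by (subst emeasure_distr) auto
    also have "(\<lambda>x::real^'n. - norm x) -` {t<..} = ball 0 (max 0 (- t))"
      by (auto simp: max_def) (smt (verit) norm_ge_zero)+
    also have "emeasure lborel \<dots> = ennreal (?w * (max 0 (- t)) ^ ?N)"
      by (subst emeasure_ball) auto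
    finally show ?thesis .
  qed
  have rhs: "emeasure (density lborel ?d) {t<..} = ennreal (?w * (max 0 (- t)) ^ ?N)" for t
  proof (cases "t < 0")
    case True
    have "emeasure (density lborel ?d) {t<..} = (\<integral>\<^sup>+s. ?d s * indicator {t<..} s \<partial>lborel)"
      by (subst emeasure_density) auto
    also have "\<dots> = (\<integral>\<^sup>+s. ennreal (real ?N * ?w * (- s) ^ (?N - 1)) * indicator {t..0} s \<partial>lborel)"
    proof (rule nn_integral_cong_AE)
      have "AE s in lborel. s \<noteq> t" by (rule AE_lborel_singleton)
      then show "AE s in lborel. ?d s * indicator {t<..} s = ennreal (real ?N * ?w * (- s) ^ (?N - 1)) * indicator {t..0} s"
        by eventually_elim (auto simp: indicator_def)
    qed
    also have "\<dots> = ennreal ((- (?w * (- 0) ^ ?N)) - (- (?w * (- t) ^ ?N)))"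
    proof (rule nn_integral_FTC_Icc)
      show "((\<lambda>s. - (?w * (- s) ^ ?N)) has_real_derivative real ?N * ?w * (- s) ^ (?N - 1)) (at s)" for s
        by (auto intro!: derivative_eq_intros)
      show "0 \<le> real ?N * ?w * (- s) ^ (?N - 1)" if "s \<in> {t..0}" for s
        using that w by (intro mult_nonneg_nonneg zero_le_power) auto
    qed (use True in auto)
    finally show ?thesis using True N by (simp add: max_def zero_power)
  next
    case False
    have "emeasure (density lborel ?d) {t<..} = (\<integral>\<^sup>+s. ?d s * indicator {t<..} s \<partial>lborel)"
      by (subst emeasure_density) auto
    also have "\<dots> = (\<integral>\<^sup>+s. 0 \<partial>(lborel :: real measure))"
      by (rule nn_integral_cong) (use False in \<open>auto simp: indicator_def\<close>)
    finally show ?thesis using False N by (simp add: max_def)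
  qed
  show "emeasure ?M {t<..} < \<infinity>" for t unfolding lhs by simp
  show "emeasure ?M {t<..} = emeasure (density lborel ?d) {t<..}" for t unfolding lhs rhs ..
qed auto

text \<open>Values at the radii a and b are left free: clamped profiles have a corner there, and the
  density in polar coordinates does not see single radii.\<close>

lemma integral_radial:
  fixes F :: "real \<Rightarrow> real" and c :: "real^'n::finite"
  assumes ab: "0 \<le> a" "a \<le> b" and h: "continuous_on {a..b} h" and Fm: "F \<in> borel_measurable borel"
    and F: "\<And>s. 0 \<le> s \<Longrightarrow> s \<noteq> a \<Longrightarrow> s \<noteq> b \<Longrightarrow> F s = (if a < s \<and> s < b then h s else 0)"
  shows "(\<integral>x. F (norm (x - c)) \<partial>lborel)
     = real CARD('n) * unit_ball_vol (real CARD('n)) * integral {a..b} (\<lambda>s. s ^ (CARD('n) - 1) * h s)"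
proof -
  let ?k = "real CARD('n) * unit_ball_vol (real CARD('n))" and ?n = "CARD('n) - 1"
  let ?g = "\<lambda>t. ?k * (- t) ^ ?n * indicator {..0} t"
  note Fm [measurable]
  have "(\<integral>x. F (norm (x - c)) \<partial>lborel) = (\<integral>x. F (norm (x :: real^'n)) \<partial>lborel)"
    by (rule integral_lborel_diff [of "\<lambda>x. F (norm x)"]) measurable
  also have "\<dots> = (\<integral>t. F (- t) \<partial>distr lborel borel (\<lambda>x::real^'n. - norm x))"
    by (subst integral_distr) auto
  also have "\<dots> = (\<integral>t. ?g t *\<^sub>R F (- t) \<partial>lborel)"
    unfolding distr_minus_norm
    by (rule integral_density) (auto simp: indicator_def intro!: mult_nonneg_nonneg zero_le_power)
  also have "\<dots> = (\<integral>t. ?g (0 - t) *\<^sub>R F (- (0 - t)) \<partial>lborel)"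
    by (rule integral_lborel_reflect [of "\<lambda>t. ?g t *\<^sub>R F (- t)", symmetric]) measurable
  also have "\<dots> = (\<integral>s. ?k * (indicator {a..b} s *\<^sub>R (s ^ ?n * h s)) \<partial>lborel)"
  proof (rule integral_cong_AE)
    show "(\<lambda>s. ?k * (indicator {a..b} s *\<^sub>R (s ^ ?n * h s))) \<in> borel_measurable lborel"
    proof -
      have "(\<lambda>s. indicator {a..b} s *\<^sub>R (s ^ ?n * h s)) \<in> borel_measurable borel"
        by (rule borel_measurable_continuous_on_indicator) (auto intro!: continuous_intros h)
      then show ?thesis by simp
    qed
    have "AE s in lborel. s \<noteq> a" "AE s in lborel. s \<noteq> b" by (rule AE_lborel_singleton)+
    then show "AE s in lborel. ?g (0 - s) *\<^sub>R F (- (0 - s)) = ?k * (indicator {a..b} s *\<^sub>R (s ^ ?n * h s))"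
    proof eventually_elim
      case (elim s)
      show ?case
      proof (cases "0 \<le> s")
        case True
        then show ?thesis using F [OF True elim] elim by (auto simp: indicator_def)
      qed (use ab in \<open>auto simp: indicator_def\<close>)
    qed
  qed measurable
  also have "\<dots> = ?k * (\<integral>s. indicator {a..b} s *\<^sub>R (s ^ ?n * h s) \<partial>lborel)" by simp
  also have "(\<integral>s. indicator {a..b} s *\<^sub>R (s ^ ?n * h s) \<partial>lborel) = integral {a..b} (\<lambda>s. s ^ ?n * h s)"
  proof -
    have "set_integrable lborel {a..b} (\<lambda>s. s ^ ?n * h s)"
      unfolding set_integrable_def using h by (intro borel_integrable_compact continuous_intros) auto
    from set_borel_integral_eq_integral(2) [OF this] show ?thesis
      by (simp add: set_lebesgue_integral_def)
  qed
  finally show ?thesis .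
qed

section \<open>Nodal pieces as functions on space\<close>

text \<open>Extending by the boundary values is the zero extension for a piece between two zeros,
  and the extension by the maximum for the two halves of the last piece. For a = 0 only the outer
  end acts on radii.\<close>

definition clampf :: "(real \<Rightarrow> real) \<Rightarrow> real \<Rightarrow> real \<Rightarrow> real \<Rightarrow> real" where
  "clampf u a b s = u (max a (min b s))"

definition clampf' :: "(real \<Rightarrow> real) \<Rightarrow> real \<Rightarrow> real \<Rightarrow> real \<Rightarrow> real" where
  "clampf' u' a b s = (if a < s \<and> s < b then u' s else 0)"

text \<open>The gradient of a radial function with profile derivative g'; at the origin it is 0
  because \<open>sgn 0 = 0\<close>.\<close>

definition radgrad :: "(real \<Rightarrow> real) \<Rightarrow> real^'n::finite \<Rightarrow> real^'n" where
  "radgrad g' x = g' (norm x) *\<^sub>R sgn x"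

lemma norm_radgrad: "g' 0 = 0 \<Longrightarrow> norm (radgrad g' x) = \<bar>g' (norm x)\<bar>"
  by (cases "x = 0") (auto simp: radgrad_def norm_sgn)

context
  fixes N :: nat and p \<mu> R a b :: real and u u' :: "real \<Rightarrow> real"
  assumes p: "p > 1" and u: "radsol N p \<mu> R u u'" and ab: "0 \<le> a" "a < b" "b \<le> R"
begin

lemma clampf_cont: "continuous_on UNIV (clampf u a b)"
  unfolding clampf_def
  by (intro continuous_on_compose2 [OF radsol_cont [OF p u]] continuous_intros) (use ab in auto)

lemma clampf_lipschitz:
  obtains L where "L \<ge> 0" "\<And>s t. \<bar>clampf u a b s - clampf u a b t\<bar> \<le> L * \<bar>s - t\<bar>" "\<And>s. \<bar>clampf' u' a b s\<bar> \<le> L"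
proof -
  have "compact (u' ` {0..R})" by (intro compact_continuous_image radsol_cont' [OF p u]) simp
  then obtain L where L: "\<forall>s\<in>{0..R}. \<bar>u' s\<bar> \<le> L"
    by (auto simp: bounded_iff dest!: compact_imp_bounded)
  have L0: "L \<ge> 0" using L [rule_format, of 0] ab by fastforce
  have lip: "\<bar>u s - u t\<bar> \<le> L * \<bar>s - t\<bar>" if "s \<in> {0..R}" "t \<in> {0..R}" for s t
    using field_differentiable_bound [of "{0..R}" u u' L s t] radsol_deriv_within [OF p u] L that by simp
  show ?thesis
  proof (rule that [OF L0])
    fix s t
    have "\<bar>clampf u a b s - clampf u a b t\<bar> \<le> L * \<bar>max a (min b s) - max a (min b t)\<bar>"
      unfolding clampf_def by (rule lip) (use ab in auto)
    also have "\<dots> \<le> L * \<bar>s - t\<bar>" using L0 by (intro mult_left_mono) auto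
    finally show "\<bar>clampf u a b s - clampf u a b t\<bar> \<le> L * \<bar>s - t\<bar>" .
    show "\<bar>clampf' u' a b s\<bar> \<le> L" using L L0 ab by (auto simp: clampf'_def)
  qed
qed

lemma clampf_deriv:
  assumes "s \<noteq> a" "s \<noteq> b"
  shows "(clampf u a b has_real_derivative clampf' u' a b s) (at s)"
proof -
  consider "s < a" | "a < s" "s < b" | "b < s" using assms by linarith
  then show ?thesis
  proof cases
    case 1
    have "(clampf u a b has_real_derivative 0) (at s)"
      by (rule has_field_derivative_transform_within_open [OF DERIV_const [of "u a"], of "{..<a}"])
        (use 1 ab in \<open>auto simp: clampf_def max_def min_def\<close>)
    then show ?thesis using 1 by (simp add: clampf'_def)
  next
    case 2
    then have s: "s \<in> {0<..<R}" using ab by auto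
    have "(clampf u a b has_real_derivative u' s) (at s)"
      by (rule has_field_derivative_transform_within_open [OF radsol_deriv [OF p u s], of "{a<..<b}"])
        (use 2 in \<open>auto simp: clampf_def\<close>)
    then show ?thesis using 2 by (simp add: clampf'_def)
  next
    case 3
    have "(clampf u a b has_real_derivative 0) (at s)"
      by (rule has_field_derivative_transform_within_open [OF DERIV_const [of "u b"], of "{b<..}"])
        (use 3 ab in \<open>auto simp: clampf_def max_def min_def\<close>)
    then show ?thesis using 3 by (simp add: clampf'_def)
  qed
qed

lemma clampf'_measurable [measurable]: "clampf' u' a b \<in> borel_measurable borel"
proof -
  have "(\<lambda>s. indicator {a<..<b} s *\<^sub>R u' s) \<in> borel_measurable borel"
    by (intro borel_measurable_continuous_on_indicator continuous_on_subset [OF radsol_cont' [OF p u]])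
      (use ab in auto)
  moreover have "(\<lambda>s. indicator {a<..<b} s *\<^sub>R u' s) = clampf' u' a b"
    by (auto simp: clampf'_def indicator_def fun_eq_iff)
  ultimately show ?thesis by simp
qed

lemma clampf_measurable [measurable]: "clampf u a b \<in> borel_measurable borel"
  by (rule borel_measurable_continuous_onI [OF clampf_cont])

lemma clampf'_0: "clampf' u' a b 0 = 0"
  using ab by (simp add: clampf'_def)

lemma radgrad_measurable [measurable]: "(\<lambda>x. radgrad (clampf' u' a b) (x - c) :: real^'n::finite) \<in> borel_measurable borel"
  unfolding radgrad_def sgn_div_norm by measurable

lemma clampf_norm_has_derivative:
  fixes x c :: "real^'n::finite"
  assumes "x \<noteq> c" "norm (x - c) \<noteq> a" "norm (x - c) \<noteq> b"
  shows "((\<lambda>x. clampf u a b (norm (x - c))) has_derivative (\<lambda>h. radgrad (clampf' u' a b) (x - c) \<bullet> h)) (at x)"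
proof -
  have "((\<lambda>x. x - c) has_derivative (\<lambda>h. h)) (at x)" by (auto intro!: derivative_eq_intros)
  moreover have "(norm has_derivative (\<lambda>h. h \<bullet> sgn (x - c))) (at (x - c))"
    by (rule has_derivative_norm) (use assms in simp)
  ultimately have "((\<lambda>x. norm (x - c)) has_derivative (\<lambda>h. h \<bullet> sgn (x - c))) (at x)"
    by (rule has_derivative_compose)
  moreover have "(clampf u a b has_derivative (\<lambda>h. clampf' u' a b (norm (x - c)) * h)) (at (norm (x - c)))"
    using clampf_deriv [OF assms(2,3)] by (simp add: has_field_derivative_def)
  ultimately have "((\<lambda>x. clampf u a b (norm (x - c))) has_derivative (\<lambda>h. clampf' u' a b (norm (x - c)) * (h \<bullet> sgn (x - c)))) (at x)"
    by (rule has_derivative_compose)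
  then show ?thesis by (simp add: radgrad_def inner_commute)
qed

lemma clampf_norm_lipschitz:
  obtains L where "L-lipschitz_on UNIV (\<lambda>x::real^'n::finite. clampf u a b (norm (x - c)))"
    "\<And>x::real^'n. norm (radgrad (clampf' u' a b) (x - c)) \<le> L"
proof -
  obtain L where L: "L \<ge> 0" "\<And>s t. \<bar>clampf u a b s - clampf u a b t\<bar> \<le> L * \<bar>s - t\<bar>" "\<And>s. \<bar>clampf' u' a b s\<bar> \<le> L"
    using clampf_lipschitz by metis
  show ?thesis
  proof (rule that)
    show "L-lipschitz_on UNIV (\<lambda>x::real^'n. clampf u a b (norm (x - c)))"
    proof (rule lipschitz_onI)
      fix x y :: "real^'n"
      have "\<bar>norm (x - c) - norm (y - c)\<bar> \<le> dist x y"
        using norm_triangle_ineq3 [of "x - c" "y - c"] by (simp add: dist_norm)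
      then have "L * \<bar>norm (x - c) - norm (y - c)\<bar> \<le> L * dist x y" using L(1) by (rule mult_left_mono)
      with L(2) [of "norm (x - c)" "norm (y - c)"]
      show "dist (clampf u a b (norm (x - c))) (clampf u a b (norm (y - c))) \<le> L * dist x y"
        by (simp add: dist_real_def)
    qed (rule L(1))
    show "norm (radgrad (clampf' u' a b) (x - c)) \<le> L" for x :: "real^'n"
      using L(3) by (simp add: norm_radgrad clampf'_0)
  qed
qed

text \<open>Testing the equation with \<open>u\<close> itself: \<open>r ^ (N - 1) * phi_p p (u' r) * u r\<close> vanishes at both ends.\<close>

lemma nodal_energy_identity:
  assumes ub: "u b = 0" and ua: "a = 0 \<or> u a = 0"
  shows "integral {a..b} (\<lambda>s. s ^ (N - 1) * \<bar>u' s\<bar> powr p) = \<mu> * integral {a..b} (\<lambda>s. s ^ (N - 1) * \<bar>u s\<bar> powr p)"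
proof -
  define F where "F r = r ^ (N - 1) * phi_p p (u' r) * u r" for r
  have sub: "{a..b} \<subseteq> {0..R}" using ab by auto
  have cu: "continuous_on {a..b} u" "continuous_on {a..b} u'"
    using continuous_on_subset [OF radsol_cont [OF p u] sub] continuous_on_subset [OF radsol_cont' [OF p u] sub] by auto
  have i1: "(\<lambda>s. s ^ (N - 1) * \<bar>u' s\<bar> powr p) integrable_on {a..b}"
    using cu p by (intro integrable_continuous_interval continuous_intros continuous_on_powr') auto
  have i2: "(\<lambda>s. \<mu> * (s ^ (N - 1) * \<bar>u s\<bar> powr p)) integrable_on {a..b}"
    using cu p by (intro integrable_continuous_interval continuous_intros continuous_on_powr') auto
  have "((\<lambda>s. s ^ (N - 1) * \<bar>u' s\<bar> powr p - \<mu> * (s ^ (N - 1) * \<bar>u s\<bar> powr p)) has_integral F b - F a) {a..b}"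
  proof (rule fundamental_theorem_of_calculus_interior)
    show "continuous_on {a..b} F"
      unfolding F_def using cu by (intro continuous_intros continuous_on_phi_p p)
    fix r assume "r \<in> {a<..<b}"
    then have r: "r \<in> {0<..<R}" using ab by auto
    have "(F has_real_derivative (- \<mu> * r ^ (N - 1) * phi_p p (u r)) * u r + u' r * (r ^ (N - 1) * phi_p p (u' r))) (at r)"
      unfolding F_def by (intro DERIV_mult radsol_flux_deriv [OF p u r] radsol_deriv [OF p u r])
    then have "(F has_real_derivative r ^ (N - 1) * \<bar>u' r\<bar> powr p - \<mu> * (r ^ (N - 1) * \<bar>u r\<bar> powr p)) (at r)"
      by (rule DERIV_cong) (simp add: phi_p_times_self [OF p, symmetric] algebra_simps)
    then show "(F has_vector_derivative r ^ (N - 1) * \<bar>u' r\<bar> powr p - \<mu> * (r ^ (N - 1) * \<bar>u r\<bar> powr p)) (at r)"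
      by (simp add: has_real_derivative_iff_has_vector_derivative)
  qed (use ab in simp)
  moreover have "F b = 0" using ub by (simp add: F_def)
  moreover have "F a = 0" using ua radsol_deriv0 [OF p u] by (auto simp: F_def)
  ultimately have "integral {a..b} (\<lambda>s. s ^ (N - 1) * \<bar>u' s\<bar> powr p - \<mu> * (s ^ (N - 1) * \<bar>u s\<bar> powr p)) = 0"
    by (simp add: integral_unique)
  then show ?thesis
    using Henstock_Kurzweil_Integration.integral_diff [OF i1 i2] by simp
qed

text \<open>In polar coordinates \<open>nodal_energy_identity\<close> says that the zero extension
  of one nodal interval has Rayleigh quotient exactly \<mu>. The centre c is free since the
  integrals are translation invariant.\<close>

lemma nodal_piece:
  fixes c :: "real^'n::finite"
  assumes N: "N = CARD('n)" and pos: "\<And>s. a < s \<Longrightarrow> s < b \<Longrightarrow> 0 < u s"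
    and ub: "u b = 0" and ua: "a = 0 \<or> u a = 0"
  defines "f \<equiv> \<lambda>x. clampf u a b (norm (x - c))" and "G \<equiv> \<lambda>x. radgrad (clampf' u' a b) (x - c)"
  shows "lipgrad f G" and "0 \<le> f x" and "0 < f x \<Longrightarrow> norm (x - c) < b \<and> (0 < a \<longrightarrow> a < norm (x - c))"
    and "(\<integral>x. norm (G x) powr p \<partial>lborel) = \<mu> * (\<integral>x. \<bar>f x\<bar> powr p \<partial>lborel)"
    and "0 < (\<integral>x. \<bar>f x\<bar> powr p \<partial>lborel)"
proof -
  \<comment> \<open>For a = 0 the value u a is not prescribed; its sign follows by continuity from
    the right.\<close>
  have ua0: "u a \<ge> 0"
  proof (rule ccontr)
    assume "\<not> u a \<ge> 0"
    then have neg: "u a < 0" by simp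
    have "continuous_on {a..b} u" by (rule continuous_on_subset [OF radsol_cont [OF p u]]) (use ab in auto)
    then have "(u \<longlongrightarrow> u a) (at_right a)"
      using ab by (simp add: continuous_on_Icc_at_rightD)
    then have "eventually (\<lambda>s. u s < 0) (at_right a)" using neg by (rule order_tendstoD)
    moreover have "eventually (\<lambda>s. 0 < u s) (at_right a)"
      using eventually_at_right_less [of a] eventually_at_rightI [of a b "\<lambda>s. 0 < u s"] pos ab by auto
    ultimately have "eventually (\<lambda>s. False) (at_right a)" by eventually_elim simp
    then show False by (simp add: eventually_False trivial_limit_at_right_real)
  qed
  have u0: "u s \<ge> 0" if "s \<in> {a..b}" for s
    using pos [of s] ua0 ub that by (cases "s = a \<or> s = b") (auto intro: less_imp_le)
  show f0: "0 \<le> f x" for x unfolding f_def clampf_def by (rule u0) (use ab in auto)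
  show fp: "norm (x - c) < b \<and> (0 < a \<longrightarrow> a < norm (x - c))" if "0 < f x" for x
  proof (intro conjI impI; rule ccontr)
    assume "\<not> norm (x - c) < b"
    then have "f x = u b" using ab by (simp add: f_def clampf_def min_def max_def)
    then show False using that ub by simp
  next
    assume "0 < a" "\<not> a < norm (x - c)"
    then have "f x = u a" using ab by (simp add: f_def clampf_def min_def max_def)
    then show False using that ua \<open>0 < a\<close> by simp
  qed
  obtain L where "L-lipschitz_on UNIV (\<lambda>x. clampf u a b (norm (x - c)))"
    "\<And>x. norm (radgrad (clampf' u' a b) (x - c)) \<le> L"
    by (rule clampf_norm_lipschitz [of c]) (rule that)
  then have L: "L-lipschitz_on UNIV f" "\<And>x. norm (G x) \<le> L"
    by (simp_all only: f_def G_def)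
  have supp: "norm x \<le> b + norm c" if "f x \<noteq> 0 \<or> G x \<noteq> 0" for x
  proof -
    have "norm (x - c) < b"
    proof (cases "f x = 0")
      case True
      then show ?thesis using that by (auto simp: G_def radgrad_def clampf'_def split: if_splits)
    next
      case False
      then show ?thesis using fp [of x] f0 [of x] by simp
    qed
    then show ?thesis using norm_triangle_sub [of x c] by simp
  qed
  have Gm: "G \<in> borel_measurable borel" unfolding G_def by measurable
  have diff: "AE x in lborel. (f has_derivative (\<lambda>h. G x \<bullet> h)) (at x)"
    using AE_norm_diff_ne [of c a] AE_norm_diff_ne [of c b] AE_norm_diff_ne [of c 0]
  proof eventually_elim
    case (elim x)
    then show ?case unfolding f_def G_def by (intro clampf_norm_has_derivative) auto
  qed
  show lg: "lipgrad f G"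
    unfolding lipgrad_def using L supp Gm diff by blast
  let ?k = "real CARD('n) * unit_ball_vol (real CARD('n))"
  have sub: "{a..b} \<subseteq> {0..R}" using ab by auto
  have cu: "continuous_on {a..b} u" "continuous_on {a..b} u'"
    using continuous_on_subset [OF radsol_cont [OF p u] sub] continuous_on_subset [OF radsol_cont' [OF p u] sub] by auto
  have "(\<integral>x. norm (G x) powr p \<partial>lborel) = (\<integral>x. \<bar>clampf' u' a b (norm (x - c))\<bar> powr p \<partial>lborel)"
    by (simp add: G_def norm_radgrad clampf'_0)
  also have "\<dots> = ?k * integral {a..b} (\<lambda>s. s ^ (CARD('n) - 1) * \<bar>u' s\<bar> powr p)"
  proof (rule integral_radial [where F = "\<lambda>s. \<bar>clampf' u' a b s\<bar> powr p"])
    show "continuous_on {a..b} (\<lambda>s. \<bar>u' s\<bar> powr p)"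
      using cu p by (intro continuous_intros continuous_on_powr') auto
    show "(\<lambda>s. \<bar>clampf' u' a b s\<bar> powr p) \<in> borel_measurable borel" by measurable
  qed (use ab in \<open>auto simp: clampf'_def\<close>)
  also have "\<dots> = \<mu> * (?k * integral {a..b} (\<lambda>s. s ^ (CARD('n) - 1) * \<bar>u s\<bar> powr p))"
    using nodal_energy_identity [OF ub ua] by (simp add: N)
  also have "?k * integral {a..b} (\<lambda>s. s ^ (CARD('n) - 1) * \<bar>u s\<bar> powr p)
      = (\<integral>x. \<bar>clampf u a b (norm (x - c))\<bar> powr p \<partial>lborel)"
  proof (rule integral_radial [where F = "\<lambda>s. \<bar>clampf u a b s\<bar> powr p", symmetric])
    show "continuous_on {a..b} (\<lambda>s. \<bar>u s\<bar> powr p)"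
      using cu p by (intro continuous_intros continuous_on_powr') auto
  next
    fix s :: real assume s: "0 \<le> s" "s \<noteq> a" "s \<noteq> b"
    consider "s < a" | "a < s" "s < b" | "b < s" using s by linarith
    then show "\<bar>clampf u a b s\<bar> powr p = (if a < s \<and> s < b then \<bar>u s\<bar> powr p else 0)"
      by cases (use ua ub ab s p in \<open>auto simp: clampf_def min_def max_def\<close>)
  qed (use ab in auto)
  finally show "(\<integral>x. norm (G x) powr p \<partial>lborel) = \<mu> * (\<integral>x. \<bar>f x\<bar> powr p \<partial>lborel)"
    by (simp add: f_def)
  obtain e :: "real^'n" where e: "norm e = 1" using norm_axis_1 by blast
  show "0 < (\<integral>x. \<bar>f x\<bar> powr p \<partial>lborel)"
  proof (rule integral_pos_continuous)
    show "continuous_on UNIV (\<lambda>x. \<bar>f x\<bar> powr p)"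
      using p by (intro continuous_intros continuous_on_powr' lipschitz_on_continuous_on [OF L(1)]) auto
    show "integrable lborel (\<lambda>x. \<bar>f x\<bar> powr p)" by (rule lipgrad_integrable(2) [OF p lg])
    let ?s = "(a + b) / 2"
    have "norm (c + ?s *\<^sub>R e - c) = ?s" using e ab by simp
    then have "f (c + ?s *\<^sub>R e) = u ?s" unfolding f_def clampf_def using ab by (simp add: min_def max_def)
    moreover have "0 < u ?s" using ab by (intro pos) auto
    ultimately show "\<bar>f (c + ?s *\<^sub>R e)\<bar> powr p \<noteq> 0" by simp
  qed simp
qed

end

section \<open>The competitor for the outermost nodal interval\<close>

text \<open>Where the values differ, the minimum locally is one of the functions. At a tie the
  derivatives agree, and the remainder of the minimum is at each point one of the two
  remainders.\<close>

lemma has_derivative_min: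
  fixes f g :: "'a::real_normed_vector \<Rightarrow> real"
  assumes f: "(f has_derivative f') (at x)" and g: "(g has_derivative g') (at x)"
    and eq: "f x = g x \<Longrightarrow> f' = g'"
  shows "((\<lambda>x. min (f x) (g x)) has_derivative (if f x < g x then f' else g')) (at x)"
proof -
  have cf: "(f \<longlongrightarrow> f x) (at x)" and cg: "(g \<longlongrightarrow> g x) (at x)"
    using has_derivative_continuous [OF f] has_derivative_continuous [OF g] by (auto simp: continuous_within)
  consider "f x < g x" | "g x < f x" | "f x = g x" by linarith
  then show ?thesis
  proof cases
    case 1
    have "eventually (\<lambda>y. 0 < g y - f y) (at x)"
      by (rule order_tendstoD(1) [OF tendsto_diff [OF cg cf]]) (use 1 in simp)
    then have "eventually (\<lambda>y. f y = min (f y) (g y)) (at x)" by eventually_elim simp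
    from has_derivative_transform_eventually [OF f this] 1 show ?thesis by simp
  next
    case 2
    have "eventually (\<lambda>y. 0 < f y - g y) (at x)"
      by (rule order_tendstoD(1) [OF tendsto_diff [OF cf cg]]) (use 2 in simp)
    then have "eventually (\<lambda>y. g y = min (f y) (g y)) (at x)" by eventually_elim simp
    from has_derivative_transform_eventually [OF g this] 2 show ?thesis by simp
  next
    case 3
    have fg: "(f has_derivative g') (at x)" using f eq [OF 3] by simp
    let ?R = "\<lambda>h y. norm (h y - h x - g' (y - x)) / norm (y - x)"
    have Rf: "(?R f \<longlongrightarrow> 0) (at x)" and Rg: "(?R g \<longlongrightarrow> 0) (at x)"
      using fg g by (simp_all add: has_derivative_iff_norm)
    have "(?R (\<lambda>y. min (f y) (g y)) \<longlongrightarrow> 0) (at x)"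
    proof (rule Lim_null_comparison)
      show "\<forall>\<^sub>F y in at x. norm (?R (\<lambda>y. min (f y) (g y)) y) \<le> ?R f y + ?R g y"
      proof (rule always_eventually, rule allI)
        fix y
        have "?R (\<lambda>y. min (f y) (g y)) y = ?R f y \<or> ?R (\<lambda>y. min (f y) (g y)) y = ?R g y"
          using 3 by (cases "f y \<le> g y") (simp_all add: min_def)
        moreover have "0 \<le> ?R f y" "0 \<le> ?R g y" by simp_all
        moreover have "norm (?R (\<lambda>y. min (f y) (g y)) y) = ?R (\<lambda>y. min (f y) (g y)) y" by simp
        ultimately show "norm (?R (\<lambda>y. min (f y) (g y)) y) \<le> ?R f y + ?R g y" by linarith
      qed
      show "((\<lambda>y. ?R f y + ?R g y) \<longlongrightarrow> 0) (at x)" by (rule tendsto_add_zero [OF Rf Rg])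
    qed
    then show ?thesis using g 3 by (simp add: has_derivative_iff_norm)
  qed
qed


context
  fixes N :: nat and p \<mu> r :: real and v v' :: "real \<Rightarrow> real"
  assumes p: "p > 1" and v: "radsol N p \<mu> 1 v v'" and mu: "\<mu> > 0" and r: "0 < r" "r < 1"
    and pos: "\<And>s. r < s \<Longrightarrow> s < 1 \<Longrightarrow> 0 < v s" and vr: "v r = 0" and v1: "v 1 = 0"
begin

text \<open>While v is positive its flux decreases strictly, so v' changes sign exactly once, at the
  critical point that Rolle's theorem provides between the two zeros.\<close>

lemma unimodal:
  obtains \<rho> where "r < \<rho>" "\<rho> < 1" "v' \<rho> = 0" "\<And>s t. r \<le> s \<Longrightarrow> s < t \<Longrightarrow> t \<le> \<rho> \<Longrightarrow> v s < v t"
    "\<And>s t. \<rho> \<le> s \<Longrightarrow> s < t \<Longrightarrow> t \<le> 1 \<Longrightarrow> v t < v s"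
proof -
  define Y where "Y s = s ^ (N - 1) * phi_p p (v' s)" for s
  have cv: "continuous_on {a..b} v" "continuous_on {a..b} v'" if "0 \<le> a" "b \<le> 1" for a b
    using continuous_on_subset [OF radsol_cont [OF p v]] continuous_on_subset [OF radsol_cont' [OF p v]] that by auto
  have dv: "(v has_real_derivative v' s) (at s)" if "r < s" "s < 1" for s
    by (rule radsol_deriv [OF p v]) (use that r in auto)
  have Ydec: "Y t < Y s" if "r < s" "s < t" "t < 1" for s t
  proof (rule DERIV_neg_imp_decreasing [OF that(2)])
    fix x assume x: "s \<le> x" "x \<le> t"
    have "0 < \<mu> * x ^ (N - 1) * phi_p p (v x)"
      using mu x that r pos [of x] by (intro mult_pos_pos) auto
    moreover have "(Y has_real_derivative - \<mu> * x ^ (N - 1) * phi_p p (v x)) (at x)"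
      unfolding Y_def by (rule radsol_flux_deriv [OF p v]) (use x that r in auto)
    ultimately show "\<exists>y. (Y has_real_derivative y) (at x) \<and> y < 0"
      by (intro exI [of _ "- \<mu> * x ^ (N - 1) * phi_p p (v x)"]) auto
  qed
  have "\<exists>z>r. z < 1 \<and> (\<forall>f'. (v has_real_derivative f') (at z) \<longrightarrow> f' = 0)"
  proof -
    have "\<exists>l z. r < z \<and> z < 1 \<and> (v has_real_derivative l) (at z) \<and> v 1 - v r = (1 - r) * l"
    proof (rule MVT [OF r(2) cv(1)])
      show "v differentiable (at x)" if "r < x" "x < 1" for x
        using dv [OF that] by (auto simp: real_differentiable_def)
    qed (use r in auto)
    then obtain l z where z: "r < z" "z < 1" "(v has_real_derivative l) (at z)" "v 1 - v r = (1 - r) * l" by blast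
    then have "l = 0" using vr v1 r by simp
    then show ?thesis using z DERIV_unique by blast
  qed
  then obtain \<rho> where rho: "r < \<rho>" "\<rho> < 1" "v' \<rho> = 0" using dv by blast
  have Y0: "Y \<rho> = 0" by (simp add: Y_def rho)
  have inc: "0 < v' s" if "r < s" "s < \<rho>" for s
    using Ydec [of s \<rho>] that rho Y0 r by (auto simp: Y_def zero_less_mult_iff)
  have dec: "v' s < 0" if "\<rho> < s" "s < 1" for s
    using Ydec [of \<rho> s] that rho Y0 r by (auto simp: Y_def mult_less_0_iff)
  show ?thesis
  proof (rule that [OF rho])
    fix s t assume st: "r \<le> s" "s < t" "t \<le> \<rho>"
    show "v s < v t"
    proof (rule DERIV_pos_imp_increasing_open [OF st(2)])
      show "continuous_on {s..t} v" by (rule cv(1)) (use st r rho in auto)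
      fix x assume x: "s < x" "x < t"
      show "\<exists>y. (v has_real_derivative y) (at x) \<and> 0 < y"
        by (intro exI [of _ "v' x"] conjI dv inc) (use x st rho in auto)
    qed
  next
    fix s t assume st: "\<rho> \<le> s" "s < t" "t \<le> 1"
    have "- v s < - v t"
    proof (rule DERIV_pos_imp_increasing_open [OF st(2)])
      show "continuous_on {s..t} (\<lambda>x. - v x)" by (intro continuous_intros cv(1)) (use st r rho in auto)
      fix x assume x: "s < x" "x < t"
      have "((\<lambda>x. - v x) has_real_derivative - v' x) (at x)" by (intro DERIV_minus dv) (use x st rho in auto)
      moreover have "0 < - v' x" using dec [of x] x st by simp
      ultimately show "\<exists>y. ((\<lambda>x. - v x) has_real_derivative y) (at x) \<and> 0 < y" by blast
    qed
    then show "v t < v s" by simp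
  qed
qed

text \<open>Cut \<open>v\<close> at its maximum point \<open>\<rho>\<close> into an increasing part, centred at \<open>c\<close>, and a decreasing
  part, centred at \<open>0\<close>. Compared with \<open>c = 0\<close>, the minimum of the two parts has no more energy,
  and it has larger norm because both parts are below the maximum on an overlap of positive measure.\<close>

lemma outer_competitor:
  assumes N: "N = CARD('n::finite)"
  obtains f :: "real^'n \<Rightarrow> real" and G c where "lipgrad f G" "\<And>x. 0 \<le> f x"
    "\<And>x. 0 < f x \<Longrightarrow> norm x < 1 \<and> r < norm (x - c)" "norm c + r < 1"
    "(\<integral>x. norm (G x) powr p \<partial>lborel) < \<mu> * (\<integral>x. \<bar>f x\<bar> powr p \<partial>lborel)"
proof -
  obtain \<rho> where rho: "r < \<rho>" "\<rho> < 1" "v' \<rho> = 0"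
    and inc: "\<And>s t. r \<le> s \<Longrightarrow> s < t \<Longrightarrow> t \<le> \<rho> \<Longrightarrow> v s < v t"
    and dec: "\<And>s t. \<rho> \<le> s \<Longrightarrow> s < t \<Longrightarrow> t \<le> 1 \<Longrightarrow> v t < v s"
    by (rule unimodal) (rule that)
  define M where "M = v \<rho>"
  have M: "M > 0" unfolding M_def by (rule pos) (use rho in auto)
  \<comment> \<open>The displacement of the centre: t < 1 - r keeps the moved ball of radius r
    inside the unit ball, and t < \<rho> makes the outward direction from 0 also lead away from c at
    radii from \<rho> on.\<close>
  define t where "t = min (1 - r) \<rho> / 2"
  have t: "0 < t" "t < \<rho>" "t + r < 1" using r rho by (auto simp: t_def min_def field_simps)
  obtain e :: "real^'n" where e: "norm e = 1" using norm_axis_1 by blast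
  define c where "c = t *\<^sub>R e"
  have nc: "norm c = t" using e t by (simp add: c_def)
  let ?V1 = "clampf v r \<rho>" and ?V2 = "clampf v \<rho> 1" and ?V0 = "clampf v r 1"
  let ?D1 = "clampf' v' r \<rho>" and ?D2 = "clampf' v' \<rho> 1" and ?D0 = "clampf' v' r 1"
  have ab1: "0 \<le> r" "r < \<rho>" "\<rho> \<le> 1" and ab2: "0 \<le> \<rho>" "\<rho> < 1" "(1::real) \<le> 1" and ab0: "0 \<le> r" "r < 1" "(1::real) \<le> 1"
    using r rho by auto
  have V1: "0 \<le> ?V1 s" "?V1 s \<le> M" "s < \<rho> \<Longrightarrow> ?V1 s < M" "\<rho> \<le> s \<Longrightarrow> ?V1 s = M" "s \<le> r \<Longrightarrow> ?V1 s = 0" "r < s \<Longrightarrow> 0 < ?V1 s" for s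
  proof -
    have le: "v x \<le> v y" if "r \<le> x" "x \<le> y" "y \<le> \<rho>" for x y using inc [of x y] that by (cases "x = y") auto
    show "0 \<le> ?V1 s" unfolding clampf_def vr [symmetric] by (rule le) (use rho in auto)
    show "?V1 s \<le> M" unfolding clampf_def M_def by (rule le) (use rho in auto)
    show "?V1 s < M" if "s < \<rho>" unfolding clampf_def M_def by (rule inc) (use rho that in auto)
    show "?V1 s = M" if "\<rho> \<le> s" using that rho by (simp add: clampf_def M_def)
    show "?V1 s = 0" if "s \<le> r" using that rho vr by (simp add: clampf_def max_def min_def)
    show "0 < ?V1 s" if "r < s" unfolding clampf_def vr [symmetric] by (rule inc) (use rho that in auto)
  qed
  have V2: "0 \<le> ?V2 s" "?V2 s \<le> M" "\<rho> < s \<Longrightarrow> ?V2 s < M" "s \<le> \<rho> \<Longrightarrow> ?V2 s = M" "1 \<le> s \<Longrightarrow> ?V2 s = 0" "s < 1 \<Longrightarrow> 0 < ?V2 s" for s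
  proof -
    have le: "v y \<le> v x" if "\<rho> \<le> x" "x \<le> y" "y \<le> 1" for x y using dec [of x y] that by (cases "x = y") auto
    show "0 \<le> ?V2 s" unfolding clampf_def v1 [symmetric] by (rule le) (use rho in auto)
    show "?V2 s \<le> M" unfolding clampf_def M_def by (rule le) (use rho in auto)
    show "?V2 s < M" if "\<rho> < s" unfolding clampf_def M_def by (rule dec) (use rho that in auto)
    show "?V2 s = M" if "s \<le> \<rho>" using that rho by (simp add: clampf_def M_def max_def min_def)
    show "?V2 s = 0" if "1 \<le> s" using that rho v1 by (simp add: clampf_def max_def min_def)
    show "0 < ?V2 s" if "s < 1" unfolding clampf_def v1 [symmetric] by (rule dec) (use rho that in auto)
  qed
  define A where "A x = ?V1 (norm (x - c))" for x :: "real^'n"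
  define B where "B x = ?V2 (norm x)" for x :: "real^'n"
  define A0 where "A0 x = ?V1 (norm x)" for x :: "real^'n"
  define f0 where "f0 x = ?V0 (norm x)" for x :: "real^'n"
  define f where "f x = min (A x) (B x)" for x
  define GA where "GA x = radgrad ?D1 (x - c)" for x :: "real^'n"
  define GB where "GB x = radgrad ?D2 x" for x :: "real^'n"
  \<comment> \<open>Almost everywhere the choice at ties is immaterial, because both gradients
    vanish there by \<open>eq0\<close>.\<close>
  define G where "G x = (if A x < B x then GA x else GB x)" for x
  have A01: "0 \<le> A x" "A x \<le> M" and B01: "0 \<le> B x" "B x \<le> M" for x
    by (simp_all add: A_def B_def V1 V2)
  show ?thesis
  proof (rule that [of f G c])
    show f0le: "0 \<le> f x" for x by (simp add: f_def A01 B01)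
    show fpos: "norm x < 1 \<and> r < norm (x - c)" if "0 < f x" for x
      using that V1(5) [of "norm (x - c)"] V2(5) [of "norm x"] by (auto simp: f_def A_def B_def not_less intro: leI)
    show "norm c + r < 1" using t nc by simp
    obtain L1 where L1: "L1-lipschitz_on UNIV A" "\<And>x. norm (GA x) \<le> L1"
    proof -
      obtain L where "L-lipschitz_on UNIV (\<lambda>x::real^'n. ?V1 (norm (x - c)))" "\<And>x::real^'n. norm (radgrad ?D1 (x - c)) \<le> L"
        by (rule clampf_norm_lipschitz [OF p v ab1, of c]) (rule that)
      then show ?thesis using that [of L] by (simp add: A_def [abs_def] GA_def)
    qed
    obtain L2 where L2: "L2-lipschitz_on UNIV B" "\<And>x. norm (GB x) \<le> L2"
    proof -
      obtain L where "L-lipschitz_on UNIV (\<lambda>x::real^'n. ?V2 (norm (x - 0)))" "\<And>x::real^'n. norm (radgrad ?D2 (x - 0)) \<le> L"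
        by (rule clampf_norm_lipschitz [OF p v ab2, of 0]) (rule that)
      then show ?thesis using that [of L] by (simp add: B_def [abs_def] GB_def)
    qed
    have Ac: "continuous_on UNIV A" and Bc: "continuous_on UNIV B"
      by (rule lipschitz_on_continuous_on [OF L1(1)], rule lipschitz_on_continuous_on [OF L2(1)])
    have GAm [measurable]: "GA \<in> borel_measurable borel"
      using radgrad_measurable [OF p v ab1, of c] by (simp add: GA_def [abs_def])
    have GBm [measurable]: "GB \<in> borel_measurable borel"
      using radgrad_measurable [OF p v ab2, of 0] by (simp add: GB_def [abs_def])
    have [measurable]: "A \<in> borel_measurable borel" "B \<in> borel_measurable borel"
      using Ac Bc by (auto intro: borel_measurable_continuous_onI)
    \<comment> \<open>Ties inside the overlap of the two shells are the only ones, up to null sets,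
      at which the gradients may differ. They form a null set as well.\<close>
    define S where "S = {x :: real^'n. \<rho> \<le> norm x \<and> norm x \<le> 1 \<and> norm (x - c) \<le> \<rho> \<and> A x = B x}"
    have "closed S"
      unfolding S_def
      by (intro closed_Collect_conj closed_Collect_le closed_Collect_eq continuous_intros Ac Bc)
    moreover have "negligible S"
    proof (rule starlike_negligible [of S 0, OF \<open>closed S\<close>])
      \<comment> \<open>Moving outward along a ray from 0, B decreases strictly and A does not
        decrease, so the ray meets S at most once. This is the hypothesis of
        \<open>starlike_negligible\<close>.\<close>
      have key: False if x: "x \<in> S" and k: "1 < k" and kx: "k *\<^sub>R x \<in> S" for k and x :: "real^'n"
      proof -
        have nx: "\<rho> \<le> norm x" "norm x \<le> 1" "norm (x - c) \<le> \<rho>" "A x = B x" using x by (auto simp: S_def)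
        have nkx: "norm (k *\<^sub>R x) \<le> 1" "norm (k *\<^sub>R x - c) \<le> \<rho>" "A (k *\<^sub>R x) = B (k *\<^sub>R x)" using kx by (auto simp: S_def)
        have "norm x > 0" using nx rho r by linarith
        then have "norm x < norm (k *\<^sub>R x)" using k by simp
        then have "v (norm (k *\<^sub>R x)) < v (norm x)" using nx nkx by (intro dec) auto
        moreover have "B x = v (norm x)" using nx by (simp add: B_def clampf_def)
        moreover have "B (k *\<^sub>R x) = v (norm (k *\<^sub>R x))"
          using nx nkx \<open>norm x < norm (k *\<^sub>R x)\<close> by (simp only: B_def clampf_def max_def min_def) auto
        ultimately have Blt: "B (k *\<^sub>R x) < B x" by simp
        \<comment> \<open>The square of \<open>norm (k *\<^sub>R x - c)\<close> does not decrease
          from its value at k = 1, since x \<bullet> c \<le> x \<bullet> x; this is where t < \<rho>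
          is used.\<close>
        have "x \<bullet> c \<le> norm x * t" using norm_cauchy_schwarz [of x c] nc by simp
        also have "\<dots> \<le> norm x * norm x" using nx t by (intro mult_left_mono) auto
        finally have xc: "x \<bullet> c \<le> x \<bullet> x" by (simp add: power2_norm_eq_inner [symmetric] power2_eq_square)
        have "(k *\<^sub>R x - c) \<bullet> (k *\<^sub>R x - c) - (x - c) \<bullet> (x - c) = (k - 1) * ((k + 1) * (x \<bullet> x) - 2 * (x \<bullet> c))"
          by (simp add: inner_diff_left inner_diff_right inner_commute algebra_simps)
        moreover have "0 \<le> (k + 1) * (x \<bullet> x) - 2 * (x \<bullet> c)"
          using xc mult_right_mono [of 2 "k + 1" "x \<bullet> x"] k by simp
        ultimately have "(x - c) \<bullet> (x - c) \<le> (k *\<^sub>R x - c) \<bullet> (k *\<^sub>R x - c)"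
          using k by (smt (verit) mult_nonneg_nonneg)
        then have le: "norm (x - c) \<le> norm (k *\<^sub>R x - c)" by (simp add: norm_le)
        have Av: "A y = v (max r (norm (y - c)))" if "norm (y - c) \<le> \<rho>" for y
          using that by (simp add: A_def clampf_def min_absorb2)
        have "A x \<le> A (k *\<^sub>R x)"
          unfolding Av [OF nx(3)] Av [OF nkx(2)]
        proof (cases "max r (norm (x - c)) = max r (norm (k *\<^sub>R x - c))")
          case True
          then show "v (max r (norm (x - c))) \<le> v (max r (norm (k *\<^sub>R x - c)))" by simp
        next
          case False
          then have "v (max r (norm (x - c))) < v (max r (norm (k *\<^sub>R x - c)))"
            using le nx nkx rho by (intro inc) (auto simp: max_def split: if_splits)
          then show "v (max r (norm (x - c))) \<le> v (max r (norm (k *\<^sub>R x - c)))" by simp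
        qed
        then show False using Blt nx nkx by simp
      qed
      fix k and x :: "real^'n" assume k: "0 + k *\<^sub>R x \<in> S" "0 \<le> k" "0 + x \<in> S"
      show "k = 1"
      proof (rule ccontr)
        assume "k \<noteq> 1"
        then consider "1 < k" | "k < 1" by linarith
        then show False
        proof cases
          case 1
          then show False using key [of x k] k by simp
        next
          case 2
          have "k \<noteq> 0"
          proof
            assume "k = 0"
            then have "(0 :: real^'n) \<in> S" using k by simp
            then show False using rho r by (simp add: S_def)
          qed
          then show False using key [of "k *\<^sub>R x" "1 / k"] k 2 by simp
        qed
      qed
    qed
    ultimately have AES: "AE x in lborel. x \<notin> S" by (rule AE_not_in_closed_negligible)
    \<comment> \<open>Inside radius \<rho> a tie means A = B = M, where both gradients vanish.
      Between \<rho> and 1, off S, a tie would give A = M > B. Beyond 1 it would put x into the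
      moved ball of radius r, which lies in the unit ball.\<close>
    have eq0: "GA x = 0 \<and> GB x = 0"
      if x: "x \<notin> S" "norm (x - c) \<noteq> r" "norm (x - c) \<noteq> \<rho>" "norm x \<noteq> \<rho>" "norm x \<noteq> 1" and eq: "A x = B x" for x
    proof -
      consider "norm x < \<rho>" | "\<rho> < norm x" "norm x < 1" | "1 < norm x" using x by linarith
      then show ?thesis
      proof cases
        case 1
        then have "A x = M" using eq V2(4) [of "norm x"] by (simp add: B_def)
        then have "\<not> norm (x - c) < \<rho>" using V1(3) [of "norm (x - c)"] by (auto simp: A_def)
        then show ?thesis using 1 by (simp add: GA_def GB_def radgrad_def clampf'_def)
      next
        case 2
        then have "\<rho> < norm (x - c)" using x eq by (auto simp: S_def)
        then have "A x = M" by (simp add: A_def V1)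
        moreover have "B x < M" using 2 by (simp add: B_def V2)
        ultimately show ?thesis using eq by simp
      next
        case 3
        then have "A x = 0" using eq by (simp add: B_def V2)
        then have "\<not> r < norm (x - c)" using V1(6) [of "norm (x - c)"] by (auto simp: A_def)
        moreover have "norm x \<le> norm c + norm (x - c)" using norm_triangle_sub [of x c] by simp
        ultimately show ?thesis using 3 nc t by linarith
      qed
    qed
    have "(max L1 L2)-lipschitz_on UNIV f"
    proof (rule lipschitz_onI)
      fix x y
      have "\<bar>A x - A y\<bar> \<le> L1 * dist x y" "\<bar>B x - B y\<bar> \<le> L2 * dist x y"
        using lipschitz_onD [OF L1(1), of x y] lipschitz_onD [OF L2(1), of x y] by (auto simp: dist_real_def)
      moreover have "L1 * dist x y \<le> max L1 L2 * dist x y" "L2 * dist x y \<le> max L1 L2 * dist x y"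
        by (intro mult_right_mono; simp)+
      ultimately show "dist (f x) (f y) \<le> max L1 L2 * dist x y"
        unfolding f_def dist_real_def by (auto simp: min_def abs_le_iff)
    qed (use lipschitz_on_nonneg [OF L1(1)] in simp)
    moreover have "norm (G x) \<le> max L1 L2" for x
      using L1(2) [of x] L2(2) [of x] by (auto simp: G_def)
    moreover have "norm x \<le> 2" if "f x \<noteq> 0 \<or> G x \<noteq> 0" for x
    proof (rule ccontr)
      assume "\<not> norm x \<le> 2"
      then have n: "norm x > 2" by simp
      then have "B x = 0" by (simp add: B_def V2)
      then have "f x = 0" "\<not> A x < B x" using A01(1) [of x] by (auto simp: f_def)
      moreover have "GB x = 0" using n by (simp add: GB_def radgrad_def clampf'_def)
      ultimately show False using that by (simp add: G_def)
    qed
    moreover have "G \<in> borel_measurable borel" unfolding G_def by measurable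
    moreover have "AE x in lborel. (f has_derivative (\<lambda>h. G x \<bullet> h)) (at x)"
      using AES AE_norm_diff_ne [of c r] AE_norm_diff_ne [of c \<rho>] AE_norm_diff_ne [of c 0]
        AE_norm_diff_ne [of 0 \<rho>] AE_norm_diff_ne [of 0 1] AE_norm_diff_ne [of 0 0]
    proof eventually_elim
      case (elim x)
      have dA: "(A has_derivative (\<lambda>h. GA x \<bullet> h)) (at x)"
        unfolding A_def [abs_def] GA_def by (rule clampf_norm_has_derivative [OF p v ab1]) (use elim in auto)
      have dB: "(B has_derivative (\<lambda>h. GB x \<bullet> h)) (at x)"
        using clampf_norm_has_derivative [OF p v ab2, of x 0] elim by (simp add: B_def [abs_def] GB_def)
      have "(f has_derivative (if A x < B x then (\<lambda>h. GA x \<bullet> h) else (\<lambda>h. GB x \<bullet> h))) (at x)"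
        unfolding f_def [abs_def]
      proof (rule has_derivative_min [OF dA dB])
        assume "A x = B x"
        from eq0 [OF _ _ _ _ _ this] elim have "GA x = GB x" by simp
        then show "(\<lambda>h. GA x \<bullet> h) = (\<lambda>h. GB x \<bullet> h)" by simp
      qed
      then show ?case by (cases "A x < B x") (auto simp: G_def)
    qed
    ultimately show lg: "lipgrad f G" unfolding lipgrad_def by blast
    have powr_bound: "\<bar>s powr p\<bar> \<le> M powr p" if "0 \<le> s" "s \<le> M" for s
      using that p by (simp add: powr_mono2)
    let ?G0 = "\<lambda>x::real^'n. radgrad ?D0 (x - 0)" and ?f0 = "\<lambda>x::real^'n. ?V0 (norm (x - 0))"
    have lg0: "lipgrad ?f0 ?G0"
      by (rule nodal_piece(1) [OF p v ab0 N pos v1]) (use vr in auto)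
    have E0: "(\<integral>x. norm (?G0 x) powr p \<partial>lborel) = \<mu> * (\<integral>x. \<bar>?f0 x\<bar> powr p \<partial>lborel)"
      by (rule nodal_piece(4) [OF p v ab0 N pos v1]) (use vr in auto)
    have iGA0: "integrable lborel (\<lambda>x::real^'n. norm (radgrad ?D1 x) powr p)"
    proof -
      have [measurable]: "(\<lambda>x::real^'n. radgrad ?D1 x) \<in> borel_measurable borel"
        using radgrad_measurable [OF p v ab1, of 0] by simp
      show ?thesis
      proof (rule integrable_bounded_support [where M = "L1 powr p" and B = 1])
        fix x :: "real^'n"
        have "norm (radgrad ?D1 x) \<le> L1" using L1(2) [of "x + c"] by (simp add: GA_def)
        then show "\<bar>norm (radgrad ?D1 x) powr p\<bar> \<le> L1 powr p" using p by (simp add: powr_mono2)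
        show "norm x \<le> 1" if "norm (radgrad ?D1 x) powr p \<noteq> 0"
          using that rho by (auto simp: radgrad_def clampf'_def split: if_splits)
      qed measurable
    qed
    have mA0: "(\<lambda>x::real^'n. norm (radgrad ?D1 x) powr p) \<in> borel_measurable borel"
      using borel_measurable_integrable [OF iGA0] by simp
    have iGA: "integrable lborel (\<lambda>x. norm (GA x) powr p)"
      unfolding GA_def by (rule iffD2 [OF integrable_lborel_diff [OF mA0] iGA0])
    have iGB: "integrable lborel (\<lambda>x. norm (GB x) powr p)"
    proof (rule integrable_bounded_support [where M = "L2 powr p" and B = 1])
      fix x
      show "\<bar>norm (GB x) powr p\<bar> \<le> L2 powr p" using L2(2) [of x] p by (simp add: powr_mono2)
      show "norm x \<le> 1" if "norm (GB x) powr p \<noteq> 0"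
        using that by (auto simp: GB_def radgrad_def clampf'_def split: if_splits)
    qed measurable
    \<comment> \<open>\<open>G\<close> equals one of the two gradients at each point, so its energy
      is at most the sum of both; moving A back to the centre recovers the energy of the full
      piece.\<close>
    have "(\<integral>x. norm (G x) powr p \<partial>lborel) \<le> (\<integral>x. norm (GA x) powr p + norm (GB x) powr p \<partial>lborel)"
      by (rule integral_mono [OF lipgrad_integrable(1) [OF p lg] Bochner_Integration.integrable_add [OF iGA iGB]])
        (auto simp: G_def)
    also have "\<dots> = (\<integral>x. norm (GA x) powr p \<partial>lborel) + (\<integral>x. norm (GB x) powr p \<partial>lborel)"
      by (rule Bochner_Integration.integral_add [OF iGA iGB])
    also have "(\<integral>x. norm (GA x) powr p \<partial>lborel) = (\<integral>x. norm (radgrad ?D1 (x :: real^'n)) powr p \<partial>lborel)"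
      unfolding GA_def by (rule integral_lborel_diff [OF mA0])
    also have "\<dots> + (\<integral>x. norm (GB x) powr p \<partial>lborel) = (\<integral>x. norm (radgrad ?D1 x) powr p + norm (GB x) powr p \<partial>lborel)"
      by (rule Bochner_Integration.integral_add [symmetric, OF iGA0 iGB])
    also have "\<dots> = (\<integral>x. norm (?G0 x) powr p \<partial>lborel)"
    proof (rule Bochner_Integration.integral_cong [OF refl])
      fix x :: "real^'n"
      have "?D1 0 = 0" "?D2 0 = 0" "?D0 0 = 0" using r rho by (auto simp: clampf'_def)
      moreover have "\<bar>?D1 s\<bar> powr p + \<bar>?D2 s\<bar> powr p = \<bar>?D0 s\<bar> powr p" for s
        using rho p by (cases s \<rho> rule: linorder_cases) (auto simp: clampf'_def)
      ultimately show "norm (radgrad ?D1 x) powr p + norm (GB x) powr p = norm (?G0 x) powr p"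
        by (simp add: GB_def norm_radgrad)
    qed
    finally have En: "(\<integral>x. norm (G x) powr p \<partial>lborel) \<le> \<mu> * (\<integral>x. \<bar>?f0 x\<bar> powr p \<partial>lborel)"
      unfolding E0 .
    \<comment> \<open>A equals M outside a ball and is not integrable there, so the comparison is
      made with differences from M^p, which have bounded support.\<close>
    let ?D = "\<lambda>x. M powr p - max (A x) (B x) powr p"
    let ?H = "\<lambda>x::real^'n. M powr p - A0 x powr p"
    have A0c: "continuous_on UNIV A0"
      unfolding A0_def [abs_def] by (intro continuous_on_compose2 [OF clampf_cont [OF p v ab1]] continuous_intros) auto
    have [measurable]: "A0 \<in> borel_measurable borel" by (rule borel_measurable_continuous_onI [OF A0c])
    have A0b: "0 \<le> A0 x" "A0 x \<le> M" for x by (simp_all add: A0_def V1)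
    have iH: "integrable lborel ?H"
    proof (rule integrable_bounded_support [where M = "M powr p" and B = 1])
      fix x :: "real^'n"
      show "\<bar>?H x\<bar> \<le> M powr p" using powr_bound [OF A0b, of x] A0b [of x] powr_ge_zero [of "A0 x" p] by linarith
      show "norm x \<le> 1" if "?H x \<noteq> 0"
        using that V1(4) [of "norm x"] rho by (auto simp: A0_def intro: leI)
    qed measurable
    have mH: "?H \<in> borel_measurable borel" by measurable
    have Adef: "A x = A0 (x - c)" for x by (simp add: A_def A0_def)
    have iHc: "integrable lborel (\<lambda>x. M powr p - A x powr p)"
      using integrable_lborel_diff [OF mH, of c] iH by (simp add: Adef)
    have eHc: "(\<integral>x. M powr p - A x powr p \<partial>lborel) = (\<integral>x. ?H x \<partial>lborel)"
      using integral_lborel_diff [OF mH, of c] by (simp add: Adef)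
    have iB: "integrable lborel (\<lambda>x. B x powr p)"
    proof (rule integrable_bounded_support [where M = "M powr p" and B = 1])
      fix x :: "real^'n"
      show "\<bar>B x powr p\<bar> \<le> M powr p" by (rule powr_bound [OF B01])
      show "norm x \<le> 1" if "B x powr p \<noteq> 0"
        using that V2(5) [of "norm x"] by (cases "norm x \<le> 1") (auto simp: B_def)
    qed measurable
    have ifp: "integrable lborel (\<lambda>x. f x powr p)"
      using lipgrad_integrable(2) [OF p lg] f0le by simp
    have minmax: "f x powr p + max (A x) (B x) powr p = A x powr p + B x powr p" for x
      by (auto simp: f_def min_def max_def)
    have iD: "integrable lborel ?D"
    proof -
      have "integrable lborel (\<lambda>x. f x powr p - B x powr p + (M powr p - A x powr p))"
        by (intro Bochner_Integration.integrable_add Bochner_Integration.integrable_diff ifp iB iHc)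
      moreover have "f x powr p - B x powr p + (M powr p - A x powr p) = ?D x" for x
        using minmax [of x] by linarith
      ultimately show ?thesis by simp
    qed
    have Dpos: "0 < (\<integral>x. ?D x \<partial>lborel)"
    proof (rule integral_pos_continuous [OF _ _ iD])
      show "continuous_on UNIV ?D"
        using p A01 B01 by (intro continuous_on_diff continuous_on_const continuous_on_powr' continuous_on_max Ac Bc) (auto simp: max_def)
      show "0 \<le> ?D x" for x
        using p A01 [of x] B01 [of x] by (simp add: powr_mono2 max_def)
      \<comment> \<open>This point has distance \<rho> + t / 2 from 0 and \<rho> - t / 2 from c, so
        both parts are strictly below M.\<close>
      let ?x = "(\<rho> + t / 2) *\<^sub>R e"
      have nx: "norm ?x = \<rho> + t / 2" unfolding norm_scaleR using e t rho r by simp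
      have "?x - c = (\<rho> + t / 2 - t) *\<^sub>R e" unfolding c_def by (rule scaleR_left_diff_distrib [symmetric])
      then have nxc: "norm (?x - c) = \<rho> - t / 2" using e t by simp
      have "A ?x < M" unfolding A_def nxc by (rule V1(3)) (use t in simp)
      moreover have "B ?x < M" unfolding B_def nx by (rule V2(3)) (use t in simp)
      ultimately have "max (A ?x) (B ?x) < M" by simp
      then have "max (A ?x) (B ?x) powr p < M powr p"
        using p A01 [of ?x] by (intro powr_less_mono2) (auto simp: max_def)
      then show "?D ?x \<noteq> 0" by simp
    qed
    have "(\<integral>x. f x powr p \<partial>lborel) = (\<integral>x. B x powr p - (M powr p - A x powr p) + ?D x \<partial>lborel)"
      by (rule Bochner_Integration.integral_cong [OF refl]) (use minmax in \<open>simp add: algebra_simps\<close>)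
    also have "\<dots> = (\<integral>x. B x powr p - (M powr p - A x powr p) \<partial>lborel) + (\<integral>x. ?D x \<partial>lborel)"
      by (rule Bochner_Integration.integral_add [OF Bochner_Integration.integrable_diff [OF iB iHc] iD])
    also have "(\<integral>x. B x powr p - (M powr p - A x powr p) \<partial>lborel) = (\<integral>x. B x powr p \<partial>lborel) - (\<integral>x. ?H x \<partial>lborel)"
      unfolding eHc [symmetric] by (rule Bochner_Integration.integral_diff [OF iB iHc])
    also have "\<dots> = (\<integral>x. B x powr p - ?H x \<partial>lborel)"
      by (rule Bochner_Integration.integral_diff [symmetric, OF iB iH])
    also have "\<dots> = (\<integral>x. \<bar>?f0 x\<bar> powr p \<partial>lborel)"
    proof (rule Bochner_Integration.integral_cong [OF refl])
      fix x :: "real^'n"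
      have f00: "0 \<le> ?f0 x"
        by (rule nodal_piece(2) [OF p v ab0 N pos v1]) (use vr in auto)
      show "B x powr p - ?H x = \<bar>?f0 x\<bar> powr p"
      proof (cases "norm x \<le> \<rho>")
        case True
        then have "?f0 x = A0 x" "B x = M"
          using rho by (auto simp: A0_def B_def M_def clampf_def)
        then show ?thesis using f00 by simp
      next
        case False
        then have "?f0 x = B x" "A0 x = M"
          using rho by (auto simp: A0_def B_def M_def clampf_def max_def min_def)
        then show ?thesis using f00 by simp
      qed
    qed
    finally have "(\<integral>x. \<bar>?f0 x\<bar> powr p \<partial>lborel) < (\<integral>x. f x powr p \<partial>lborel)" using Dpos by simp
    then have "\<mu> * (\<integral>x. \<bar>?f0 x\<bar> powr p \<partial>lborel) < \<mu> * (\<integral>x. \<bar>f x\<bar> powr p \<partial>lborel)"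
      using mu f0le by simp
    with En show "(\<integral>x. norm (G x) powr p \<partial>lborel) < \<mu> * (\<integral>x. \<bar>f x\<bar> powr p \<partial>lborel)"
      by (rule le_less_trans)
  qed
qed

end

section \<open>Assembling the competitors\<close>

lemma radsol_uminus:
  assumes p: "p > 1" and u: "radsol N p \<mu> R u u'"
  shows "radsol N p \<mu> R (\<lambda>s. - u s) (\<lambda>s. - u' s)"
  unfolding radsol_def
proof (intro conjI ballI)
  show "continuous_on {0..R} (\<lambda>s. - u' s)" by (intro continuous_intros radsol_cont' [OF p u])
  show "- u' 0 = 0" using radsol_deriv0 [OF p u] by simp
  show "((\<lambda>s. - u s) has_real_derivative - u' s) (at s within {0..R})" if "s \<in> {0..R}" for s
    by (rule DERIV_minus [OF radsol_deriv_within [OF p u that]])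
  show "((\<lambda>s. s ^ (N - 1) * phi_p p (- u' s)) has_real_derivative - \<mu> * s ^ (N - 1) * phi_p p (- u s)) (at s)"
    if "s \<in> {0<..<R}" for s
    using DERIV_minus [OF radsol_flux_deriv [OF p u that]] by (simp add: phi_p_minus)
qed

lemma continuous_nonzero_same_sign:
  fixes u :: "real \<Rightarrow> real"
  assumes c: "continuous_on {a<..<b} u" and ne: "\<And>s. a < s \<Longrightarrow> s < b \<Longrightarrow> u s \<noteq> 0"
    and m: "a < m" "m < b" "0 < u m" and s: "a < s" "s < b"
  shows "0 < u s"
proof (rule ccontr)
  assume "\<not> 0 < u s"
  then have neg: "u s < 0" using ne [OF s] by simp
  have "connected (u ` {a<..<b})" by (rule connected_continuous_image [OF c]) simp
  then have "0 \<in> u ` {a<..<b}"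
    by (rule connectedD_interval [of _ "u s" "u m"]) (use s m neg in auto)
  then show False using ne by auto
qed

text \<open>Between its zeros a solution has one sign; u or -u gives the nonnegative profile that
  \<open>nodal_piece\<close> expects, with the same zeros.\<close>

lemma radsol_sign:
  assumes p: "p > 1" and u: "radsol N p \<mu> R u u'" and ab: "0 \<le> a" "a < b" "b \<le> R"
    and ne: "\<And>s. a < s \<Longrightarrow> s < b \<Longrightarrow> u s \<noteq> 0"
  obtains v v' where "radsol N p \<mu> R v v'" "\<And>s. a < s \<Longrightarrow> s < b \<Longrightarrow> 0 < v s" "\<And>s. u s = 0 \<Longrightarrow> v s = 0"
proof -
  let ?m = "(a + b) / 2"
  have m: "a < ?m" "?m < b" using ab by auto
  have c: "continuous_on {a<..<b} u"
    by (rule continuous_on_subset [OF radsol_cont [OF p u]]) (use ab in auto)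
  show ?thesis
  proof (cases "u ?m > 0")
    case True
    have "0 < u s" if "a < s" "s < b" for s
      by (rule continuous_nonzero_same_sign [OF c ne m True that])
    from that [OF u this] show ?thesis by simp
  next
    case False
    then have mneg: "0 < - u ?m" using ne [OF m] by simp
    have "0 < - u s" if "a < s" "s < b" for s
      by (rule continuous_nonzero_same_sign [of a b "\<lambda>s. - u s", OF _ _ m mneg that])
        (use ne in \<open>auto intro!: continuous_intros c\<close>)
    from that [OF radsol_uminus [OF p u] this] show ?thesis by simp
  qed
qed

theorem theorem1p1:
  fixes p :: real and k :: nat
  assumes "CARD('n::finite) \<ge> 2" and "p > 1" and "k \<ge> 2"
  shows "lambda_var (ball (0::real^'n) 1) p k < mu_rad CARD('n) p k"
proof -
  note p = assms(2) and k = assms(3)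
  let ?N = "CARD('n)" and ?\<Omega> = "ball (0::real^'n) 1"
  obtain R U U' z where U: "radsol ?N p 1 R U U'" and R: "R > 0" and U0: "U 0 \<noteq> 0" and z0: "z 0 = (0::real)"
    and zR: "z k \<le> R" and zmono: "\<And>i. i < k \<Longrightarrow> z i < z (Suc i)"
    and zz: "\<And>i. 1 \<le> i \<Longrightarrow> i \<le> k \<Longrightarrow> U (z i) = 0"
    and nz: "\<And>i r. i < k \<Longrightarrow> z i < r \<Longrightarrow> r < z (Suc i) \<Longrightarrow> U r \<noteq> 0"
    by (rule ex_radial_nodes [OF p, where k = k and N = ?N]) (rule that)
  define \<mu> where "\<mu> = z k powr p"
  have mu_eq: "mu_rad ?N p k = \<mu>"
    unfolding \<mu>_def by (rule mu_rad_eqI [OF p k U _ U0 z0 zR zmono zz nz]) (use R in auto)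
  have zless: "z i < z j" if "i < j" "j \<le> k" for i j
    using that
  proof (induction j)
    case (Suc j)
    then show ?case using zmono [of j] by (cases "i = j") auto
  qed simp
  have zle: "z i \<le> z j" if "i \<le> j" "j \<le> k" for i j using zless [of i j] that by (cases "i = j") auto
  have zpos: "0 < z i" if "1 \<le> i" "i \<le> k" for i using zless [of 0 i] that z0 by simp
  have zk: "z k > 0" using zpos [of k] k by simp
  have mu: "\<mu> > 0" using zk by (simp add: \<mu>_def)
  \<comment> \<open>The position of the last interior zero once z k is scaled to 1: inner radius of
    the outermost piece.\<close>
  define r where "r = z (k - 1) / z k"
  have zk1: "0 < z (k - 1)" "z (k - 1) < z k" using zpos [of "k - 1"] zless [of "k - 1" k] k by auto
  have r: "0 < r" "r < 1" using zk1 by (auto simp: r_def)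
  have V: "radsol ?N p \<mu> 1 (\<lambda>s. U (z k * s)) (\<lambda>s. z k * U' (z k * s))"
    using radsol_restrict [OF radsol_scale [OF p U zk], of 1] zk zR by (simp add: \<mu>_def)
  have Vne: "U (z k * s) \<noteq> 0" if "r < s" "s < 1" for s
    using nz [of "k - 1" "z k * s"] that k zk by (simp add: r_def divide_less_eq mult.commute)
  obtain v v' where v: "radsol ?N p \<mu> 1 v v'" and vpos: "\<And>s. r < s \<Longrightarrow> s < 1 \<Longrightarrow> 0 < v s"
    and vz: "\<And>s. U (z k * s) = 0 \<Longrightarrow> v s = 0"
    by (rule radsol_sign [OF p V less_imp_le [OF r(1)] r(2) order_refl Vne]) (assumption | rule that | blast)+
  have vr: "v r = 0" using vz [of r] zz [of "k - 1"] k zk by (simp add: r_def)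
  have v1: "v 1 = 0" using vz [of 1] zz [of k] k by simp
  obtain w :: "real^'n \<Rightarrow> real" and Gw c where w: "lipgrad w Gw" and w0: "\<And>x. 0 \<le> w x"
    and wsup: "\<And>x. 0 < w x \<Longrightarrow> norm x < 1 \<and> r < norm (x - c)" and c: "norm c + r < 1"
    and wE: "(\<integral>x. norm (Gw x) powr p \<partial>lborel) < \<mu> * (\<integral>x. \<bar>w x\<bar> powr p \<partial>lborel)"
    by (rule outer_competitor [OF p v mu r vpos vr v1 refl]) (assumption | rule that | blast)+
  \<comment> \<open>The outer competitor may touch the ball of radius r around c. Part of its strict
    gain is traded for a gap.\<close>
  obtain \<delta> g Gg where d: "\<delta> > 0" and g: "lipgrad g Gg" and g0: "\<And>x. 0 \<le> g x" and gw: "\<And>x. g x \<noteq> 0 \<Longrightarrow> \<delta> \<le> w x"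
    and gE: "(\<integral>x. norm (Gg x) powr p \<partial>lborel) < \<mu> * (\<integral>x. \<bar>g x\<bar> powr p \<partial>lborel)"
    by (rule ex_trunc_rayleigh [OF p w w0 wE]) (rule that)
  \<comment> \<open>On the compact set where w \<ge> \<delta>, the distance to c attains its
    minimum, which exceeds r because w is positive there.\<close>
  obtain r' where r': "r < r'" and gr': "\<And>x. g x \<noteq> 0 \<Longrightarrow> r' \<le> norm (x - c)"
  proof -
    obtain L B where "L-lipschitz_on UNIV w" "\<And>x. w x \<noteq> 0 \<Longrightarrow> norm x \<le> B"
      using w unfolding lipgrad_def by blast
    then have C: "compact {x. \<delta> \<le> w x}" by (rule lipschitz_superlevel_compact [OF _ _ d])
    show ?thesis
    proof (cases "{x. \<delta> \<le> w x} = {}")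
      case True
      then have "g x = 0" for x using gw [of x] by auto
      then show ?thesis using that [of "r + 1"] by simp
    next
      case False
      have "continuous_on {x. \<delta> \<le> w x} (\<lambda>x. norm (x - c))" by (intro continuous_intros)
      then obtain y where y: "\<delta> \<le> w y" "\<And>x. \<delta> \<le> w x \<Longrightarrow> norm (y - c) \<le> norm (x - c)"
        using continuous_attains_inf [OF C False] by blast
      show ?thesis
        by (rule that [of "norm (y - c)"]) (use wsup [of y] y d gw in auto)
    qed
  qed
  \<comment> \<open>The dilation factor of the inner ball: q * r \<le> r' keeps it off the outer
    competitor, and q * r \<le> 1 - norm c keeps it in the unit ball.\<close>
  define q where "q = min (r' / r) ((1 - norm c) / r)"
  have q1: "q > 1" using r r' c by (simp add: q_def)
  have qr: "q * r \<le> r'" "q * r \<le> 1 - norm c"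
    using r by (simp_all add: q_def min_mult_distrib_right)
  \<comment> \<open>Rescaling U by \<tau> instead of z k dilates all nodes by q, so that the node k
    - 1 lies at q * r, and lowers the eigenvalue to \<tau>^p < \<mu>.\<close>
  define \<tau> where "\<tau> = z k / q"
  have tau: "\<tau> > 0" using zk q1 by (simp add: \<tau>_def)
  have mu': "\<tau> powr p < \<mu>"
    unfolding \<mu>_def using zk q1 p by (intro powr_less_mono2) (auto simp: \<tau>_def divide_less_eq)
  have Ut: "radsol ?N p (\<tau> powr p) (R / \<tau>) (\<lambda>s. U (\<tau> * s)) (\<lambda>s. \<tau> * U' (\<tau> * s))"
    using radsol_scale [OF p U tau] by simp
  have zt: "z i / \<tau> \<le> q * r" if "i \<le> k - 1" for i
  proof -
    have "z i \<le> z (k - 1)" using zle [of i "k - 1"] that by simp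
    then have "z i / \<tau> \<le> z (k - 1) / \<tau>" using tau by (simp add: divide_right_mono)
    also have "\<dots> = q * r" using zk q1 by (simp add: \<tau>_def r_def)
    finally show ?thesis .
  qed
  \<comment> \<open>These are the k - 1 inner pieces, all centred at c, with quotient exactly
    \<tau>^p; the index k - 1 is reserved for the outer function g.\<close>
  have piece: "\<exists>f G. lipgrad f G \<and> (\<forall>x::real^'n. 0 \<le> f x) \<and>
      (\<forall>x. 0 < f x \<longrightarrow> norm (x - c) < z (Suc i) / \<tau> \<and> (0 < i \<longrightarrow> z i / \<tau> < norm (x - c))) \<and>
      (\<integral>x. norm (G x) powr p \<partial>lborel) < \<mu> * (\<integral>x. \<bar>f x\<bar> powr p \<partial>lborel)" if i: "i < k - 1" for i
  proof -
    have ab: "0 \<le> z i / \<tau>" "z i / \<tau> < z (Suc i) / \<tau>" "z (Suc i) / \<tau> \<le> R / \<tau>"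
    proof -
      have "0 \<le> z i" "z i < z (Suc i)" "z (Suc i) \<le> z k"
        using zle [of 0 i] zmono [of i] zle [of "Suc i" k] i z0 by simp_all
      moreover from this(3) have "z (Suc i) \<le> R" using zR by (rule order_trans)
      ultimately show "0 \<le> z i / \<tau>" "z i / \<tau> < z (Suc i) / \<tau>" "z (Suc i) / \<tau> \<le> R / \<tau>"
        using tau by (simp_all add: divide_strict_right_mono divide_right_mono)
    qed
    have "U (\<tau> * s) \<noteq> 0" if "z i / \<tau> < s" "s < z (Suc i) / \<tau>" for s
      using nz [of i "\<tau> * s"] that i tau by (simp add: field_simps)
    then obtain u u' where u: "radsol ?N p (\<tau> powr p) (R / \<tau>) u u'"
      and upos: "\<And>s. z i / \<tau> < s \<Longrightarrow> s < z (Suc i) / \<tau> \<Longrightarrow> 0 < u s" and uz: "\<And>s. U (\<tau> * s) = 0 \<Longrightarrow> u s = 0"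
      using radsol_sign [OF p Ut ab] by metis
    have ub: "u (z (Suc i) / \<tau>) = 0" using uz [of "z (Suc i) / \<tau>"] zz [of "Suc i"] i tau by simp
    have ua: "z i / \<tau> = 0 \<or> u (z i / \<tau>) = 0"
      using uz [of "z i / \<tau>"] zz [of i] i tau z0 by (cases "i = 0") auto
    note P = nodal_piece [OF p u ab refl upos ub ua, where c = c]
    have zi: "0 < z i / \<tau>" if "0 < i" using zpos [of i] that i tau by simp
    let ?f = "\<lambda>x::real^'n. clampf u (z i / \<tau>) (z (Suc i) / \<tau>) (norm (x - c))"
    have "(\<tau> powr p) * (\<integral>x. \<bar>?f x\<bar> powr p \<partial>lborel) < \<mu> * (\<integral>x. \<bar>?f x\<bar> powr p \<partial>lborel)"
      using P(5) mu' by (rule mult_strict_right_mono [rotated])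
    then show ?thesis
      using P(1-4) zi by (intro exI [of _ ?f] exI [of _ "\<lambda>x. radgrad (clampf' u' (z i / \<tau>) (z (Suc i) / \<tau>)) (x - c)"]) auto
  qed
  define Q where "Q i f G \<longleftrightarrow> lipgrad f G \<and> (\<forall>x::real^'n. 0 \<le> f x) \<and>
      (\<forall>x. 0 < f x \<longrightarrow> norm (x - c) < z (Suc i) / \<tau> \<and> (0 < i \<longrightarrow> z i / \<tau> < norm (x - c))) \<and>
      (\<integral>x. norm (G x) powr p \<partial>lborel) < \<mu> * (\<integral>x. \<bar>f x\<bar> powr p \<partial>lborel)" for i f G
  have "\<forall>i. \<exists>f G. i < k - 1 \<longrightarrow> Q i f G" using piece unfolding Q_def by blast
  then obtain f0 G0 where fG0: "\<And>i. i < k - 1 \<Longrightarrow> Q i (f0 i) (G0 i)" by metis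
  define f where "f i = (if i < k - 1 then f0 i else g)" for i
  define G where "G i = (if i < k - 1 then G0 i else Gg)" for i
  have "lambda_var ?\<Omega> p k < \<mu>"
  proof (rule lambda_var_less_lipgrad [of ?\<Omega> p k f G])
    show "open ?\<Omega>" by simp
    show "p > 1" by (rule p)
    show "k \<ge> 1" using k by simp
    fix i assume i: "i < k"
    show "lipgrad (f i) (G i)" using fG0 [of i] g by (auto simp: f_def G_def Q_def)
    show fi0: "0 \<le> f i x" for x using fG0 [of i] g0 by (auto simp: f_def Q_def)
    show "(\<integral>x. norm (G i x) powr p \<partial>lborel) < \<mu> * (\<integral>x. \<bar>f i x\<bar> powr p \<partial>lborel)"
      using fG0 [of i] gE by (auto simp: f_def G_def Q_def)
    have inner: "norm (x - c) < z (Suc i) / \<tau>" "0 < i \<longrightarrow> z i / \<tau> < norm (x - c)" if "i < k - 1" "0 < f i x" for i x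
      using fG0 [OF that(1)] that by (auto simp: f_def Q_def)
    have inner_le: "norm (x - c) < q * r" if "i < k - 1" "0 < f i x" for i x
      using inner(1) [OF that] zt [of "Suc i"] that(1) by simp
    have outer: "q * r \<le> norm (x - c) \<and> 0 < w x" if "\<not> i < k - 1" "0 < f i x" for i x
      using that gr' [of x] gw [of x] d qr by (auto simp: f_def)
    show "x \<in> ?\<Omega>" if "0 < f i x" for x
    proof (cases "i < k - 1")
      case True
      have "norm x \<le> norm c + norm (x - c)" using norm_triangle_sub [of x c] by simp
      then show ?thesis using inner_le [OF True that] qr by simp
    next
      case False
      then show ?thesis using outer [OF False that] wsup [of x] by simp
    qed
    fix j x assume j: "j < k" "i \<noteq> j" and fi: "0 < f i x"
    show "f j x = 0"
    proof (rule ccontr)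
      assume "f j x \<noteq> 0"
      moreover have "0 \<le> f j x" using fG0 [of j] g0 by (auto simp: f_def Q_def)
      ultimately have fj: "0 < f j x" by simp
      \<comment> \<open>Two inner pieces are separated by a common node or a whole interval, and an
        inner piece from the outer function by the sphere of radius q * r around c.\<close>
      have *: False if "a < b" "b < k" "0 < f a x" "0 < f b x" for a b
      proof -
        have a: "a < k - 1" using that by simp
        show False
        proof (cases "b < k - 1")
          case True
          have "z (Suc a) / \<tau> \<le> z b / \<tau>"
            using zle [of "Suc a" b] that tau by (simp add: divide_right_mono)
          then show False using inner(1) [OF a that(3)] inner(2) [OF True that(4)] that(1) by auto
        next
          case False
          then show False using inner_le [OF a that(3)] outer [OF False that(4)] by simp
        qed
      qed
      show False using * [of i j] * [of j i] i j fi fj by (cases "i < j") auto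
    qed
  qed
  then show ?thesis by (simp add: mu_eq)
qed

end
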